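(* Let $K$ be a field whose characteristic is not $2$, $3$, or $7$. Let $s \in K$ and let $c_4, c_2, c_0, d \in K$ be the elements defined from $s$ in the context. Suppose $c_0 d \neq 0$, and let $C_{24}^s$ be the genus-$2$ curve over $K$ given by \[ d y^2 = x^6 + c_4 x^4 + c_2 x^2 + c_0 . \] Let $D$ be the elliptic curve $y^2 = x^3 + 14 x^2 + 196 x$ over $K$. Suppose there is a nonzero point $(z,w)\in D(K)$ (i.e. a $K$-rational point other than the identity, the point at infinity) such that \[ s = -21 \cdot \frac{(z^2 + 196) (z^2 + 56 z + 196) + 32 (z + 14) (z - 14) w} {z^4 - 896 z^3 - 24696 z^2 - 175616 z + 38416}. \] Then there is a $K$-rational point of order exactly $48$ on the Jacobian of $C_{24}^s$.
   Context: For $s\in K$ (with $\operatorname{char} K \notin\{2,3,7\}$), set \begin{align*} c_4 &= -31 \left(s^4 + 42 s^2 - 147\right) + \tfrac{32200}{3}\, s,\\ c_2 &= 2^8 \left(s^8 + 84 s^6 - \tfrac{3472}{3} s^5 + 1470 s^4 - 48608 s^3 + 53508 s^2 + 170128 s + 21609\right),\\ c_0 &= \tfrac{2^{20} \cdot 7}{3}\, s\, (s^2 + 7)^3 (s^2 + 63),\\ d &= s^4 + 42 s^2 + \tfrac{1736}{3} s - 147. \end{align*} When $c_0 d\ne 0$, the equation $d y^2 = x^6 + c_4 x^4 + c_2 x^2 + c_0$ defines a nonsingular genus-$2$ curve over $K$; here a curve given by an affine equation $dy^2=f(x)$ with $f$ a separable sextic means the smooth projective curve with that affine model, and its Jacobian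 is the associated principally polarized abelian surface over $K$. The displayed formula for $s$ is understood to require that its denominator is nonzero. *)

theory Defs
  imports
    "HOL-Algebra.Algebraic_Closure_Type"
    "HOL-Algebra.Free_Abelian_Groups"
    "HOL-Algebra.Multiplicative_Group"
    "HOL-Computational_Algebra.Computational_Algebra"
begin

section \<open>Points of the smooth projective model\<close>

text \<open>
  The pair \<open>(d, f)\<close> stands for the curve \<open>d y\<^sup>2 = f(x)\<close> with \<open>d \<noteq> 0\<close> and \<open>f\<close> a separable
  sextic. Its smooth projective model is glued from the affine curve and the chart
  \<open>d v\<^sup>2 = u\<^sup>6 f(1/u)\<close>, where \<open>u = 1/x\<close> and \<open>v = y/x\<^sup>3\<close>; the points missing from the affine
  curve have \<open>u = 0\<close> and are denoted by their \<open>v\<close>-coordinate.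
\<close>

datatype 'a curve_point = Affine 'a 'a | At_Infinity 'a

definition curve_points :: "'a::field \<Rightarrow> 'a poly \<Rightarrow> 'a curve_point set" where
  "curve_points d f =
     {Affine x y | x y. d * y\<^sup>2 = poly f x} \<union>
     {At_Infinity v | v. d * v\<^sup>2 = Polynomial.coeff f 6}"


section \<open>The function field and orders of vanishing\<close>

text \<open>
  The pair \<open>(a, b)\<close> of rational functions in \<open>x\<close> represents the element \<open>a + b y\<close> of the
  function field, in which \<open>y\<^sup>2 = f/d\<close>.
\<close>

type_synonym 'a function_field = "'a poly fract \<times> 'a poly fract"

definition ff_of_base :: "'a::field poly fract \<Rightarrow> 'a function_field" where
  "ff_of_base a = (a, 0)"

definition ff_const :: "'a::field \<Rightarrow> 'a function_field" where
  "ff_const c = ff_of_base (Fract [:c:] 1)"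

definition ff_x :: "'a::field function_field" where
  "ff_x = ff_of_base (Fract [:0, 1:] 1)"

definition ff_y :: "'a::field function_field" where
  "ff_y = (0, 1)"

definition ff_zero :: "'a::field function_field" where
  "ff_zero = (0, 0)"

definition ff_add :: "'a::field function_field \<Rightarrow> 'a function_field \<Rightarrow> 'a function_field" where
  "ff_add g h = (fst g + fst h, snd g + snd h)"

definition ff_diff :: "'a::field function_field \<Rightarrow> 'a function_field \<Rightarrow> 'a function_field" where
  "ff_diff g h = (fst g - fst h, snd g - snd h)"

definition ff_mult ::
  "'a::field \<Rightarrow> 'a poly \<Rightarrow> 'a function_field \<Rightarrow> 'a function_field \<Rightarrow> 'a function_field" where
  "ff_mult d f g h =
     (fst g * fst h + Fract f [:d:] * (snd g * snd h), fst g * snd h + snd g * fst h)"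

text \<open>
  Normalized discrete valuations of the function field that are trivial on the constants.
  The value at zero is a dummy and stands for infinity.
\<close>

definition ff_valuation :: "'a::field \<Rightarrow> 'a poly \<Rightarrow> ('a function_field \<Rightarrow> int) \<Rightarrow> bool" where
  "ff_valuation d f v \<longleftrightarrow>
     (\<forall>g h. g \<noteq> ff_zero \<longrightarrow> h \<noteq> ff_zero \<longrightarrow> v (ff_mult d f g h) = v g + v h) \<and>
     (\<forall>g h. g \<noteq> ff_zero \<longrightarrow> h \<noteq> ff_zero \<longrightarrow> ff_add g h \<noteq> ff_zero \<longrightarrow>
        v (ff_add g h) \<ge> min (v g) (v h)) \<and>
     (\<forall>c. c \<noteq> 0 \<longrightarrow> v (ff_const c) = 0) \<and>
     (\<exists>g. g \<noteq> ff_zero \<and> v g = 1) \<and>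
     v ff_zero = 0"

text \<open>
  The valuation has centre \<open>P\<close> if the local coordinates that vanish at \<open>P\<close> (differences of
  \<open>x, y\<close> or of \<open>1/x, y/x\<^sup>3\<close> and their values at \<open>P\<close>) have positive valuation. These
  coordinates are never the zero function.
\<close>

fun centred_at :: "('a::field function_field \<Rightarrow> int) \<Rightarrow> 'a curve_point \<Rightarrow> bool" where
  "centred_at v (Affine \<alpha> \<beta>) \<longleftrightarrow>
     v (ff_diff ff_x (ff_const \<alpha>)) > 0 \<and> v (ff_diff ff_y (ff_const \<beta>)) > 0"
| "centred_at v (At_Infinity \<gamma>) \<longleftrightarrow>
     v (ff_of_base (Fract 1 [:0, 1:])) > 0 \<and>
     v (ff_diff (0, Fract 1 ([:0, 1:] ^ 3)) (ff_const \<gamma>)) > 0"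

text \<open>
  Over an algebraically closed field, the local ring at a point of the smooth model is a
  discrete valuation ring and \<open>ord_at d f P\<close> is its valuation.
\<close>

definition ord_at ::
  "'a::field \<Rightarrow> 'a poly \<Rightarrow> 'a curve_point \<Rightarrow> 'a function_field \<Rightarrow> int" where
  "ord_at d f P = (THE v. ff_valuation d f v \<and> centred_at v P)"


section \<open>Divisors and the Picard group\<close>

definition divisor_group :: "'a::field \<Rightarrow> 'a poly \<Rightarrow> ('a curve_point \<Rightarrow>\<^sub>0 int) monoid" where
  "divisor_group d f = free_Abelian_group (curve_points d f)"

definition divisor_degree :: "('p \<Rightarrow>\<^sub>0 int) \<Rightarrow> int" where
  "divisor_degree D = (\<Sum>P\<in>Poly_Mapping.keys D. Poly_Mapping.lookup D P)"

definition principal_divisors :: "'a::field \<Rightarrow> 'a poly \<Rightarrow> ('a curve_point \<Rightarrow>\<^sub>0 int) set" where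
  "principal_divisors d f =
     {D \<in> carrier (divisor_group d f).
        \<exists>g. g \<noteq> ff_zero \<and> (\<forall>P\<in>curve_points d f. Poly_Mapping.lookup D P = ord_at d f P g)}"

definition picard_group :: "'a::field \<Rightarrow> 'a poly \<Rightarrow> ('a curve_point \<Rightarrow>\<^sub>0 int) set monoid" where
  "picard_group d f = divisor_group d f Mod principal_divisors d f"


section \<open>Rational points of the Jacobian\<close>

definition field_automorphisms_over_base :: "('k::field alg_closure \<Rightarrow> 'k alg_closure) set" where
  "field_automorphisms_over_base =
     {\<sigma>. bij \<sigma> \<and> (\<forall>a b. \<sigma> (a + b) = \<sigma> a + \<sigma> b) \<and> (\<forall>a b. \<sigma> (a * b) = \<sigma> a * \<sigma> b) \<and>
         (\<forall>c. \<sigma> (to_ac c) = to_ac c)}"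

definition separable_closure :: "'k::field alg_closure set" where
  "separable_closure =
     {a. \<exists>p :: 'k poly. rsquarefree (map_poly to_ac p) \<and> poly (map_poly to_ac p) a = 0}"

definition galois_act ::
  "('a \<Rightarrow> 'a) \<Rightarrow> ('a curve_point \<Rightarrow>\<^sub>0 int) \<Rightarrow> ('a curve_point \<Rightarrow>\<^sub>0 int)" where
  "galois_act \<sigma> = frag_extend (\<lambda>P. frag_of (map_curve_point \<sigma> P))"

text \<open>
  For a curve \<open>C\<close> over a field \<open>K\<close> with Jacobian \<open>J\<close>, the group \<open>J(K)\<close> consists of the
  Galois-invariant elements of \<open>J(K\<^sup>s) = Pic\<^sup>0(C\<^sub>s)\<close>, where \<open>K\<^sup>s\<close> is the separable closure
  and \<open>C\<^sub>s\<close> the base change of \<open>C\<close> to it. This group embeds into the Picard group over the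
  algebraic closure as the set of classes of degree-zero divisors supported on
  \<open>K\<^sup>s\<close>-rational points. For perfect \<open>K\<close> the condition on the support is void; without it,
  the invariants would be the points over the perfect closure of \<open>K\<close>. The group structure
  is inherited from the Picard group.
\<close>

definition rational_divisor_classes ::
  "'k::field \<Rightarrow> 'k poly \<Rightarrow> ('k alg_closure curve_point \<Rightarrow>\<^sub>0 int) set set" where
  "rational_divisor_classes d f =
     {\<xi>. \<xi> \<in> carrier (picard_group (to_ac d) (map_poly to_ac f)) \<and>
         (\<exists>D\<in>\<xi>. divisor_degree D = 0 \<and>
            (\<forall>P\<in>Poly_Mapping.keys D. set_curve_point P \<subseteq> separable_closure)) \<and>
         (\<forall>\<sigma>\<in>field_automorphisms_over_base. galois_act \<sigma> ` \<xi> = \<xi>)}"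

definition jacobian_rational_points ::
  "'k::field \<Rightarrow> 'k poly \<Rightarrow> ('k alg_closure curve_point \<Rightarrow>\<^sub>0 int) set monoid" where
  "jacobian_rational_points d f =
     (picard_group (to_ac d) (map_poly to_ac f))\<lparr>carrier := rational_divisor_classes d f\<rparr>"


section \<open>The family of curves\<close>

definition c4 :: "'k::field \<Rightarrow> 'k" where
  "c4 s = - 31 * (s ^ 4 + 42 * s ^ 2 - 147) + 32200 / 3 * s"

definition c2 :: "'k::field \<Rightarrow> 'k" where
  "c2 s = 2 ^ 8 * (s ^ 8 + 84 * s ^ 6 - 3472 / 3 * s ^ 5 + 1470 * s ^ 4 - 48608 * s ^ 3
                     + 53508 * s ^ 2 + 170128 * s + 21609)"

definition c0 :: "'k::field \<Rightarrow> 'k" where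
  "c0 s = 2 ^ 20 * 7 / 3 * s * (s ^ 2 + 7) ^ 3 * (s ^ 2 + 63)"

definition d_coeff :: "'k::field \<Rightarrow> 'k" where
  "d_coeff s = s ^ 4 + 42 * s ^ 2 + 1736 / 3 * s - 147"

definition C24_sextic :: "'k::field \<Rightarrow> 'k poly" where
  "C24_sextic s = [:c0 s, 0, c2 s, 0, c4 s, 0, 1:]"

end

theory Submission
  imports Defs
begin

text \<open>
  With \<open>u = -28672 s / 3\<close>, \<open>x\<^sup>2 = u + d \<xi>\<close> and \<open>y = d \<eta>\<close>, the curve is a double cover of the constant
  elliptic curve \<open>\<eta>\<^sup>2 = \<xi> (\<xi>\<^sup>2 - 31 \<xi> + 256)\<close>, and the pullback of the point \<open>(8, 24)\<close> is a class \<open>q\<close> of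
  order 8 on the Jacobian. If a cubic \<open>m = 24 d + (x\<^sup>2 - u - 8 d) (k x + n)\<close> is such that
  \<open>d m\<^sup>2 - f\<close> is a constant times \<open>x\<^sup>2 - u - 8 d\<close> times a square, then the divisor of \<open>y - m\<close> shows that
  \<open>q\<close> is minus twice a rational class, of order 16. This amounts to \<open>8 d k\<^sup>2 = 8 - n\<^sup>2\<close> and
  \<open>(u + 8 d) (n\<^sup>2 - 8) = d (48 n + 120)\<close>, and a point of \<open>D\<close> solves these equations, except for a
  degenerate case \<open>n = \<infinity>\<close> in which \<open>q\<close> can be halved directly. The other elliptic quotient
  \<open>(1/x\<^sup>2, y/x\<^sup>3)\<close> has a rational flex, which pulls back to a class of order 3, and the sum of the
  two classes has order 48.

  To see that a class is nonzero it suffices that \<open>P + Q\<close> is equivalent to the divisor at infinity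
  only if \<open>Q\<close> is the hyperelliptic conjugate of \<open>P\<close>.
\<close>

section \<open>Parameters\<close>

text \<open>Every relation between classes comes from a function y - m with m a cubic in x: its
  poles lie at infinity and are at most triple, and d m^2 - f is d times its norm. If this sextic
  splits into three factors of formal degree 2, the divisors that they cut out on y = m add up to
  three times the divisor at infinity. The factors have coefficients in K, so each divisor is Galois
  invariant, and its points lie in quadratic extensions, which are separable because the
  characteristic is not 2. Only two classes have to be shown nonzero: the 2-torsion class t = 4 q
  and the flex class b. If 2 a = - q, then 24 (a + b) = t and 16 (a + b) = b. The order at a point
  is a definite description, so nothing can be computed before a valuation centred there is shown to
  exist and to be unique. Both questions are reduced to rational functions in x: a function A + B y
  is controlled by its norm A^2 - B^2 f/d, and where the norm cannot tell two conjugate points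
  apart, by approximating y by rational functions.\<close>

text \<open>
  On \<open>D\<close> put \<open>r = w/z\<close> and \<open>e = z - 196/z\<close>, so that \<open>z + 196/z = r\<^sup>2 - 14\<close> and \<open>s = -21 N/P\<close>.
  The polynomials \<open>V\<close>, \<open>L\<close> and \<open>M\<close> come from expanding the square roots of the right hand sides,
  as functions on \<open>D\<close>, at the point at infinity.
\<close>

lemma parameter_identities:
  fixes r e :: "'k::field"
  assumes e: "e^2 = (r^2 - 42) * (r^2 + 14)"
  defines "P \<equiv> (r^2-14)^2 - 896*(r^2-14) - 25088"
    and "N \<equiv> (r^2-14)*(r^2+42) + 32*r*e"
    and "V \<equiv> -4879139328 - 99574272*r^2 + 23708160*r^4 + 583296*r^6 + 672*r^8 + (37340352*r + 987840*r^3 + 39984*r^5)*e"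
    and "L \<equiv> -11239445952*r - 734360256*r^3 + 1926288*r^5 + 28224*r^7 + (-261382464 + 38229408*r^2 + 402192*r^4 + 504*r^6)*e"
    and "M \<equiv> 1829677248*r + 87127488*r^3 + 6964272*r^5 + 649152*r^7 + (1829677248 + 255159072*r^2 + 10224144*r^4 + 10584*r^6)*e"
  shows "V^2 = 2 * (441*N^2 + 7*P^2) * (441*N^2 + 63*P^2)"
    and "8 * L^2 = 27 * (8*(441*N^2+7*P^2)*V - 11*21^4*N^4 - 462*441*N^2*P^2 + 392*21*N*P^3 + 1617*P^4)"
    and "8 * M^2 = 189 * (8*(441*N^2+7*P^2)*V + 11*21^4*N^4 + 462*441*N^2*P^2 - 392*21*N*P^3 - 1617*P^4)"
  unfolding P_def N_def V_def L_def M_def using e by Groebner_Basis.algebra+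

text \<open>The homogeneous identities in N and P turn into the required ones for s = -21 N/P after
  division by P^4. Of the three square roots, v makes the quadratic equation for n in the halving
  problem solvable, m then gives k, and l serves the degenerate case n = \<infinity>.\<close>

lemma parameter_exists:
  fixes s z w :: "'k::field"
  assumes two: "(2::'k) \<noteq> 0"
    and w: "w^2 = z^3 + 14*z^2 + 196*z"
    and den: "z^4 - 896*z^3 - 24696*z^2 - 175616*z + 38416 \<noteq> 0"
    and s: "s = - 21 * (((z^2 + 196) * (z^2 + 56*z + 196) + 32 * (z + 14) * (z - 14) * w)
                     / (z^4 - 896*z^3 - 24696*z^2 - 175616*z + 38416))"
  obtains v l m where "v^2 = 2 * (s^2 + 7) * (s^2 + 63)"
    and "8 * l^2 = 27 * (8*(s^2+7)*v - 11*s^4 - 462*s^2 - 392*s + 1617)"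
    and "8 * m^2 = 189 * (8*(s^2+7)*v + 11*s^4 + 462*s^2 + 392*s - 1617)"
proof (cases "z = 0")
  case True
  with w den s have "s = -21" by simp
  \<comment> \<open>The point is (0, 0), where r = w/z has no meaning; the three square roots at s =
    -21 are given directly.\<close>
  then show ?thesis by (intro that[of 672 504 10584]) simp_all
next
  case False
  define r e where "r = w/z" and "e = z - 196/z"
  have ze: "z*e = z^2 - 196" and zr: "z * r = w" and r2: "r^2 * z = z^2 + 14*z + 196"
    using False w by (simp_all add: e_def r_def field_simps power2_eq_square power3_eq_cube)
  define P where "P = (r^2-14)^2 - 896*(r^2-14) - 25088"
  define N where "N = (r^2-14)*(r^2+42) + 32*r*e"
  have T: "z * (r^2 - 14) = z^2 + 196" using r2 by (simp add: algebra_simps)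
  have T2: "z * (r^2 + 42) = z^2 + 56*z + 196" using r2 by (simp add: algebra_simps)
  have "z^2 * P = (z*(r^2-14))^2 - 896*z*(z*(r^2-14)) - 25088*z^2"
    by (simp add: P_def algebra_simps power2_eq_square)
  also have "\<dots> = z^4 - 896*z^3 - 24696*z^2 - 175616*z + 38416"
    unfolding T by Groebner_Basis.algebra
  finally have P: "z^2 * P = z^4 - 896*z^3 - 24696*z^2 - 175616*z + 38416" .
  have "z^2 * N = (z*(r^2-14))*(z*(r^2+42)) + 32*(z*r)*(z*e)"
    by (simp add: N_def algebra_simps power2_eq_square)
  also have "\<dots> = (z^2 + 196) * (z^2 + 56*z + 196) + 32 * (z + 14) * (z - 14) * w"
    unfolding T T2 ze zr by Groebner_Basis.algebra
  finally have N: "z^2 * N = (z^2 + 196) * (z^2 + 56*z + 196) + 32 * (z + 14) * (z - 14) * w" .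
  have P0: "P \<noteq> 0" using den P by auto
  have s': "s = -21*N/P"
    unfolding s N[symmetric] P[symmetric] using False by simp
  have "z^2 * e^2 = z^2 * ((r^2 - 42)*(r^2+14))"
  proof -
    have "z^2 * ((r^2 - 42)*(r^2+14)) = (r^2*z - 42*z)*(r^2*z+14*z)"
      by (simp add: algebra_simps power2_eq_square)
    also have "\<dots> = (z*e)^2" unfolding r2 ze by Groebner_Basis.algebra
    finally show ?thesis by (simp only: power_mult_distrib)
  qed
  hence e: "e^2 = (r^2 - 42)*(r^2+14)" using False by simp
  obtain V L M where V: "V^2 = 2 * (441*N^2 + 7*P^2) * (441*N^2 + 63*P^2)"
    and L: "8 * L^2 = 27 * (8*(441*N^2+7*P^2)*V - 11*21^4*N^4 - 462*441*N^2*P^2 + 392*21*N*P^3 + 1617*P^4)"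
    and M: "8 * M^2 = 189 * (8*(441*N^2+7*P^2)*V + 11*21^4*N^4 + 462*441*N^2*P^2 - 392*21*N*P^3 - 1617*P^4)"
    using parameter_identities[OF e] unfolding P_def N_def by blast
  have sP: "s * P = -21 * N" using P0 s' by simp
  show ?thesis
  proof (rule that[of "V/P^2" "L/P^2" "M/P^2"])
    have "P^4 * (V/P^2)^2 = V^2" using P0 by (simp add: power_divide flip: power_mult)
    also have "\<dots> = P^4 * (2 * (s^2 + 7) * (s^2 + 63))" using V sP by Groebner_Basis.algebra
    finally show "(V/P^2)^2 = 2 * (s^2 + 7) * (s^2 + 63)" using P0 by simp
    have v: "V/P^2 * P^2 = V" using P0 by simp
    have "P^4 * (8*(L/P^2)^2) = 8*L^2" using P0 by (simp add: power_divide flip: power_mult)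
    also have "\<dots> = P^4 * (27 * (8*(s^2+7)*(V/P^2) - 11*s^4 - 462*s^2 - 392*s + 1617))"
      using L sP v by Groebner_Basis.algebra
    finally show "8*(L/P^2)^2 = 27 * (8*(s^2+7)*(V/P^2) - 11*s^4 - 462*s^2 - 392*s + 1617)" using P0 by simp
    have "P^4 * (8*(M/P^2)^2) = 8*M^2" using P0 by (simp add: power_divide flip: power_mult)
    also have "\<dots> = P^4 * (189 * (8*(s^2+7)*(V/P^2) + 11*s^4 + 462*s^2 + 392*s - 1617))"
      using M sP v by Groebner_Basis.algebra
    finally show "8*(M/P^2)^2 = 189 * (8*(s^2+7)*(V/P^2) + 11*s^4 + 462*s^2 + 392*s - 1617)" using P0 by simp
  qed
qed

section \<open>Solution of the halving equations, and the sextic and its flex in terms of s\<close>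

lemma three_d: "(3::'k::field) \<noteq> 0 \<Longrightarrow> 3 * d_coeff s = 3*s^4 + 126*s^2 + 1736*s - (441::'k)"
  by (simp add: d_coeff_def field_simps)

text \<open>The second equation is quadratic in n. The auxiliary W is a root of W^2 - 2 (33 d -
  17920 s) W - 7 E^2 = 0, whose discriminant is a square thanks to v, and n = (-5 - 7 E/W)/2 solves
  the equation for n. This choice gives 8 - n^2 = 63 d/W, so the first equation becomes 8 k^2 =
  63/W, which k = m/W satisfies. For W = 0 the solution n moves to infinity and the second
  alternative holds.\<close>

lemma halving_parameters:
  fixes s v l m :: "'k::field"
  assumes char: "(2::'k) \<noteq> 0" "(3::'k) \<noteq> 0" "(7::'k) \<noteq> 0"
    and v: "v^2 = 2 * (s^2 + 7) * (s^2 + 63)"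
    and l: "8 * l^2 = 27 * (8*(s^2+7)*v - 11*s^4 - 462*s^2 - 392*s + 1617)"
    and m: "8 * m^2 = 189 * (8*(s^2+7)*v + 11*s^4 + 462*s^2 + 392*s - 1617)"
    and u: "3 * u = - 28672 * s"
  obtains (generic) n k where "8 * d_coeff s * k^2 = 8 - n^2"
      "(u + 8 * d_coeff s) * (n^2 - 8) = d_coeff s * (48*n + 120)"
  | (special) k where "u + 8 * d_coeff s = 0" "k^2 = u"
proof -
  define d where "d = d_coeff s"
  note d = three_d[OF char(2), of s, folded d_def]
  define E where "E = 3*d - 3584*s"
  define W where "W = 33*d - 17920*s + 24*(s^2+7)*v"
  have u8: "3 * (u + 8*d) = 8 * E" using u by (simp add: E_def algebra_simps)
  have m': "8 * m^2 = 63 * W" using m d unfolding W_def by Groebner_Basis.algebra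
  have WE: "W * (W - 2 * (33*d - 17920*s)) = 7 * E^2"
    using v d unfolding W_def E_def by Groebner_Basis.algebra
  show ?thesis
  proof (cases "W = 0")
    case False
    define n where "n = (-5 - 7*E/W)/2"
    have n: "2*n*W = -5*W - 7*E" using False char(1) by (simp add: n_def field_simps)
    define k where "k = m/W"
    have k: "k * W = m" using False by (simp add: k_def)
    have n2: "4*W^2*n^2 = (5*W + 7*E)^2" using n by Groebner_Basis.algebra
    have q: "33*d - 17920*s = 18*d + 5*E" by (simp add: E_def)
    have disc: "4*W^2*(8 - n^2) = 252*d*W"
      using n2 WE unfolding q by Groebner_Basis.algebra
    have "4*W^2 * (8*d*k^2) = 4*d*(8*m^2)" unfolding k[symmetric] by Groebner_Basis.algebra
    hence "4*W^2 * (8*d*k^2) = 4*W^2*(8 - n^2)" unfolding m' disc by simp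
    moreover have "12*W^2*((u + 8*d)*(n^2-8)) = 12*W^2*(d*(48*n+120))"
      using n u8 disc by Groebner_Basis.algebra
    moreover have "(12::'k) = 2*2*3" "(4::'k) = 2*2" by simp_all
    hence "(4::'k) \<noteq> 0" "(12::'k) \<noteq> 0" using char by (metis mult_eq_0_iff)+
    hence "4*W^2 \<noteq> 0" "12*W^2 \<noteq> 0" using False by simp_all
    ultimately have "8*d*k^2 = 8 - n^2" "(u + 8*d)*(n^2-8) = d*(48*n+120)" by (metis mult_left_cancel)+
    then show ?thesis using generic[of k n] unfolding d_def by blast
  next
    case True
    hence E0: "E = 0" using WE char(3) by simp
    have "u + 8*d = 0" using u8 char(2) unfolding E0 mult_zero_right mult_eq_0_iff by blast
    moreover obtain k where "k^2 = u"
    proof -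
      have "(9::'k) = 3*3" "(24::'k) = 2*2*2*3" "(81::'k) = 3*3*3*3" by simp_all
      hence nz: "(9::'k) \<noteq> 0" "(24::'k) \<noteq> 0" "(81::'k) \<noteq> 0"
        using char by (metis mult_eq_0_iff)+
      \<comment> \<open>For W = 0 the equation for \<open>l\<close> reduces to 16 l^2 = 81
        u.\<close>
      define k where "k = 4*l/9"
      have l': "9*k = 4*l"
        unfolding k_def times_divide_eq_right by (rule nonzero_mult_div_cancel_left[OF nz(1)])
      have "24 * (81*k^2) = 24 * (81*u)"
        using l' l u d E0 True unfolding E_def W_def by Groebner_Basis.algebra
      hence "k^2 = u" using nz mult_left_cancel by blast
      thus ?thesis by (rule that)
    qed
    ultimately show ?thesis using special[of k] unfolding d_def by auto
  qed
qed

text \<open>Expansion of z (z^2 - 31 d z + 256 d^2) at z = x^2 - u, which is d^3 times the cubic of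
  the constant elliptic curve at \<xi> = z/d. The value of u is read off from the coefficient of
  x^4, since \<open>c4 s\<close> + 31 d = 28672 s.\<close>

lemma sextic_coefficients:
  fixes s u :: "'k::field"
  assumes three: "(3::'k) \<noteq> 0" and u: "3 * u = - 28672 * s"
  defines "d \<equiv> d_coeff s"
  shows "c4 s = -3*u - 31*d"
    and "c2 s = 3*u^2 + 62*d*u + 256*d^2"
    and "c0 s = -(u^3) - 31*d*u^2 - 256*d^2*u"
proof -
  note d = three_d[OF three, of s, folded d_def]
  have "3 * c4 s = -93*(s^4 + 42*s^2 - 147) + 32200*s"
    using three by (simp add: c4_def field_simps)
  hence "3 * c4 s = 3 * (-3*u - 31*d)"
    using d u by Groebner_Basis.algebra
  thus "c4 s = -3*u - 31*d" using three mult_left_cancel by blast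
  have "3 * c2 s = 2^8 * (3*s^8 + 252*s^6 - 3472*s^5 + 4410*s^4 - 145824*s^3
                     + 160524*s^2 + 510384*s + 64827)"
    using three by (simp add: c2_def field_simps)
  hence "9 * c2 s = 9 * (3*u^2 + 62*d*u + 256*d^2)"
    using d u by Groebner_Basis.algebra
  moreover have "(9::'k) = 3*3" "(27::'k) = 3*3*3" by simp_all
  hence nz: "(9::'k) \<noteq> 0" "(27::'k) \<noteq> 0" using three by (metis mult_eq_0_iff)+
  ultimately show "c2 s = 3*u^2 + 62*d*u + 256*d^2"
    using mult_left_cancel by blast
  have "3 * c0 s = 2^20 * 7 * s * (s^2+7)^3 * (s^2 + 63)"
    using three by (simp add: c0_def field_simps)
  hence "27 * c0 s = 27 * (-(u^3) - 31*d*u^2 - 256*d^2*u)"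
    using d u by Groebner_Basis.algebra
  thus "c0 s = -(u^3) - 31*d*u^2 - 256*d^2*u" using nz mult_left_cancel by blast
qed

text \<open>In X = 1/x^2 and Y = y/x^3 the curve covers d Y^2 = 1 + c4 X + c2 X^2 + c0 X^3. The four
  equations say that d (a X + b)^2 minus the right hand side equals - c (h X + j)^3, so the line Y =
  a X + b meets this cubic with multiplicity three at X = - j/h.\<close>

lemma flex_parameters:
  fixes s :: "'k::field"
  assumes two: "(2::'k) \<noteq> 0" and three: "(3::'k) \<noteq> 0" and c0: "c0 s \<noteq> 0"
  defines "d \<equiv> d_coeff s"
  obtains a b h j c where
    "d * b^2 = 1 - c * j^3"
    "2 * d * a * b = c4 s - 3 * c * j^2 * h"
    "d * a^2 = c2 s - 3 * c * j * h^2"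
    "c0 s = c * h^3"
proof -
  note d = three_d[OF three, of s, folded d_def]
  define p where "p = 32 * s * (s^2 + 63)"
  have s: "s \<noteq> 0" "s^2 + 7 \<noteq> 0" "s^2+63 \<noteq> 0" using c0 by (auto simp: c0_def)
  have "(32::'k) = 2^5" by simp
  hence "(32::'k) \<noteq> 0" using two by (metis power_not_zero)
  hence p: "p \<noteq> 0" using s by (simp add: p_def)
  define a b h j c where "a = 16*(21 - s^2)" and "b = (31*s+63)/p" and "h = 32*(s^2+7)*p"
    and "j = 3*s^2 - 62*s + 63" and "c = 7/(3*p^2)"
  have b: "b * p = 31*s+63" and c: "3 * c * p^2 = 7"
    using p three by (simp_all add: b_def c_def)
  have nz: "3 * p^2 \<noteq> 0" using p three by simp
  have c4': "3 * c4 s = -93*(s^4 + 42*s^2 - 147) + 32200*s"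
    using three by (simp add: c4_def field_simps)
  have c2': "3 * c2 s = 2^8 * (3*s^8 + 252*s^6 - 3472*s^5 + 4410*s^4 - 145824*s^3
                     + 160524*s^2 + 510384*s + 64827)"
    using three by (simp add: c2_def field_simps)
  have c0': "3 * c0 s = 2^20 * 7 * s * (s^2+7)^3 * (s^2 + 63)"
    using three by (simp add: c0_def field_simps)
  show ?thesis
  proof (rule that[of b c j a h])
    have "3*p^2 * (d * b^2) = 3*p^2*(1 - c * j^3)"
      using b c d unfolding j_def p_def by Groebner_Basis.algebra
    thus "d * b^2 = 1 - c * j^3" using nz mult_left_cancel by blast
    have "3*p^2 * (2 * d * a * b) = 2*p*a*(3*d)*(b*p)" by Groebner_Basis.algebra
    also have "\<dots> = p^2*(3 * c4 s) - 3 * (3 * c * p^2) * j^2 * h"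
      unfolding b c d c4' unfolding j_def p_def a_def h_def by Groebner_Basis.algebra
    also have "\<dots> = 3*p^2*(c4 s - 3 * c * j^2 * h)" by Groebner_Basis.algebra
    finally have "3*p^2 * (2 * d * a * b) = 3*p^2*(c4 s - 3 * c * j^2 * h)" .
    thus "2 * d * a * b = c4 s - 3 * c * j^2 * h" using nz mult_left_cancel by blast
    have "3*p^2 * (d * a^2) = p^2*a^2*(3*d)" by Groebner_Basis.algebra
    also have "\<dots> = p^2*(3 * c2 s) - 3 * (3 * c * p^2) * j * h^2"
      unfolding c d c2' unfolding j_def p_def a_def h_def by Groebner_Basis.algebra
    also have "\<dots> = 3*p^2*(c2 s - 3 * c * j * h^2)" by Groebner_Basis.algebra
    finally have "3*p^2 * (d * a^2) = 3*p^2*(c2 s - 3 * c * j * h^2)" .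
    thus "d * a^2 = c2 s - 3 * c * j * h^2" using nz mult_left_cancel by blast
    have "3*p^2 * c0 s = p^2*(3 * c0 s)" by Groebner_Basis.algebra
    also have "\<dots> = (3 * c * p^2) * h^3"
      unfolding c c0' unfolding p_def h_def by Groebner_Basis.algebra
    also have "\<dots> = 3*p^2*(c * h^3)" by Groebner_Basis.algebra
    finally have "3*p^2 * c0 s = 3*p^2*(c * h^3)" .
    thus "c0 s = c * h^3" using nz mult_left_cancel by blast
  qed
qed

section \<open>Orders of vanishing\<close>

subsection \<open>Discrete valuations of the rational function field\<close>

definition fract_const :: "'a::field \<Rightarrow> 'a poly fract" where
  "fract_const c = Fract [:c:] 1"

lemma fract_const_add: "fract_const (a + b) = fract_const a + fract_const b"
  and fract_const_uminus: "fract_const (- a) = - fract_const a"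
  and fract_const_mult: "fract_const (a * b) = fract_const a * fract_const b"
  and fract_const_0 [simp]: "fract_const 0 = 0"
  and fract_const_1 [simp]: "fract_const 1 = 1"
  and fract_const_eq_0_iff: "fract_const a = 0 \<longleftrightarrow> a = 0"
  by (simp_all add: fract_const_def Zero_fract_def One_fract_def eq_fract flip: pCons_one)

text \<open>Serves for all points of the line, finite or infinite. The last axiom says that the
  residue field consists of the constants, so the residue of a unit can be compared with a
  coordinate of a point. The value of \<nu> at 0 is left open, whence the predicate
  \<open>ge\<close> below, which counts 0 as divisible to any order.\<close>

locale rational_valuation =
  fixes \<nu> :: "'a::field poly fract \<Rightarrow> int"
  assumes nu_mult: "x \<noteq> 0 \<Longrightarrow> y \<noteq> 0 \<Longrightarrow> \<nu> (x * y) = \<nu> x + \<nu> y"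
    and nu_add: "x \<noteq> 0 \<Longrightarrow> y \<noteq> 0 \<Longrightarrow> x + y \<noteq> 0 \<Longrightarrow> \<nu> (x + y) \<ge> min (\<nu> x) (\<nu> y)"
    and nu_const: "a \<noteq> 0 \<Longrightarrow> \<nu> (fract_const a) = 0"
    and nu_residue: "x \<noteq> 0 \<Longrightarrow> \<nu> x = 0 \<Longrightarrow> \<exists>a. x = fract_const a \<or> \<nu> (x - fract_const a) > 0"
begin

definition ge :: "int \<Rightarrow> 'a poly fract \<Rightarrow> bool" where
  "ge n x \<longleftrightarrow> x = 0 \<or> \<nu> x \<ge> n"

lemma nu_1 [simp]: "\<nu> 1 = 0"
  using nu_const[of 1] by simp

lemma nu_uminus [simp]: "\<nu> (- x) = \<nu> x"
proof (cases "x = 0")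
  case False
  have "- x = fract_const (- 1) * x"
    by (simp add: fract_const_uminus)
  thus ?thesis
    using nu_mult[of "fract_const (- 1)" x] False nu_const[of "-1"]
    by (metis add_0 fract_const_eq_0_iff neg_equal_0_iff_equal zero_neq_one)
qed simp

lemma nu_power: "x \<noteq> 0 \<Longrightarrow> \<nu> (x ^ n) = int n * \<nu> x"
  by (induction n) (simp_all add: nu_mult algebra_simps)

lemma nu_inverse: "x \<noteq> 0 \<Longrightarrow> \<nu> (inverse x) = - \<nu> x"
  using nu_mult[of x "inverse x"] by simp

lemma nu_divide: "x \<noteq> 0 \<Longrightarrow> y \<noteq> 0 \<Longrightarrow> \<nu> (x / y) = \<nu> x - \<nu> y"
  by (simp add: divide_inverse nu_mult nu_inverse)

lemma ge_0 [simp]: "ge n 0"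
  by (simp add: ge_def)

lemma ge_mono: "ge n x \<Longrightarrow> m \<le> n \<Longrightarrow> ge m x"
  by (auto simp: ge_def)

lemma ge_const [simp]: "ge 0 (fract_const a)"
  using nu_const[of a] by (cases "a = 0") (auto simp: ge_def)

lemma ge_uminus [simp]: "ge n (- x) = ge n x"
  by (simp add: ge_def)

lemma ge_add: "ge n x \<Longrightarrow> ge n y \<Longrightarrow> ge n (x + y)"
  using nu_add[of x y] by (fastforce simp: ge_def)

lemma ge_diff: "ge n x \<Longrightarrow> ge n y \<Longrightarrow> ge n (x - y)"
  using ge_add[of n x "- y"] by simp

lemma ge_mult: "ge m x \<Longrightarrow> ge n y \<Longrightarrow> ge (m + n) (x * y)"
  by (cases "x = 0"; cases "y = 0") (auto simp: ge_def nu_mult)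

lemma ge_nu [simp]: "ge (\<nu> x) x"
  by (simp add: ge_def)

lemma dominant:
  assumes "x \<noteq> 0" and "ge (\<nu> x + 1) y"
  shows "x + y \<noteq> 0" and "\<nu> (x + y) = \<nu> x"
proof -
  show nz: "x + y \<noteq> 0"
  proof
    assume "x + y = 0"
    hence "y = - x" by (simp add: eq_neg_iff_add_eq_0 add.commute)
    with assms show False by (auto simp: ge_def)
  qed
  show "\<nu> (x + y) = \<nu> x"
  proof (cases "y = 0")
    case False
    have "\<nu> (x + y) \<ge> \<nu> x"
      using nu_add[of x y] assms False nz by (auto simp: ge_def)
    moreover have "\<nu> x \<ge> min (\<nu> (x + y)) (\<nu> y)"
      using nu_add[of "x + y" "- y"] assms False nz by simp
    ultimately show ?thesis using assms False by (auto simp: ge_def)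
  qed simp
qed

end

subsection \<open>Valuations of the function field\<close>

lemma ff_zero_iff: "(a, b) = ff_zero \<longleftrightarrow> a = 0 \<and> b = 0"
  by (simp add: ff_zero_def)

locale ff_val =
  fixes d :: "'a::field" and f :: "'a poly" and v :: "'a function_field \<Rightarrow> int"
  assumes val: "ff_valuation d f v"
begin

lemma v_mult: "g \<noteq> ff_zero \<Longrightarrow> h \<noteq> ff_zero \<Longrightarrow> v (ff_mult d f g h) = v g + v h"
  using val unfolding ff_valuation_def by blast

lemma v_add: "g \<noteq> ff_zero \<Longrightarrow> h \<noteq> ff_zero \<Longrightarrow> ff_add g h \<noteq> ff_zero \<Longrightarrow>
  v (ff_add g h) \<ge> min (v g) (v h)"
  using val unfolding ff_valuation_def by blast

lemma v_const: "a \<noteq> 0 \<Longrightarrow> v (fract_const a, 0) = 0"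
  using val unfolding ff_valuation_def ff_const_def ff_of_base_def fract_const_def by blast

lemma v_zero: "v ff_zero = 0"
  using val unfolding ff_valuation_def by blast

lemma v_one: "\<exists>g. g \<noteq> ff_zero \<and> v g = 1"
  using val unfolding ff_valuation_def by blast

lemma v_base_mult: "x \<noteq> 0 \<Longrightarrow> (a, b) \<noteq> ff_zero \<Longrightarrow> v (x * a, x * b) = v (x, 0) + v (a, b)"
  using v_mult[of "(x, 0)" "(a, b)"] by (simp add: ff_mult_def ff_zero_def)

lemma v_minus: "v (- a, - b) = v (a, b)"
proof (cases "(a, b) = ff_zero")
  case False
  thus ?thesis using v_base_mult[of "- 1" a b] v_const[of "- 1"]
    by (simp add: fract_const_uminus)
qed (simp add: ff_zero_iff)

definition pos :: "'a function_field \<Rightarrow> bool" where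
  "pos g \<longleftrightarrow> g = ff_zero \<or> v g > 0"

lemma pos_add: "pos g \<Longrightarrow> pos h \<Longrightarrow> pos (ff_add g h)"
proof -
  assume *: "pos g" "pos h"
  consider "g = ff_zero" | "h = ff_zero" | "ff_add g h = ff_zero"
    | "g \<noteq> ff_zero" "h \<noteq> ff_zero" "ff_add g h \<noteq> ff_zero" by blast
  thus ?thesis
  proof cases
    case 4
    thus ?thesis using v_add[of g h] * by (simp add: pos_def)
  qed (use * in \<open>simp_all add: pos_def ff_add_def ff_zero_def\<close>)
qed

lemma v_dominant:
  assumes "(a, b) \<noteq> ff_zero" and "(a', b') = ff_zero \<or> v (a', b') > v (a, b)"
  shows "(a + a', b + b') \<noteq> ff_zero" and "v (a + a', b + b') = v (a, b)"
proof -
  show nz: "(a + a', b + b') \<noteq> ff_zero"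
  proof
    assume "(a + a', b + b') = ff_zero"
    hence "a' = - a" "b' = - b" by (auto simp: ff_zero_iff eq_neg_iff_add_eq_0 add.commute)
    with assms v_minus[of a b] show False by (auto simp: ff_zero_iff)
  qed
  show "v (a + a', b + b') = v (a, b)"
  proof (cases "(a', b') = ff_zero")
    case False
    have "v (a + a', b + b') \<ge> v (a, b)"
      using v_add[OF assms(1) False] assms False nz by (auto simp: ff_add_def)
    moreover have "v (a, b) \<ge> min (v (a + a', b + b')) (v (a', b'))"
      using v_add[of "(a + a', b + b')" "(- a', - b')"] v_minus[of a' b'] assms False nz
      by (auto simp: ff_add_def ff_zero_iff)
    ultimately show ?thesis using assms False by auto
  qed (auto simp: ff_zero_iff)
qed

lemma v_const_plus_pos:
  assumes "k \<noteq> 0" and "pos (a, b)"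
  shows "(fract_const k + a, b) \<noteq> ff_zero" and "v (fract_const k + a, b) = 0"
  using v_dominant[of "fract_const k" 0 a b] assms v_const[of k]
  by (auto simp: pos_def ff_zero_iff fract_const_eq_0_iff)

text \<open>The functions (x, 0) and (0, y) have residues k and l at the centre, so their sum has
  the nonzero residue k + l.\<close>

lemma v_unit:
  assumes "k + l \<noteq> 0" and "pos (x - fract_const k, 0)" and "pos (- fract_const l, y)"
  shows "(x, y) \<noteq> ff_zero" and "v (x, y) = 0"
proof -
  have "pos (x - fract_const (k + l), y)"
    using pos_add[OF assms(2,3)] by (simp add: ff_add_def fract_const_add algebra_simps)
  from v_const_plus_pos[OF assms(1) this] show "(x, y) \<noteq> ff_zero" "v (x, y) = 0"
    by (simp_all add: algebra_simps)
qed

end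

subsection \<open>The valuation at a smooth point\<close>

text \<open>
  The local chart at a point consists of a uniformizer \<open>t\<close> of \<open>\<nu>\<close> and the function
  \<open>c y\<close>, which takes the value \<open>\<beta>\<close> at the point. The case \<open>\<beta> = 0\<close> is that of a branch point.
\<close>

locale smooth_point = rational_valuation \<nu>
  for \<nu> :: "'a::field poly fract \<Rightarrow> int" +
  fixes d :: 'a and f :: "'a poly" and t c :: "'a poly fract" and \<beta> :: 'a
  assumes two: "(2::'a) \<noteq> 0"
    and nonsquare: "x ^ 2 \<noteq> Fract f [:d:]"
    and t: "t \<noteq> 0" "\<nu> t = 1"
    and c: "c \<noteq> 0"
    and generic: "ff_valuation d f v \<Longrightarrow> v (t, 0) > 0 \<Longrightarrow> x \<noteq> 0 \<Longrightarrow> v (x, 0) = v (t, 0) * \<nu> x"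
    and on_curve: "\<beta> \<noteq> 0 \<Longrightarrow> ge 1 (c^2 * Fract f [:d:] - fract_const (\<beta>^2))"
    and branch: "\<beta> = 0 \<Longrightarrow> \<nu> (c^2 * Fract f [:d:]) = 1"
begin

abbreviation D where "D \<equiv> c^2 * Fract f [:d:]"

text \<open>Common form of \<open>centred_at\<close> for both charts: the second pair is the
  function c y - \<beta>, with c = 1 on the affine chart and c = 1/x^3 at infinity.\<close>

definition centred :: "('a function_field \<Rightarrow> int) \<Rightarrow> bool" where
  "centred v \<longleftrightarrow> v (t, 0) > 0 \<and> v (- fract_const \<beta>, c) > 0"

lemma mult_eq: "ff_mult d f (a, b * c) (a', b' * c) = (a * a' + D * (b * b'), (a * b' + b * a') * c)"
  by (simp add: ff_mult_def algebra_simps power2_eq_square)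

lemma f_neq_0: "Fract f [:d:] \<noteq> 0"
  using nonsquare[of 0] by auto

lemma D_neq_0: "D \<noteq> 0"
  using f_neq_0 c by simp

lemma norm_neq_0: "a \<noteq> 0 \<or> b \<noteq> 0 \<Longrightarrow> a^2 - b^2 * D \<noteq> 0"
proof
  assume *: "a \<noteq> 0 \<or> b \<noteq> 0" "a^2 - b^2 * D = 0"
  hence b: "b \<noteq> 0" by auto
  hence "(a / (b * c))^2 = Fract f [:d:]" using * c
    by (simp add: field_simps power_mult_distrib)
  thus False using nonsquare by blast
qed

lemma decompose: obtains a b where "g = (a, b * c)"
  using c that[of "fst g" "snd g / c"] by (cases g) simp

lemma pair_zero_iff: "(a, b * c) = ff_zero \<longleftrightarrow> a = 0 \<and> b = 0"
  using c by (simp add: ff_zero_iff)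

context
  fixes v assumes v: "ff_valuation d f v" and cv: "centred v"
begin

interpretation ff_val d f v by unfold_locales (rule v)

lemma v_base: "x \<noteq> 0 \<Longrightarrow> v (x, 0) = v (t, 0) * \<nu> x"
  using generic v cv by (simp add: centred_def)

lemma v_t_pos: "v (t, 0) > 0"
  using cv by (simp add: centred_def)

lemma pos_base: "ge 1 x \<Longrightarrow> pos (x, 0)"
  using v_base[of x] v_t_pos
  by (cases "x = 0") (auto simp: pos_def ge_def ff_zero_iff zero_less_mult_iff)

lemma pos_y: "pos (- fract_const \<beta>, c)"
  using cv by (simp add: pos_def centred_def)

end

subsubsection \<open>Points that are not branch points\<close>

lemma unramified_value_unit:
  assumes "\<beta> \<noteq> 0" and "ff_valuation d f v" "centred v"
    and "ge 1 (q - fract_const k)" and "k + \<beta> \<noteq> 0"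
  shows "v (q, c) = 0"
proof -
  interpret ff_val d f v by unfold_locales fact
  show ?thesis
    using v_unit(2)[OF assms(5) pos_base pos_y] assms by simp
qed

text \<open>The function q + c y vanishes at the point, while its conjugate - q + c y has residue 2
  \<beta> there and is a unit. Hence q + c y has the order of the norm, which is a rational function
  in x.\<close>

lemma unramified_value_conj:
  assumes "\<beta> \<noteq> 0" and "ff_valuation d f v" "centred v"
    and "ge 1 (q - fract_const k)" and "k + \<beta> = 0" and "q \<noteq> 0"
  shows "v (q, c) = v (t, 0) * \<nu> (q^2 - D)"
proof -
  interpret ff_val d f v by unfold_locales fact
  have "- k + \<beta> \<noteq> 0"
  proof
    assume "- k + \<beta> = 0"
    hence "2 * \<beta> = 0" using assms(5) by (simp add: add_eq_0_iff)
    thus False using two assms(1) by simp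
  qed
  moreover have "ge 1 (- q - fract_const (- k))"
    using assms(4) ge_uminus[of 1 "q - fract_const k"] by (simp add: fract_const_uminus)
  ultimately have "v (- q, c) = 0"
    using unramified_value_unit assms by blast
  moreover have "ff_mult d f (q, c) (- q, c) = (- (q^2 - D), 0)"
    using mult_eq[of q 1 "-q" 1] by (simp add: algebra_simps power2_eq_square)
  ultimately have "v (q, c) = v (- (q^2 - D), 0)"
    using v_mult[of "(q, c)" "(- q, c)"] c by (simp add: ff_zero_iff)
  also have "\<dots> = v (t, 0) * \<nu> (- (q^2 - D))"
    using norm_neq_0[of q 1] by (intro v_base[OF assms(2,3)]) simp
  finally show ?thesis by (simp only: nu_uminus)
qed

text \<open>The multiplier m is the same for all v, and this will make the valuation unique. In g =
  a + b c y the factor c y is a unit, so if a and b have different orders the smaller one wins; if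
  the orders agree, the residue k of a/b decides whether a/b + c y is a unit or vanishes.\<close>

lemma unramified_value:
  assumes \<beta>: "\<beta> \<noteq> 0" and g: "g \<noteq> ff_zero"
  shows "\<exists>m. \<forall>v. ff_valuation d f v \<and> centred v \<longrightarrow> v g = v (t, 0) * m"
proof -
  obtain a b where ab: "g = (a, b * c)" by (rule decompose)
  have vc: "v (0, c) = 0" if "ff_valuation d f v" "centred v" for v
    using unramified_value_unit[OF \<beta> that, of 0 0] \<beta> by simp
  have vb: "v (0, b * c) = v (t, 0) * \<nu> b" if "ff_valuation d f v" "centred v" "b \<noteq> 0" for v
  proof -
    interpret ff_val d f v by unfold_locales fact
    show ?thesis using v_base_mult[OF that(3), of 0 c] vc[OF that(1,2)] v_base[OF that] c
      by (simp add: ff_zero_iff)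
  qed
  consider "b = 0" "a \<noteq> 0" | "a = 0" "b \<noteq> 0" | "a \<noteq> 0" "b \<noteq> 0" "\<nu> a < \<nu> b"
    | "a \<noteq> 0" "b \<noteq> 0" "\<nu> b < \<nu> a" | "a \<noteq> 0" "b \<noteq> 0" "\<nu> a = \<nu> b"
    using g by (force simp: ab pair_zero_iff)
  thus ?thesis
  proof cases
    case 1
    thus ?thesis using v_base ab by auto
  next
    case 2
    thus ?thesis using vb ab by auto
  next
    case 3
    have "v g = v (t, 0) * \<nu> a" if v: "ff_valuation d f v" "centred v" for v
    proof -
      interpret ff_val d f v by unfold_locales fact
      have "v (a, 0) < v (0, b * c)"
        using vb[OF v 3(2)] v_base[OF v 3(1)] v_t_pos[OF v] 3(3) by simp
      with v_dominant(2)[of a 0 0 "b * c"] v_base[OF v 3(1)] 3(1) show ?thesis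
        by (simp add: ab ff_zero_iff)
    qed
    thus ?thesis by blast
  next
    case 4
    have "v g = v (t, 0) * \<nu> b" if v: "ff_valuation d f v" "centred v" for v
    proof -
      interpret ff_val d f v by unfold_locales fact
      have "v (0, b * c) < v (a, 0)"
        using vb[OF v 4(2)] v_base[OF v 4(1)] v_t_pos[OF v] 4(3) by simp
      with v_dominant(2)[of 0 "b * c" a 0] vb[OF v 4(2)] 4(2) c show ?thesis
        by (simp add: ab ff_zero_iff)
    qed
    thus ?thesis by blast
  next
    case 5
    define q where "q = a / b"
    have q: "q \<noteq> 0" "\<nu> q = 0" using 5 by (simp_all add: q_def nu_divide)
    from nu_residue[OF q] obtain k where "q = fract_const k \<or> \<nu> (q - fract_const k) > 0"
      by blast
    hence k: "ge 1 (q - fract_const k)" by (auto simp: ge_def)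
    have *: "v g = v (t, 0) * \<nu> b + v (q, c)" if v: "ff_valuation d f v" "centred v" for v
    proof -
      interpret ff_val d f v by unfold_locales fact
      show ?thesis using v_base_mult[OF 5(2), of q c] v_base[OF v 5(2)] 5(2) q(1)
        by (simp add: ab q_def ff_zero_iff)
    qed
    show ?thesis
    proof (cases "k + \<beta> = 0")
      case True
      hence "v g = v (t, 0) * (\<nu> b + \<nu> (q^2 - D))" if v: "ff_valuation d f v" "centred v" for v
        using *[OF v] unramified_value_conj[OF \<beta> v k True q(1)] by (simp add: algebra_simps)
      thus ?thesis by blast
    next
      case False
      hence "v g = v (t, 0) * \<nu> b" if v: "ff_valuation d f v" "centred v" for v
        using *[OF v] unramified_value_unit[OF \<beta> v k False] by simp
      thus ?thesis by blast
    qed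
  qed
qed

text \<open>Newton iteration: \<open>c y\<close> is approximated by rational functions to any order.\<close>

lemma sqrt_approx:
  assumes \<beta>: "\<beta> \<noteq> 0"
  shows "\<exists>s. ge 1 (s - fract_const \<beta>) \<and> ge (int n) (s^2 - D)"
proof -
  have step: "\<exists>s. ge 1 (s - fract_const \<beta>) \<and> ge (1 + int n) (s^2 - D)" for n
  proof (induction n)
    case 0
    have "ge 1 (- (D - fract_const (\<beta>^2)))" using on_curve[OF \<beta>] by (simp only: ge_uminus)
    thus ?case
      by (intro exI[of _ "fract_const \<beta>"]) (simp add: fract_const_mult power2_eq_square)
  next
    case (Suc n)
    then obtain s where s: "ge 1 (s - fract_const \<beta>)" "ge (1 + int n) (s^2 - D)" by blast
    \<comment> \<open>The derivative 2 s is inverted only at its residue 2 \<beta>. Each iteration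
      then gains a single order, but the correction stays a constant multiple of s^2 - D.\<close>
    define k where "k = fract_const (inverse (2 * \<beta>))"
    have k: "2 * k * fract_const \<beta> = 1"
    proof -
      have "k * fract_const (2 * \<beta>) = 1" using \<beta> two
        unfolding k_def fract_const_mult[symmetric] by simp
      moreover have "fract_const (2 * \<beta>) = 2 * fract_const \<beta>"
        unfolding mult_2 fract_const_add ..
      ultimately show ?thesis by (simp add: ac_simps)
    qed
    define r where "r = s^2 - D"
    define s' where "s' = s - r * k"
    have "s'^2 - D = r * ((fract_const \<beta> - s) * (2 * k)) + (r * r) * (k * k) + r * (1 - 2 * k * fract_const \<beta>)"
      by (simp add: s'_def r_def algebra_simps power2_eq_square)
    hence eq: "s'^2 - D = r * ((fract_const \<beta> - s) * (2 * k)) + (r * r) * (k * k)" using k by simp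
    have r: "ge (1 + int n) r" using s by (simp add: r_def)
    have k0: "ge 0 k" by (simp add: k_def)
    have "ge (1 + int (Suc n)) (r * ((fract_const \<beta> - s) * (2 * k)))"
    proof -
      have "ge 1 (fract_const \<beta> - s)" using s(1) ge_uminus[of 1 "s - fract_const \<beta>"] by simp
      moreover have "ge 0 (2 * k)" unfolding mult_2 by (rule ge_add[OF k0 k0])
      ultimately have "ge (1 + 0) ((fract_const \<beta> - s) * (2 * k))" by (rule ge_mult)
      from ge_mult[OF r this] show ?thesis by (simp add: algebra_simps)
    qed
    moreover have "ge (1 + int (Suc n)) ((r * r) * (k * k))"
      using ge_mult[OF ge_mult[OF r r] ge_mult[OF k0 k0]] by (rule ge_mono) simp
    ultimately have "ge (1 + int (Suc n)) (s'^2 - D)" unfolding eq by (rule ge_add)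
    moreover have "ge 1 (s' - fract_const \<beta>)"
    proof -
      have "ge 1 (r * k)" using ge_mult[OF r k0] by (rule ge_mono) simp
      from ge_diff[OF s(1) this] show ?thesis by (simp add: s'_def algebra_simps)
    qed
    ultimately show ?case by blast
  qed
  obtain s where "ge 1 (s - fract_const \<beta>)" "ge (1 + int n) (s^2 - D)" using step by blast
  moreover from this(2) have "ge (int n) (s^2 - D)" by (rule ge_mono) simp
  ultimately show ?thesis by blast
qed

definition approx :: "nat \<Rightarrow> 'a poly fract" where
  "approx n = (SOME s. ge 1 (s - fract_const \<beta>) \<and> ge (int n) (s^2 - D))"

text \<open>The image of g in the completion at the point, cut off at stage n: the power series of c
  y is replaced by a rational approximation. The order of g is the value that \<nu> eventually takes
  on these images.\<close>

definition approx_eval :: "nat \<Rightarrow> 'a function_field \<Rightarrow> 'a poly fract" where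
  "approx_eval n g = fst g + (snd g / c) * approx n"

lemma approx_eval_pair: "approx_eval n (a, b * c) = a + b * approx n"
  using c by (simp add: approx_eval_def)

definition val_unramified :: "'a function_field \<Rightarrow> int" where
  "val_unramified g = (if g = ff_zero then 0 else
     (THE k. \<forall>\<^sub>F n in sequentially. approx_eval n g \<noteq> 0 \<and> \<nu> (approx_eval n g) = k))"

context
  assumes \<beta>: "\<beta> \<noteq> 0"
begin

lemma approx: "ge 1 (approx n - fract_const \<beta>)" "ge (int n) (approx n ^ 2 - D)"
  using someI_ex[OF sqrt_approx[OF \<beta>, of n]] unfolding approx_def by auto

lemma approx_ge_0: "ge 0 (approx n)"
proof -
  from approx(1) have "ge 0 (approx n - fract_const \<beta>)" by (rule ge_mono) simp
  from ge_add[OF this ge_const[of \<beta>]] show ?thesis by simp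
qed

text \<open>The difference of the squares of two approximations has order at least m. It is the
  product of their difference and their sum, and the sum has residue 2 \<beta> and is a
  unit.\<close>

lemma approx_Cauchy: assumes "m \<le> n" shows "ge (int m) (approx n - approx m)"
proof -
  have "ge 1 ((approx n - fract_const \<beta>) + (approx m - fract_const \<beta>))"
    by (intro ge_add approx)
  moreover have nz: "\<beta> + \<beta> \<noteq> 0"
    using two \<beta> by (simp flip: mult_2)
  moreover have eq: "fract_const (\<beta> + \<beta>) + ((approx n - fract_const \<beta>) + (approx m - fract_const \<beta>))
      = approx n + approx m"
    unfolding fract_const_add by simp
  ultimately have s: "approx n + approx m \<noteq> 0" "\<nu> (approx n + approx m) = 0"
    using dominant[of "fract_const (\<beta> + \<beta>)"
        "(approx n - fract_const \<beta>) + (approx m - fract_const \<beta>)"] nu_const[OF nz]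
    by (simp_all only: eq fract_const_eq_0_iff not_False_eq_True add_0)
  have "ge (int m) (approx n ^ 2 - D)" using approx(2)[of n] by (rule ge_mono) (use assms in simp)
  hence "ge (int m) ((approx n ^ 2 - D) - (approx m ^ 2 - D))" using approx(2) by (rule ge_diff)
  also have "(approx n ^ 2 - D) - (approx m ^ 2 - D) = (approx n - approx m) * (approx n + approx m)"
    by (simp add: algebra_simps power2_eq_square)
  finally show ?thesis using s by (cases "approx n = approx m") (auto simp: ge_def nu_mult)
qed

text \<open>For an accurate approximation s, the product of a + b s and a - b s has the order of the
  norm N. As a - b s has order at least m, the order of a + b s is at most that of N minus m, and
  later corrections of s are too small to change it.\<close>

lemma approx_eval_stable:
  assumes "g \<noteq> ff_zero"
  shows "\<exists>k. \<forall>\<^sub>F n in sequentially. approx_eval n g \<noteq> 0 \<and> \<nu> (approx_eval n g) = k"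
proof -
  obtain a b where g: "g = (a, b * c)" by (rule decompose)
  define N where "N = a^2 - b^2 * D"
  define m where "m = (if a = 0 then \<nu> b else if b = 0 then \<nu> a else min (\<nu> a) (\<nu> b))"
  \<comment> \<open>The first bound gives b^2 (s^2 - D) higher order than N; the second gives every
    later change of b s higher order than a + b s.\<close>
  define n0 where "n0 = nat (max (\<nu> N - 2 * \<nu> b + 1) (\<nu> N - m - \<nu> b + 1))"
  have N: "N \<noteq> 0" using norm_neq_0 assms by (auto simp: N_def g pair_zero_iff)
  have m: "ge m a" "ge m b" by (auto simp: m_def ge_def)
  have main: "a + b * approx n \<noteq> 0 \<and> \<nu> (a + b * approx n) \<le> \<nu> N - m" if "n \<ge> n0" for n
  proof -
    have "ge (\<nu> N + 1) (- (b * b * (approx n ^ 2 - D)))"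
      using ge_mult[OF ge_mult[OF ge_nu ge_nu] approx(2)[of n], of b b]
      unfolding ge_uminus by (rule ge_mono) (use that in \<open>simp add: n0_def\<close>)
    from dominant[OF N this]
    have "N + - (b * b * (approx n ^ 2 - D)) \<noteq> 0 \<and> \<nu> (N + - (b * b * (approx n ^ 2 - D))) = \<nu> N" by simp
    also have "N + - (b * b * (approx n ^ 2 - D)) = (a + b * approx n) * (a - b * approx n)"
      by (simp add: N_def algebra_simps power2_eq_square)
    finally have *: "a + b * approx n \<noteq> 0" "a - b * approx n \<noteq> 0"
      "\<nu> (a + b * approx n) + \<nu> (a - b * approx n) = \<nu> N"
      by (auto simp: nu_mult)
    have "ge m (a - b * approx n)"
      using m ge_mult[OF m(2) approx_ge_0, of n] by (intro ge_diff) simp_all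
    with * show ?thesis by (auto simp: ge_def)
  qed
  have "approx_eval n g \<noteq> 0 \<and> \<nu> (approx_eval n g) = \<nu> (a + b * approx n0)" if n: "n \<ge> n0" for n
  proof -
    have "ge (\<nu> b + int n0) (b * (approx n - approx n0))"
      using ge_mult[OF ge_nu approx_Cauchy[OF n]] .
    hence "ge (\<nu> (a + b * approx n0) + 1) (b * (approx n - approx n0))"
      by (rule ge_mono) (use main[of n0] in \<open>auto simp: n0_def\<close>)
    from dominant(2)[OF _ this] main[of n0] main[OF n] show ?thesis
      by (simp add: g approx_eval_pair algebra_simps)
  qed
  thus ?thesis unfolding eventually_sequentially by blast
qed

lemma val_unramified:
  assumes "g \<noteq> ff_zero"
  shows "\<forall>\<^sub>F n in sequentially. approx_eval n g \<noteq> 0 \<and> \<nu> (approx_eval n g) = val_unramified g"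
proof -
  obtain k where k: "\<forall>\<^sub>F n in sequentially. approx_eval n g \<noteq> 0 \<and> \<nu> (approx_eval n g) = k"
    using approx_eval_stable[OF assms] by blast
  have "k' = k" if "\<forall>\<^sub>F n in sequentially. approx_eval n g \<noteq> 0 \<and> \<nu> (approx_eval n g) = k'" for k'
  proof -
    have "\<forall>\<^sub>F n in sequentially. k' = k" using that k by eventually_elim simp
    thus ?thesis by simp
  qed
  hence "(THE k. \<forall>\<^sub>F n in sequentially. approx_eval n g \<noteq> 0 \<and> \<nu> (approx_eval n g) = k) = k"
    by (intro the_equality k)
  hence "val_unramified g = k" using assms by (simp add: val_unramified_def)
  with k show ?thesis by simp
qed

lemma val_unramifiedI:
  assumes "\<And>n. n \<ge> n0 \<Longrightarrow> approx_eval n g \<noteq> 0 \<and> \<nu> (approx_eval n g) = k" and "g \<noteq> ff_zero"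
  shows "val_unramified g = k"
proof -
  have "\<forall>\<^sub>F n in sequentially. approx_eval n g \<noteq> 0 \<and> \<nu> (approx_eval n g) = k"
    using assms unfolding eventually_sequentially by blast
  hence "\<forall>\<^sub>F n in sequentially. val_unramified g = k"
    using val_unramified[OF assms(2)] by eventually_elim simp
  thus ?thesis by simp
qed

lemma val_unramified_base: "x \<noteq> 0 \<Longrightarrow> val_unramified (x, 0) = \<nu> x"
  by (rule val_unramifiedI[of 0]) (simp_all add: approx_eval_def ff_zero_iff)

lemma val_unramified_valuation: "ff_valuation d f val_unramified"
  unfolding ff_valuation_def
proof (intro conjI allI impI)
  fix g h :: "'a function_field"
  assume g: "g \<noteq> ff_zero" and h: "h \<noteq> ff_zero"
  obtain a b where a: "g = (a, b * c)" by (rule decompose)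
  obtain a' b' where a': "h = (a', b' * c)" by (rule decompose)
  note ab = a a'
  \<comment> \<open>Evaluation is multiplicative only up to b b' (s^2 - D); from stage K on, this
    error has higher order than the product of the two values.\<close>
  define K where "K = nat (val_unramified g + val_unramified h + 1 - \<nu> b - \<nu> b')"
  have gh: "ff_mult d f g h \<noteq> ff_zero"
  proof
    assume "ff_mult d f g h = ff_zero"
    hence 0: "a * a' + D * (b * b') = 0" "a * b' + b * a' = 0"
      unfolding ab mult_eq pair_zero_iff by auto
    have "(a^2 - b^2 * D) * (a'^2 - b'^2 * D) = (a * a' + D * (b * b'))^2 - (a * b' + b * a')^2 * D"
      by Groebner_Basis.algebra
    with 0 norm_neq_0[of a b] norm_neq_0[of a' b'] g h show False
      by (simp add: ab pair_zero_iff)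
  qed
  have "\<forall>\<^sub>F n in sequentially. n \<ge> K" by (rule eventually_ge_at_top)
  hence "\<forall>\<^sub>F n in sequentially. val_unramified (ff_mult d f g h) = val_unramified g + val_unramified h"
    using val_unramified[OF g] val_unramified[OF h] val_unramified[OF gh]
  proof eventually_elim
    case (elim n)
    have eq: "approx_eval n (ff_mult d f g h) =
      approx_eval n g * approx_eval n h + - (b * b' * (approx n ^ 2 - D))"
      unfolding ab mult_eq approx_eval_pair by Groebner_Basis.algebra
    have "ge (\<nu> (approx_eval n g * approx_eval n h) + 1) (- (b * b' * (approx n ^ 2 - D)))"
      using ge_mult[OF ge_mult[OF ge_nu ge_nu] approx(2)[of n], of b b']
      unfolding ge_uminus by (rule ge_mono) (use elim in \<open>simp add: K_def nu_mult\<close>)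
    from dominant(2)[OF _ this] elim
    have "\<nu> (approx_eval n (ff_mult d f g h)) = \<nu> (approx_eval n g * approx_eval n h)"
      unfolding eq by simp
    with elim show ?case by (simp add: nu_mult)
  qed
  thus "val_unramified (ff_mult d f g h) = val_unramified g + val_unramified h" by simp
next
  fix g h :: "'a function_field"
  assume g: "g \<noteq> ff_zero" and h: "h \<noteq> ff_zero" and gh: "ff_add g h \<noteq> ff_zero"
  have eq: "approx_eval n (ff_add g h) = approx_eval n g + approx_eval n h" for n
    by (simp add: approx_eval_def ff_add_def algebra_simps add_divide_distrib)
  from val_unramified[OF g] val_unramified[OF h] val_unramified[OF gh]
  have "\<forall>\<^sub>F n in sequentially. min (val_unramified g) (val_unramified h) \<le> val_unramified (ff_add g h)"
  proof eventually_elim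
    case (elim n)
    thus ?case using nu_add[of "approx_eval n g" "approx_eval n h"] by (simp add: eq)
  qed
  thus "min (val_unramified g) (val_unramified h) \<le> val_unramified (ff_add g h)" by simp
next
  fix a :: 'a assume a: "a \<noteq> 0"
  show "val_unramified (ff_const a) = 0"
    using val_unramified_base[of "fract_const a"] nu_const[OF a] a
    by (simp add: ff_const_def ff_of_base_def fract_const_eq_0_iff flip: fract_const_def)
next
  have "val_unramified (t, 0) = 1"
    using val_unramified_base[OF t(1)] t by simp
  thus "\<exists>g. g \<noteq> ff_zero \<and> val_unramified g = 1" using t by (intro exI[of _ "(t, 0)"]) (simp add: ff_zero_iff)
qed (simp add: val_unramified_def)

lemma val_unramified_centred: "centred val_unramified"
  unfolding centred_def
proof
  have "val_unramified (t, 0) = 1"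
    using val_unramified_base[OF t(1)] t by simp
  thus "val_unramified (t, 0) > 0" by simp
  have "(- fract_const \<beta>, c) \<noteq> ff_zero" using c by (simp add: ff_zero_iff)
  from val_unramified[OF this]
  have "\<forall>\<^sub>F n in sequentially. val_unramified (- fract_const \<beta>, c) > 0"
  proof eventually_elim
    case (elim n)
    thus ?case using approx(1)[of n] c by (auto simp: approx_eval_def ge_def)
  qed
  thus "val_unramified (- fract_const \<beta>, c) > 0" by simp
qed

end

subsubsection \<open>Branch points\<close>

lemma ramified_uniformizer:
  assumes "\<beta> = 0" and "ff_valuation d f v" "centred v"
  shows "v (t, 0) = 2 * v (0, c)"
proof -
  interpret ff_val d f v by unfold_locales fact
  have "2 * v (0, c) = v (D, 0)"
    using v_mult[of "(0, c)" "(0, c)"] mult_eq[of 0 1 0 1] c by (simp add: ff_zero_iff)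
  also have "\<dots> = v (t, 0) * \<nu> D"
    using D_neq_0 assms by (intro v_base) simp_all
  finally show ?thesis using branch[OF assms(1)] by simp
qed

text \<open>At a branch point a^2 has even order and b^2 D has odd order, so the two terms of a + b
  c y never have the same value and cannot cancel.\<close>

lemma ramified_value:
  assumes \<beta>: "\<beta> = 0" and v: "ff_valuation d f v" "centred v" and ab: "a \<noteq> 0 \<or> b \<noteq> 0"
  shows "v (a, b * c) = v (0, c) * \<nu> (a^2 - b^2 * D)"
proof -
  interpret ff_val d f v by unfold_locales fact
  have pos: "v (0, c) > 0"
    using ramified_uniformizer[OF \<beta> v] v_t_pos[OF v] by simp
  have va: "v (a, 0) = v (0, c) * \<nu> (a^2)" if "a \<noteq> 0"
    using v_base[OF v that] ramified_uniformizer[OF \<beta> v] that by (simp add: nu_power)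
  have nb: "\<nu> (b^2 * D) = 2 * \<nu> b + 1" if "b \<noteq> 0"
  proof -
    have "\<nu> (b^2 * D) = \<nu> (b^2) + \<nu> D" by (rule nu_mult) (use that D_neq_0 in auto)
    thus ?thesis using that branch[OF \<beta>] by (simp add: nu_power)
  qed
  have vb: "v (0, b * c) = v (0, c) * \<nu> (- (b^2 * D))" if "b \<noteq> 0"
    using v_base_mult[OF that, of 0 c] v_base[OF v that] ramified_uniformizer[OF \<beta> v] c nb[OF that]
    by (simp only: nu_uminus) (simp add: ff_zero_iff algebra_simps)
  consider "b = 0" "a \<noteq> 0" | "a = 0" "b \<noteq> 0" | "a \<noteq> 0" "b \<noteq> 0" "\<nu> (a^2) < \<nu> (- (b^2 * D))"
    | "a \<noteq> 0" "b \<noteq> 0" "\<nu> (- (b^2 * D)) < \<nu> (a^2)"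
  proof -
    have "\<nu> (a^2) \<noteq> \<nu> (- (b^2 * D))" if "a \<noteq> 0" "b \<noteq> 0"
      using nb[OF that(2)] that unfolding nu_uminus by (simp add: nu_power) presburger
    thus ?thesis using ab that by fastforce
  qed
  thus ?thesis
  proof cases
    case 1
    thus ?thesis using va by simp
  next
    case 2
    thus ?thesis using vb by simp
  next
    case 3
    have "\<nu> (a^2 + - (b^2 * D)) = \<nu> (a^2)"
      by (rule dominant) (use 3 in \<open>auto simp: ge_def\<close>)
    moreover have "v (a, 0) < v (0, b * c)" using va vb 3 pos by simp
    ultimately show ?thesis using v_dominant(2)[of a 0 0 "b * c"] 3 va by (simp add: ff_zero_iff)
  next
    case 4
    have "\<nu> (- (b^2 * D) + a^2) = \<nu> (- (b^2 * D))"
      by (rule dominant) (use 4 D_neq_0 in \<open>auto simp: ge_def\<close>)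
    moreover have "v (0, b * c) < v (a, 0)" using va vb 4 pos by simp
    ultimately show ?thesis using v_dominant(2)[of 0 "b * c" a 0] 4 vb c by (simp add: ff_zero_iff)
  qed
qed

text \<open>A single point of the curve lies over a branch point, so the order of the norm down to
  the rational functions in x is already the normalized valuation.\<close>

definition val_ramified :: "'a function_field \<Rightarrow> int" where
  "val_ramified g = (if g = ff_zero then 0 else \<nu> ((fst g)^2 - (snd g / c)^2 * D))"

context
  assumes \<beta>: "\<beta> = 0"
begin

lemma val_ramified_pair:
  "a \<noteq> 0 \<or> b \<noteq> 0 \<Longrightarrow> val_ramified (a, b * c) = \<nu> (a^2 - b^2 * D)"
  using c by (auto simp: val_ramified_def pair_zero_iff)

text \<open>The norm is not additive, so the ultrametric inequality is drawn from this description,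
  which is: t has value 2 and c y has value 1, so value at least n means 2 \<nu>(a) \<ge> n and 2
  \<nu>(b) + 1 \<ge> n, and the bounds are rounded up.\<close>

lemma val_ramified_ge:
  assumes "a \<noteq> 0 \<or> b \<noteq> 0"
  shows "val_ramified (a, b * c) \<ge> n \<longleftrightarrow> ge ((n + 1) div 2) a \<and> ge (n div 2) b"
proof -
  have na: "\<nu> (a^2) = 2 * \<nu> a" if "a \<noteq> 0" using that by (simp add: nu_power)
  have nb: "\<nu> (- (b^2 * D)) = 2 * \<nu> b + 1" if "b \<noteq> 0"
  proof -
    have "\<nu> (b^2 * D) = \<nu> (b^2) + \<nu> D" by (rule nu_mult) (use that D_neq_0 in auto)
    thus ?thesis using that branch[OF \<beta>] unfolding nu_uminus by (simp add: nu_power)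
  qed
  consider "b = 0" "a \<noteq> 0" | "a = 0" "b \<noteq> 0" | "a \<noteq> 0" "b \<noteq> 0" "\<nu> a \<le> \<nu> b"
    | "a \<noteq> 0" "b \<noteq> 0" "\<nu> b < \<nu> a" using assms by fastforce
  thus ?thesis
  proof cases
    case 1
    thus ?thesis using na val_ramified_pair[OF assms] by (auto simp: ge_def)
  next
    case 2
    thus ?thesis using nb val_ramified_pair[OF assms] by (auto simp: ge_def)
  next
    case 3
    have "\<nu> (a^2 + - (b^2 * D)) = \<nu> (a^2)"
      by (rule dominant) (use 3 na nb in \<open>auto simp: ge_def\<close>)
    thus ?thesis using 3 na val_ramified_pair[OF assms] by (auto simp: ge_def)
  next
    case 4
    have "\<nu> (- (b^2 * D) + a^2) = \<nu> (- (b^2 * D))"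
      by (rule dominant) (use 4 D_neq_0 na nb in \<open>auto simp: ge_def\<close>)
    hence "val_ramified (a, b * c) = 2 * \<nu> b + 1"
      using nb[OF 4(2)] val_ramified_pair[OF assms] by simp
    thus ?thesis using 4 by (auto simp: ge_def)
  qed
qed

lemma val_ramified_valuation: "ff_valuation d f val_ramified"
  unfolding ff_valuation_def
proof (intro conjI allI impI)
  fix g h :: "'a function_field"
  assume g: "g \<noteq> ff_zero" and h: "h \<noteq> ff_zero"
  obtain a b where a: "g = (a, b * c)" by (rule decompose)
  obtain a' b' where a': "h = (a', b' * c)" by (rule decompose)
  have nz: "a \<noteq> 0 \<or> b \<noteq> 0" "a' \<noteq> 0 \<or> b' \<noteq> 0" using g h by (auto simp: a a' pair_zero_iff)
  have eq: "(a * a' + D * (b * b'))^2 - (a * b' + b * a')^2 * D = (a^2 - b^2 * D) * (a'^2 - b'^2 * D)"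
    by Groebner_Basis.algebra
  have nz': "a * a' + D * (b * b') \<noteq> 0 \<or> a * b' + b * a' \<noteq> 0"
  proof (rule ccontr)
    assume "\<not> ?thesis"
    hence "(a^2 - b^2 * D) * (a'^2 - b'^2 * D) = 0" unfolding eq[symmetric] by simp
    with norm_neq_0[OF nz(1)] norm_neq_0[OF nz(2)] show False by simp
  qed
  show "val_ramified (ff_mult d f g h) = val_ramified g + val_ramified h"
    unfolding a a' mult_eq val_ramified_pair[OF nz(1)] val_ramified_pair[OF nz(2)]
      val_ramified_pair[OF nz'] eq
    by (rule nu_mult) (use norm_neq_0[OF nz(1)] norm_neq_0[OF nz(2)] in simp_all)
next
  fix g h :: "'a function_field"
  assume g: "g \<noteq> ff_zero" and h: "h \<noteq> ff_zero" and gh: "ff_add g h \<noteq> ff_zero"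
  obtain a b where a: "g = (a, b * c)" by (rule decompose)
  obtain a' b' where a': "h = (a', b' * c)" by (rule decompose)
  define n where "n = min (val_ramified g) (val_ramified h)"
  have s: "ff_add g h = (a + a', (b + b') * c)" by (simp add: ff_add_def a a' algebra_simps)
  have nz: "a \<noteq> 0 \<or> b \<noteq> 0" "a' \<noteq> 0 \<or> b' \<noteq> 0" "a + a' \<noteq> 0 \<or> b + b' \<noteq> 0"
    using g h gh unfolding s unfolding a a' pair_zero_iff by blast+
  have "val_ramified g \<ge> n" "val_ramified h \<ge> n" by (simp_all add: n_def)
  hence "val_ramified (ff_add g h) \<ge> n"
    unfolding s unfolding a a' val_ramified_ge[OF nz(1)] val_ramified_ge[OF nz(2)] val_ramified_ge[OF nz(3)]
    by (intro conjI ge_add) simp_all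
  thus "min (val_ramified g) (val_ramified h) \<le> val_ramified (ff_add g h)" by (simp add: n_def)
next
  fix a :: 'a assume "a \<noteq> 0"
  thus "val_ramified (ff_const a) = 0"
    using nu_const[of a] val_ramified_pair[of "fract_const a" 0]
    by (simp add: ff_const_def ff_of_base_def fract_const_eq_0_iff nu_power flip: fract_const_def)
next
  show "\<exists>g. g \<noteq> ff_zero \<and> val_ramified g = 1"
    using val_ramified_pair[of 0 1] branch[OF \<beta>] c by (intro exI[of _ "(0, c)"]) (simp add: ff_zero_iff)
qed (simp add: val_ramified_def)

lemma val_ramified_centred: "centred val_ramified"
  unfolding centred_def
  using val_ramified_pair[of 0 1] val_ramified_pair[of t 0] branch[OF \<beta>] t
  by (simp add: \<beta> nu_power)

end

subsubsection \<open>Existence, uniqueness and values\<close>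

lemma valuation_exists: "\<exists>v. ff_valuation d f v \<and> centred v"
  using val_ramified_valuation val_ramified_centred val_unramified_valuation val_unramified_centred
  by (cases "\<beta> = 0") blast+

definition uniformizer :: "'a function_field" where
  "uniformizer = (if \<beta> = 0 then (0, c) else (t, 0))"

lemma value_multiple:
  assumes "g \<noteq> ff_zero"
  shows "\<exists>m. \<forall>v. ff_valuation d f v \<and> centred v \<longrightarrow> v g = v uniformizer * m"
proof (cases "\<beta> = 0")
  case True
  obtain a b where g: "g = (a, b * c)" by (rule decompose)
  have "a \<noteq> 0 \<or> b \<noteq> 0" using assms by (auto simp: g pair_zero_iff)
  moreover have "uniformizer = (0, c)" unfolding uniformizer_def using True by simp
  ultimately show ?thesis using ramified_value[OF True] unfolding g by metis
next
  case False
  thus ?thesis using unramified_value[OF False assms] by (simp add: uniformizer_def)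
qed

text \<open>Every value of v is a multiple of its value at \<open>uniformizer\<close>, which is
  positive, and by normalization 1 is a value of v.\<close>

lemma value_uniformizer:
  assumes "ff_valuation d f v" "centred v"
  shows "v uniformizer = 1"
proof -
  interpret ff_val d f v by unfold_locales fact
  obtain g where g: "g \<noteq> ff_zero" "v g = 1" using v_one by blast
  obtain m where "v g = v uniformizer * m" using value_multiple[OF g(1)] assms by blast
  hence "v uniformizer * m = 1" using g by simp
  moreover have "v uniformizer > 0"
    using assms by (auto simp: uniformizer_def centred_def)
  ultimately show ?thesis using zmult_eq_1_iff by force
qed

lemma valuation_unique:
  assumes "ff_valuation d f v" "centred v" "ff_valuation d f w" "centred w"
  shows "v = w"
proof
  fix g
  show "v g = w g"
  proof (cases "g = ff_zero")
    case True
    thus ?thesis using ff_val.v_zero[OF ff_val.intro] assms by metis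
  next
    case False
    then obtain m where "v g = v uniformizer * m" "w g = w uniformizer * m"
      using value_multiple assms by meson
    thus ?thesis using value_uniformizer[OF assms(1,2)] value_uniformizer[OF assms(3,4)] by simp
  qed
qed

lemma value_t:
  assumes "ff_valuation d f v" "centred v"
  shows "v (t, 0) = (if \<beta> = 0 then 2 else 1)"
  using value_uniformizer[OF assms] ramified_uniformizer[OF _ assms] by (auto simp: uniformizer_def)

lemma value_base:
  assumes "ff_valuation d f v" "centred v" "x \<noteq> 0"
  shows "v (x, 0) = (if \<beta> = 0 then 2 else 1) * \<nu> x"
  using v_base[OF assms] value_t[OF assms(1,2)] by simp

text \<open>The form in which orders of y - m(x) are computed, with q = - c m. The function q + c y
  vanishes at the point exactly if q has residue - \<beta>; its order is then that of the norm, at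
  branch points as well as elsewhere.\<close>

lemma value_chart:
  assumes v: "ff_valuation d f v" "centred v" and k: "ge 1 (q - fract_const k)"
  shows "v (q, c) = (if k + \<beta> = 0 then \<nu> (q^2 - D) else 0)"
proof -
  interpret ff_val d f v by unfold_locales fact
  show ?thesis
  proof (cases "k + \<beta> = 0")
    case False
    hence "v (q, c) = 0" using v_unit(2)[OF False pos_base pos_y] v k by simp
    thus ?thesis using False by simp
  next
    case True
    show ?thesis
    proof (cases "\<beta> = 0")
      case b: True
      have "v (0, c) = 1" using value_uniformizer[OF v] unfolding uniformizer_def using b by simp
      thus ?thesis using ramified_value[OF b v, of q 1] True by simp
    next
      case b: False
      have "q \<noteq> 0"
      proof
        assume "q = 0"
        hence "ge 1 (fract_const k)" using k ge_uminus[of 1 "fract_const k"] by simp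
        moreover have "k \<noteq> 0" using True b by auto
        ultimately show False using nu_const[of k] by (auto simp: ge_def fract_const_eq_0_iff)
      qed
      from unramified_value_conj[OF b v k True this] value_t[OF v] b True show ?thesis by simp
    qed
  qed
qed

end

subsection \<open>Valuations at the points of the line\<close>

definition fract_val :: "('a::field poly \<Rightarrow> int) \<Rightarrow> 'a poly fract \<Rightarrow> int" where
  "fract_val u x = (THE n. \<exists>p q. p \<noteq> 0 \<and> q \<noteq> 0 \<and> x = Fract p q \<and> n = u p - u q)"

text \<open>Common source of the order at a finite point and of minus the degree. The axiom
  \<open>u_residue\<close> is the polynomial form of the statement that the residue field consists
  of the constants.\<close>

locale poly_valuation =
  fixes u :: "'a::field poly \<Rightarrow> int"
  assumes u_mult: "p \<noteq> 0 \<Longrightarrow> q \<noteq> 0 \<Longrightarrow> u (p * q) = u p + u q"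
    and u_add: "p \<noteq> 0 \<Longrightarrow> q \<noteq> 0 \<Longrightarrow> p + q \<noteq> 0 \<Longrightarrow> u (p + q) \<ge> min (u p) (u q)"
    and u_const: "a \<noteq> 0 \<Longrightarrow> u [:a:] = 0"
    and u_residue: "p \<noteq> 0 \<Longrightarrow> q \<noteq> 0 \<Longrightarrow> u p = u q \<Longrightarrow>
      \<exists>a. p = smult a q \<or> u (p - smult a q) > u q"
begin

lemma fract_val_Fract:
  assumes "p \<noteq> 0" "q \<noteq> 0"
  shows "fract_val u (Fract p q) = u p - u q"
  unfolding fract_val_def
proof (rule the_equality)
  show "\<exists>p' q'. p' \<noteq> 0 \<and> q' \<noteq> 0 \<and> Fract p q = Fract p' q' \<and> u p - u q = u p' - u q'"
    using assms by blast
next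
  fix n assume "\<exists>p' q'. p' \<noteq> 0 \<and> q' \<noteq> 0 \<and> Fract p q = Fract p' q' \<and> n = u p' - u q'"
  then obtain p' q' where *: "p' \<noteq> 0" "q' \<noteq> 0" "Fract p q = Fract p' q'" "n = u p' - u q'" by blast
  hence "p * q' = p' * q" using assms by (simp add: eq_fract)
  hence "u p + u q' = u p' + u q" using u_mult[of p q'] u_mult[of p' q] assms * by simp
  thus "n = u p - u q" using * by simp
qed

lemma fract_val_rational_valuation: "rational_valuation (fract_val u)"
proof
  fix x y :: "'a poly fract"
  assume "x \<noteq> 0" "y \<noteq> 0"
  obtain p q where x: "x = Fract p q" "q \<noteq> 0" by (cases x) auto
  obtain r s where y: "y = Fract r s" "s \<noteq> 0" by (cases y) auto
  have nz: "p \<noteq> 0" "r \<noteq> 0" using \<open>x \<noteq> 0\<close> \<open>y \<noteq> 0\<close> x y by (auto simp: fract_collapse)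
  show "fract_val u (x * y) = fract_val u x + fract_val u y"
    using nz x y by (simp add: fract_val_Fract u_mult)
  assume "x + y \<noteq> 0"
  hence "p * s + r * q \<noteq> 0" using x y by (auto simp: fract_collapse)
  with u_add[of "p * s" "r * q"] nz x y
  show "fract_val u (x + y) \<ge> min (fract_val u x) (fract_val u y)"
    by (simp add: fract_val_Fract u_mult)
next
  fix a :: 'a assume "a \<noteq> 0"
  thus "fract_val u (fract_const a) = 0"
    using u_const[of 1] by (simp add: fract_const_def fract_val_Fract u_const pCons_one)
next
  fix x :: "'a poly fract"
  assume "x \<noteq> 0" "fract_val u x = 0"
  obtain p q where x: "x = Fract p q" "q \<noteq> 0" by (cases x) auto
  have nz: "p \<noteq> 0" using \<open>x \<noteq> 0\<close> x by (auto simp: fract_collapse)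
  have "u p = u q" using \<open>fract_val u x = 0\<close> nz x by (simp add: fract_val_Fract)
  from u_residue[OF nz x(2) this] obtain a where a: "p = smult a q \<or> u (p - smult a q) > u q" by blast
  have eq: "x - fract_const a = Fract (p - smult a q) q"
    using x by (simp add: fract_const_def mult.commute)
  have "x = fract_const a \<or> fract_val u (x - fract_const a) > 0"
  proof (cases "p - smult a q = 0")
    case True
    hence "x - fract_const a = 0" unfolding eq by (simp add: fract_collapse)
    thus ?thesis by simp
  next
    case False
    thus ?thesis using a unfolding eq fract_val_Fract[OF False x(2)] by simp
  qed
  thus "\<exists>a. x = fract_const a \<or> fract_val u (x - fract_const a) > 0" by blast
qed

end

lemma order_add_ge:
  assumes "p \<noteq> 0" "q \<noteq> 0" "p + q \<noteq> 0"
  shows "order a (p + q) \<ge> min (order a p) (order a q)"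
proof -
  have "[:- a, 1:] ^ min (order a p) (order a q) dvd p + q"
    by (intro dvd_add) (simp_all add: order_divides)
  thus ?thesis using assms by (simp add: order_divides)
qed

lemma order_residue:
  fixes p q :: "'a::field poly"
  assumes "p \<noteq> 0" "q \<noteq> 0" "order a p = order a q"
  shows "\<exists>k. p = smult k q \<or> order a (p - smult k q) > order a q"
proof -
  define n where "n = order a q"
  obtain p' where p: "p = [:- a, 1:] ^ n * p'" "\<not> [:- a, 1:] dvd p'"
    using order_decomp[OF assms(1), of a] assms(3) by (auto simp: n_def)
  obtain q' where q: "q = [:- a, 1:] ^ n * q'" "\<not> [:- a, 1:] dvd q'"
    using order_decomp[OF assms(2), of a] by (auto simp: n_def)
  define k where "k = poly p' a / poly q' a"
  have "poly q' a \<noteq> 0" using q(2) by (simp add: poly_eq_0_iff_dvd)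
  hence "poly (p' - smult k q') a = 0" by (simp add: k_def)
  hence "[:- a, 1:] dvd p' - smult k q'" by (simp only: poly_eq_0_iff_dvd)
  hence "[:- a, 1:] ^ Suc n dvd [:- a, 1:] ^ n * (p' - smult k q')"
    unfolding power_Suc2 by (rule mult_dvd_mono[OF dvd_refl])
  also have "[:- a, 1:] ^ n * (p' - smult k q') = p - smult k q"
    by (simp add: p(1) q(1) algebra_simps)
  finally have "p - smult k q = 0 \<or> Suc n \<le> order a (p - smult k q)"
    by (simp only: order_divides)
  thus ?thesis by (intro exI[of _ k]) (auto simp: n_def)
qed

lemma degree_residue:
  fixes p q :: "'a::field poly"
  assumes "p \<noteq> 0" "q \<noteq> 0" "degree p = degree q"
  shows "\<exists>k. p = smult k q \<or> degree (p - smult k q) < degree q"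
proof -
  define k where "k = lead_coeff p / lead_coeff q"
  have "degree (p - smult k q) \<le> degree q"
    using assms by (intro degree_diff_le) simp_all
  moreover have "coeff (p - smult k q) (degree q) = 0"
    using assms by (simp add: k_def)
  ultimately have "p - smult k q = 0 \<or> degree (p - smult k q) < degree q"
    using eq_zero_or_degree_less by blast
  thus ?thesis by (intro exI[of _ k]) auto
qed

definition nu_at :: "'a::field \<Rightarrow> 'a poly fract \<Rightarrow> int" where
  "nu_at a = fract_val (\<lambda>p. int (order a p))"

definition nu_infinity :: "'a::field poly fract \<Rightarrow> int" where
  "nu_infinity = fract_val (\<lambda>p. - int (degree p))"

interpretation order_valuation: poly_valuation "\<lambda>p. int (order a p)" for a :: "'a::field"
proof
  fix p q :: "'a poly"
  assume "p \<noteq> 0" "q \<noteq> 0"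
  thus "int (order a (p * q)) = int (order a p) + int (order a q)"
    by (simp add: order_mult)
next
  fix p q :: "'a poly"
  assume "p \<noteq> 0" "q \<noteq> 0" "p + q \<noteq> 0"
  thus "min (int (order a p)) (int (order a q)) \<le> int (order a (p + q))"
    using order_add_ge[of p q a] by linarith
next
  fix p q :: "'a poly"
  assume "p \<noteq> 0" "q \<noteq> 0" "int (order a p) = int (order a q)"
  thus "\<exists>k. p = smult k q \<or> int (order a q) < int (order a (p - smult k q))"
    using order_residue[of p q a] by simp
next
  fix k :: 'a assume "k \<noteq> 0"
  thus "int (order a [:k:]) = 0" by (simp add: order_0I)
qed

interpretation degree_valuation: poly_valuation "\<lambda>p::'a::field poly. - int (degree p)"
proof
  fix p q :: "'a poly"
  assume "p \<noteq> 0" "q \<noteq> 0"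
  thus "- int (degree (p * q)) = - int (degree p) + - int (degree q)"
    by (simp add: degree_mult_eq)
next
  fix p q :: "'a poly"
  show "min (- int (degree p)) (- int (degree q)) \<le> - int (degree (p + q))"
    using degree_add_le_max[of p q] by linarith
next
  fix p q :: "'a poly"
  assume "p \<noteq> 0" "q \<noteq> 0" "- int (degree p) = - int (degree q)"
  thus "\<exists>k. p = smult k q \<or> - int (degree q) < - int (degree (p - smult k q))"
    using degree_residue[of p q] by simp
qed simp

lemma nu_at_Fract: "p \<noteq> 0 \<Longrightarrow> q \<noteq> 0 \<Longrightarrow> nu_at a (Fract p q) = int (order a p) - int (order a q)"
  unfolding nu_at_def by (rule order_valuation.fract_val_Fract)

lemma nu_infinity_Fract:
  "p \<noteq> 0 \<Longrightarrow> q \<noteq> 0 \<Longrightarrow> nu_infinity (Fract p q) = int (degree q) - int (degree p)"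
  unfolding nu_infinity_def by (simp add: degree_valuation.fract_val_Fract)

interpretation nu_at: rational_valuation "nu_at a" for a :: "'a::field"
  unfolding nu_at_def by (rule order_valuation.fract_val_rational_valuation)

interpretation nu_infinity: rational_valuation nu_infinity
  unfolding nu_infinity_def by (rule degree_valuation.fract_val_rational_valuation)

lemma (in ff_val) v_Fract:
  assumes "p \<noteq> 0" "q \<noteq> 0"
  shows "v (Fract p q, 0) = v (Fract p 1, 0) - v (Fract q 1, 0)"
proof -
  have "Fract q 1 * Fract p q = Fract p 1" using assms by (simp add: eq_fract)
  moreover have "Fract q 1 \<noteq> 0" "Fract p q \<noteq> 0" using assms by (simp_all add: Zero_fract_def eq_fract)
  ultimately show ?thesis
    using v_base_mult[of "Fract q 1" "Fract p q" 0] by (simp add: ff_zero_iff)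
qed

lemma (in ff_val) v_poly_mult:
  assumes "p \<noteq> 0" "q \<noteq> 0"
  shows "v (Fract (p * q) 1, 0) = v (Fract p 1, 0) + v (Fract q 1, 0)"
  using v_base_mult[of "Fract p 1" "Fract q 1" 0] assms
  by (simp add: ff_zero_iff Zero_fract_def eq_fract)

text \<open>By Horner's scheme v is nonnegative on polynomials. A polynomial that does not vanish at
  a is a nonzero constant plus a multiple of x - a, hence a unit, so only the power of x - a
  dividing a polynomial contributes.\<close>

lemma (in ff_val) v_nu_at:
  assumes t: "v (Fract [:- a, 1:] 1, 0) > 0" and "x \<noteq> 0"
  shows "v (x, 0) = v (Fract [:- a, 1:] 1, 0) * nu_at a x"
proof -
  let ?t = "Fract [:- a, 1:] 1"
  have nonneg: "p = 0 \<or> v (Fract p 1, 0) \<ge> 0" for p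
  proof (induction p)
    case (pCons k p)
    have eq: "Fract (pCons k p) 1 = fract_const k + (?t + fract_const a) * Fract p 1"
      by (simp add: fract_const_def)
    have X: "v (?t + fract_const a, 0) \<ge> 0"
    proof (cases "a = 0")
      case False
      have "v (fract_const a + ?t, 0 + 0) = v (fract_const a, 0)"
        by (rule v_dominant(2))
          (use False t v_const[OF False] in \<open>auto simp: ff_zero_iff fract_const_eq_0_iff\<close>)
      thus ?thesis using v_const[OF False] by (simp add: add.commute)
    qed (use t in simp)
    have X0: "?t + fract_const a \<noteq> 0" by (simp add: fract_const_def Zero_fract_def eq_fract)
    show ?case
    proof (cases "p = 0")
      case True
      thus ?thesis using v_const[of k] by (cases "k = 0") (simp_all add: fract_const_def)
    next
      case False
      hence p0: "Fract p 1 \<noteq> 0" by (simp add: Zero_fract_def eq_fract)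
      have xp: "v ((?t + fract_const a) * Fract p 1, 0) \<ge> 0"
        using v_base_mult[OF X0, of "Fract p 1" 0] p0 X pCons False by (simp add: ff_zero_iff)
      show ?thesis
      proof (cases "k = 0")
        case True
        thus ?thesis using xp eq by simp
      next
        case k: False
        have "pCons k p \<noteq> 0" using k by simp
        hence "Fract (pCons k p) 1 \<noteq> 0" by (simp add: Zero_fract_def eq_fract)
        thus ?thesis
          using v_add[of "(fract_const k, 0)" "((?t + fract_const a) * Fract p 1, 0)"] v_const[OF k]
            xp X0 p0 k unfolding eq by (simp add: ff_add_def ff_zero_iff fract_const_eq_0_iff)
      qed
    qed
  qed simp
  have unit: "v (Fract p 1, 0) = 0" if "poly p a \<noteq> 0" for p
  proof -
    have "[:- a, 1:] dvd p - [:poly p a:]" by (simp add: poly_eq_0_iff_dvd[symmetric])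
    then obtain r where r: "p - [:poly p a:] = [:- a, 1:] * r" ..
    have eq: "Fract p 1 = fract_const (poly p a) + Fract ([:- a, 1:] * r) 1"
      by (simp only: r[symmetric]) (simp add: fract_const_def)
    have "pos (Fract ([:- a, 1:] * r) 1, 0)"
    proof (cases "r = 0")
      case False
      thus ?thesis using v_poly_mult[of "[:- a, 1:]" r] nonneg[of r] t by (simp add: pos_def)
    qed (simp add: pos_def ff_zero_iff fract_collapse)
    from v_const_plus_pos(2)[OF that this] show ?thesis unfolding eq .
  qed
  have pow: "v (Fract ([:- a, 1:] ^ n) 1, 0) = int n * v (?t, 0)" for n
  proof (induction n)
    case 0
    thus ?case using v_const[of 1] by (simp add: One_fract_def)
  next
    case (Suc n)
    thus ?case using v_poly_mult[of "[:- a, 1:]" "[:- a, 1:] ^ n"] by (simp add: algebra_simps)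
  qed
  have poly: "v (Fract p 1, 0) = int (order a p) * v (?t, 0)" if p: "p \<noteq> 0" for p
  proof -
    obtain r where r: "p = [:- a, 1:] ^ order a p * r" "\<not> [:- a, 1:] dvd r"
      using order_decomp[OF p] by blast
    have "r \<noteq> 0" using r by auto
    moreover have "poly r a \<noteq> 0" using r(2) by (simp add: poly_eq_0_iff_dvd)
    ultimately show ?thesis using v_poly_mult[of "[:- a, 1:] ^ order a p" r] pow unit r(1) by simp
  qed
  obtain p q where x: "x = Fract p q" "q \<noteq> 0" by (cases x) auto
  have "p \<noteq> 0" using \<open>x \<noteq> 0\<close> x by (auto simp: fract_collapse)
  thus ?thesis using x v_Fract[of p q] poly[of p] poly[of q] by (simp add: nu_at_Fract algebra_simps)
qed

text \<open>As x has negative value, the leading term of a polynomial dominates all other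
  terms.\<close>

lemma (in ff_val) v_nu_infinity:
  assumes t: "v (Fract 1 [:0, 1:], 0) > 0" and "x \<noteq> 0"
  shows "v (x, 0) = v (Fract 1 [:0, 1:], 0) * nu_infinity x"
proof -
  let ?t = "Fract 1 [:0, 1:]"
  have X: "v (Fract [:0, 1:] 1, 0) = - v (?t, 0)"
    using v_Fract[of 1 "[:0, 1:]"] v_const[of 1] by (simp add: One_fract_def)
  have poly: "p \<noteq> 0 \<Longrightarrow> v (Fract p 1, 0) = - int (degree p) * v (?t, 0)" for p
  proof (induction p)
    case (pCons k p)
    show ?case
    proof (cases "p = 0")
      case True
      thus ?thesis using v_const[of k] pCons.prems by (simp add: fract_const_def)
    next
      case False
      have xp: "v (Fract ([:0, 1:] * p) 1, 0) = - int (degree (pCons k p)) * v (?t, 0)"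
        using v_poly_mult[of "[:0, 1:]" p] X pCons False by (simp add: algebra_simps)
      have eq: "Fract (pCons k p) 1 = Fract ([:0, 1:] * p) 1 + fract_const k"
        by (simp add: fract_const_def)
      have "v (Fract ([:0, 1:] * p) 1 + fract_const k, 0 + 0) = v (Fract ([:0, 1:] * p) 1, 0)"
      proof (rule v_dominant(2))
        show "(Fract ([:0, 1:] * p) 1, 0) \<noteq> ff_zero"
          using False by (simp add: ff_zero_iff Zero_fract_def eq_fract)
        have "v (Fract ([:0, 1:] * p) 1, 0) < 0"
          using xp t False by (simp add: mult_less_0_iff)
        thus "(fract_const k, 0) = ff_zero \<or> v (Fract ([:0, 1:] * p) 1, 0) < v (fract_const k, 0)"
          using v_const[of k] by (cases "k = 0") (simp_all add: ff_zero_iff)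
      qed
      thus ?thesis using xp eq by simp
    qed
  qed simp
  obtain p q where x: "x = Fract p q" "q \<noteq> 0" by (cases x) auto
  have "p \<noteq> 0" using \<open>x \<noteq> 0\<close> x by (auto simp: fract_collapse)
  thus ?thesis using x v_Fract[of p q] poly[of p] poly[of q]
    by (simp add: nu_infinity_Fract algebra_simps)
qed

subsection \<open>Orders of vanishing on a sextic curve\<close>

locale sextic_curve =
  fixes d :: "'a::alg_closed_field" and f :: "'a poly"
  assumes two: "(2::'a) \<noteq> 0"
    and d: "d \<noteq> 0"
    and degree_f: "degree f = 6"
    and simple_roots: "poly f a = 0 \<Longrightarrow> order a f = 1"
begin

lemma f_neq_0: "f \<noteq> 0"
  using degree_f by auto

text \<open>A square has even order at every point of the line, but f has order 1 at its
  roots.\<close>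

lemma y_square: "Fract f [:d:] \<noteq> x ^ 2"
proof
  assume *: "Fract f [:d:] = x ^ 2"
  obtain a where a: "poly f a = 0"
    using alg_closed_imp_poly_has_root[of f] degree_f by auto
  have "Fract f [:d:] \<noteq> 0" using f_neq_0 d by (simp add: Zero_fract_def eq_fract)
  hence "x \<noteq> 0" using * by auto
  hence "nu_at a (x ^ 2) = 2 * nu_at a x" by (simp add: nu_at.nu_power)
  moreover have "nu_at a (x ^ 2) = 1"
    using simple_roots[OF a] f_neq_0 d by (simp add: nu_at_Fract order_0I flip: *)
  ultimately show False by presburger
qed

lemma base_neq_0: "p \<noteq> 0 \<Longrightarrow> Fract p 1 \<noteq> 0"
  by (simp add: Zero_fract_def eq_fract)

lemma smooth_affine:
  assumes "d * \<beta>^2 = poly f \<alpha>"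
  shows "smooth_point (nu_at \<alpha>) d f (Fract [:- \<alpha>, 1:] 1) 1 \<beta>"
proof
  show "Fract [:- \<alpha>, 1:] 1 \<noteq> 0" by (simp add: base_neq_0)
  show "nu_at \<alpha> (Fract [:- \<alpha>, 1:] 1) = 1"
    using order_power_n_n[of \<alpha> 1] by (simp add: nu_at_Fract)
next
  fix v x assume "ff_valuation d f v" "0 < v (Fract [:- \<alpha>, 1:] 1, 0)" "(x::'a poly fract) \<noteq> 0"
  thus "v (x, 0) = v (Fract [:- \<alpha>, 1:] 1, 0) * nu_at \<alpha> x"
    by (intro ff_val.v_nu_at ff_val.intro)
next
  assume "\<beta> \<noteq> 0"
  have eq: "1^2 * Fract f [:d:] - fract_const (\<beta>^2) = Fract (f - [:d * \<beta>^2:]) [:d:]"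
    using d by (simp add: fract_const_def mult.commute)
  show "nu_at.ge \<alpha> 1 (1^2 * Fract f [:d:] - fract_const (\<beta>^2))"
  proof (cases "f - [:d * \<beta>^2:] = 0")
    case True
    thus ?thesis unfolding eq by (simp add: fract_collapse)
  next
    case False
    moreover have "poly (f - [:d * \<beta>^2:]) \<alpha> = 0" using assms by simp
    ultimately have "order \<alpha> (f - [:d * \<beta>^2:]) \<noteq> 0" by (simp only: order_root) simp
    thus ?thesis unfolding eq nu_at.ge_def using False d by (simp add: nu_at_Fract order_0I)
  qed
next
  assume "\<beta> = 0"
  thus "nu_at \<alpha> (1^2 * Fract f [:d:]) = 1"
    using assms simple_roots[of \<alpha>] f_neq_0 d by (simp add: nu_at_Fract order_0I)
qed (use two y_square[symmetric] in simp_all)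

lemma smooth_infinity:
  assumes "d * \<gamma>^2 = coeff f 6"
  shows "smooth_point nu_infinity d f (Fract 1 [:0, 1:]) (Fract 1 ([:0, 1:] ^ 3)) \<gamma>"
proof
  show "Fract 1 [:0, 1:] \<noteq> (0::'a poly fract)" "Fract 1 ([:0, 1:] ^ 3) \<noteq> (0::'a poly fract)"
    by (simp_all add: Zero_fract_def eq_fract)
  show "nu_infinity (Fract 1 [:0::'a, 1:]) = 1"
    by (simp add: nu_infinity_Fract)
next
  fix v x assume "ff_valuation d f v" "0 < v (Fract 1 [:0, 1:], 0)" "(x::'a poly fract) \<noteq> 0"
  thus "v (x, 0) = v (Fract 1 [:0, 1:], 0) * nu_infinity x"
    by (intro ff_val.v_nu_infinity ff_val.intro)
next
  let ?x6 = "([:0, 1:] :: 'a poly) ^ 6"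
  have x6: "?x6 = monom 1 6" by (simp add: monom_altdef)
  have "(Fract 1 ([:0::'a, 1:] ^ 3))^2 = Fract 1 ?x6"
    by (simp add: power2_eq_square flip: power_add)
  hence "(Fract 1 ([:0, 1:] ^ 3))^2 * Fract f [:d:] - fract_const (\<gamma>^2)
    = Fract (f - smult (d * \<gamma>^2) ?x6) (smult d ?x6)"
    using d by (simp add: fract_const_def mult.commute)
  hence eq: "(Fract 1 ([:0, 1:] ^ 3))^2 * Fract f [:d:] - fract_const (\<gamma>^2)
    = Fract (f - monom (coeff f 6) 6) (monom d 6)"
    by (simp add: assms x6 smult_monom)
  show "nu_infinity.ge 1 ((Fract 1 ([:0, 1:] ^ 3))^2 * Fract f [:d:] - fract_const (\<gamma>^2))"
  proof (cases "f - monom (coeff f 6) 6 = 0")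
    case True
    thus ?thesis unfolding eq by (simp add: fract_collapse)
  next
    case False
    have "degree (f - monom (coeff f 6) 6) \<le> 6"
      using degree_f degree_monom_le[of "coeff f 6" 6] by (intro degree_diff_le) simp_all
    moreover have "coeff (f - monom (coeff f 6) 6) 6 = 0" by simp
    ultimately have "degree (f - monom (coeff f 6) 6) < 6"
      using False eq_zero_or_degree_less by blast
    thus ?thesis unfolding eq nu_infinity.ge_def using False d
      by (simp add: nu_infinity_Fract degree_monom_eq)
  qed
next
  \<comment> \<open>Since f has degree exactly 6, infinity is never a branch point and this case is
    contradictory.\<close>
  assume "\<gamma> = 0"
  hence "coeff f 6 = 0" using assms by simp
  hence False using degree_f f_neq_0 leading_coeff_0_iff[of f] by simp
  thus "nu_infinity ((Fract 1 ([:0, 1:] ^ 3))^2 * Fract f [:d:]) = 1" ..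
qed (use two y_square[symmetric] in simp_all)

lemma centred_affine:
  assumes "d * \<beta>^2 = poly f \<alpha>"
  shows "centred_at v (Affine \<alpha> \<beta>) \<longleftrightarrow>
    smooth_point.centred (Fract [:- \<alpha>, 1:] 1) 1 \<beta> v"
  unfolding smooth_point.centred_def[OF smooth_affine[OF assms]]
  by (simp add: ff_diff_def ff_x_def ff_y_def ff_const_def ff_of_base_def fract_const_def)

lemma centred_infinity:
  assumes "d * \<gamma>^2 = coeff f 6"
  shows "centred_at v (At_Infinity \<gamma>) \<longleftrightarrow>
    smooth_point.centred (Fract 1 [:0, 1:]) (Fract 1 ([:0, 1:] ^ 3)) \<gamma> v"
  unfolding smooth_point.centred_def[OF smooth_infinity[OF assms]]
  by (simp add: ff_diff_def ff_const_def ff_of_base_def fract_const_def)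

lemma curve_points_cases:
  assumes "P \<in> curve_points d f"
  obtains (affine) \<alpha> \<beta> where "P = Affine \<alpha> \<beta>" "d * \<beta>^2 = poly f \<alpha>"
  | (infinity) \<gamma> where "P = At_Infinity \<gamma>" "d * \<gamma>^2 = coeff f 6"
  using assms unfolding curve_points_def by blast

lemma valuation_at_unique:
  assumes "P \<in> curve_points d f"
  shows "\<exists>!v. ff_valuation d f v \<and> centred_at v P"
  using assms
proof (cases rule: curve_points_cases)
  case (affine \<alpha> \<beta>)
  interpret smooth_point "nu_at \<alpha>" d f "Fract [:- \<alpha>, 1:] 1" 1 \<beta>
    by (rule smooth_affine[OF affine(2)])
  show ?thesis
    using valuation_exists valuation_unique centred_affine[OF affine(2)] unfolding affine(1) by metis
next
  case (infinity \<gamma>)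
  interpret smooth_point nu_infinity d f "Fract 1 [:0, 1:]" "Fract 1 ([:0, 1:] ^ 3)" \<gamma>
    by (rule smooth_infinity[OF infinity(2)])
  show ?thesis
    using valuation_exists valuation_unique centred_infinity[OF infinity(2)] unfolding infinity(1) by metis
qed

lemma ord_at:
  assumes "P \<in> curve_points d f"
  shows "ff_valuation d f (ord_at d f P)" "centred_at (ord_at d f P) P"
  using theI'[OF valuation_at_unique[OF assms]] unfolding ord_at_def by blast+

lemma ord_at_eqI:
  assumes "P \<in> curve_points d f" "ff_valuation d f v" "centred_at v P"
  shows "ord_at d f P = v"
  unfolding ord_at_def using the1_equality[OF valuation_at_unique[OF assms(1)]] assms(2,3) by blast

lemma ord_affine_base:
  assumes "d * \<beta>^2 = poly f \<alpha>" and "x \<noteq> 0"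
  shows "ord_at d f (Affine \<alpha> \<beta>) (x, 0) = (if \<beta> = 0 then 2 else 1) * nu_at \<alpha> x"
proof -
  interpret smooth_point "nu_at \<alpha>" d f "Fract [:- \<alpha>, 1:] 1" 1 \<beta>
    by (rule smooth_affine[OF assms(1)])
  have P: "Affine \<alpha> \<beta> \<in> curve_points d f" using assms by (simp add: curve_points_def)
  show ?thesis
    using value_base[OF ord_at(1)[OF P], of x] ord_at(2)[OF P]
      centred_affine[OF assms(1)] assms(2) by simp
qed

lemma ord_infinity_base:
  assumes "d * \<gamma>^2 = coeff f 6" and "x \<noteq> 0"
  shows "ord_at d f (At_Infinity \<gamma>) (x, 0) = nu_infinity x"
proof -
  interpret smooth_point nu_infinity d f "Fract 1 [:0, 1:]" "Fract 1 ([:0, 1:] ^ 3)" \<gamma>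
    by (rule smooth_infinity[OF assms(1)])
  have P: "At_Infinity \<gamma> \<in> curve_points d f" using assms by (simp add: curve_points_def)
  have "\<gamma> \<noteq> 0" using assms degree_f f_neq_0 leading_coeff_0_iff[of f] by auto
  thus ?thesis
    using value_base[OF ord_at(1)[OF P], of x] ord_at(2)[OF P]
      centred_infinity[OF assms(1)] assms(2) by simp
qed

text \<open>This is d times the norm of y - m, so its roots are the x-coordinates of the zeros of y
  - m.\<close>

definition norm_y :: "'a poly \<Rightarrow> 'a poly" where
  "norm_y m = smult d (m^2) - f"

lemma norm_y_neq_0: "norm_y m \<noteq> 0"
proof
  assume "norm_y m = 0"
  hence "Fract f [:d:] = (Fract m 1)^2"
    using d by (simp add: norm_y_def eq_fract power2_eq_square)
  thus False using y_square by blast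
qed

lemma norm_y_eq: "(Fract m q)^2 - (Fract 1 q)^2 * Fract f [:d:] = Fract (norm_y m) (smult d (q^2))"
  if "q \<noteq> 0"
proof -
  have "(Fract m q)^2 - (Fract 1 q)^2 * Fract f [:d:] = Fract (m^2) (q^2) - Fract f (smult d (q^2))"
    using d that by (simp add: power2_eq_square)
  also have "Fract (m^2) (q^2) = Fract (smult d (m^2)) (smult d (q^2))"
    using d that by (simp add: eq_fract)
  also have "\<dots> - Fract f (smult d (q^2)) = Fract (smult d (q^2) * norm_y m) (smult d (q^2) * smult d (q^2))"
    using d that by (simp add: norm_y_def algebra_simps)
  also have "\<dots> = Fract (norm_y m) (smult d (q^2))"
    using d that by (intro mult_fract_cancel) simp
  finally show ?thesis .
qed

lemma ord_affine_y:
  assumes "d * \<beta>^2 = poly f \<alpha>"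
  shows "ord_at d f (Affine \<alpha> \<beta>) (- Fract m 1, 1) =
    (if \<beta> = poly m \<alpha> then int (order \<alpha> (norm_y m)) else 0)"
proof -
  interpret smooth_point "nu_at \<alpha>" d f "Fract [:- \<alpha>, 1:] 1" 1 \<beta>
    by (rule smooth_affine[OF assms(1)])
  have P: "Affine \<alpha> \<beta> \<in> curve_points d f" using assms by (simp add: curve_points_def)
  have eq: "- Fract m 1 - fract_const (- poly m \<alpha>) = Fract ([:poly m \<alpha>:] - m) 1"
  proof -
    have "- Fract m 1 - fract_const (- poly m \<alpha>) = Fract (- m - [:- poly m \<alpha>:]) 1"
      by (simp add: fract_const_def)
    also have "- m - [:- poly m \<alpha>:] = [:poly m \<alpha>:] - m"
      by (rule poly_eqI) (simp add: coeff_pCons split: nat.split)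
    finally show ?thesis .
  qed
  have "nu_at.ge \<alpha> 1 (- Fract m 1 - fract_const (- poly m \<alpha>))"
  proof (cases "[:poly m \<alpha>:] - m = 0")
    case True
    thus ?thesis unfolding eq by (simp add: fract_collapse)
  next
    case False
    moreover have "poly ([:poly m \<alpha>:] - m) \<alpha> = 0" by simp
    ultimately have "order \<alpha> ([:poly m \<alpha>:] - m) \<noteq> 0" by (simp only: order_root) simp
    thus ?thesis unfolding eq nu_at.ge_def using False by (simp add: nu_at_Fract)
  qed
  hence *: "ord_at d f (Affine \<alpha> \<beta>) (- Fract m 1, 1) =
    (if - poly m \<alpha> + \<beta> = 0 then nu_at \<alpha> ((- Fract m 1)^2 - D) else 0)"
    using ord_at[OF P] centred_affine[OF assms] by (intro value_chart) simp_all
  have "(- Fract m 1)^2 - D = Fract (norm_y m) [:d:]"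
    using norm_y_eq[of 1 m] by (simp add: power2_eq_square One_fract_def)
  hence "nu_at \<alpha> ((- Fract m 1)^2 - D) = int (order \<alpha> (norm_y m))"
    using norm_y_neq_0 d by (simp add: nu_at_Fract order_0I)
  moreover have "- poly m \<alpha> + \<beta> = 0 \<longleftrightarrow> \<beta> = poly m \<alpha>" by (auto simp: add_eq_0_iff)
  ultimately show ?thesis using * by simp
qed

text \<open>In the chart at infinity y - m is x^3 times y/x^3 - m/x^3. The factor x^3 accounts for
  the - 3, the residue of m/x^3 is the coefficient of x^3 in m, and the norm of the second factor
  vanishes to order 6 minus the degree of \<open>norm_y m\<close>.\<close>

lemma ord_infinity_y:
  assumes "d * \<gamma>^2 = coeff f 6" and m: "degree m \<le> 3"
  shows "ord_at d f (At_Infinity \<gamma>) (- Fract m 1, 1) =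
    (if \<gamma> = coeff m 3 then 6 - int (degree (norm_y m)) else 0) - 3"
proof -
  let ?x3 = "([:0, 1:] :: 'a poly) ^ 3"
  have x3: "?x3 = monom 1 3" by (simp add: monom_altdef)
  interpret smooth_point nu_infinity d f "Fract 1 [:0, 1:]" "Fract 1 ?x3" \<gamma>
    by (rule smooth_infinity[OF assms(1)])
  have P: "At_Infinity \<gamma> \<in> curve_points d f" using assms by (simp add: curve_points_def)
  interpret ff_val d f "ord_at d f (At_Infinity \<gamma>)" by unfold_locales (rule ord_at(1)[OF P])
  have eq: "- Fract m ?x3 - fract_const (- coeff m 3) = Fract (monom (coeff m 3) 3 - m) (monom 1 3)"
  proof -
    have "- Fract m ?x3 - fract_const (- coeff m 3) =
        Fract (- m - monom (- coeff m 3) 3) (monom 1 3)"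
      unfolding x3 by (simp add: fract_const_def smult_monom)
    also have "- m - monom (- coeff m 3) 3 = monom (coeff m 3) 3 - m"
      by (rule poly_eqI) simp
    finally show ?thesis .
  qed
  have "nu_infinity.ge 1 (- Fract m ?x3 - fract_const (- coeff m 3))"
  proof (cases "monom (coeff m 3) 3 - m = 0")
    case True
    thus ?thesis unfolding eq by (simp add: fract_collapse)
  next
    case False
    have "degree (monom (coeff m 3) 3 - m) \<le> 3"
      using m degree_monom_le[of "coeff m 3" 3] by (intro degree_diff_le) simp_all
    moreover have "coeff (monom (coeff m 3) 3 - m) 3 = 0" by simp
    ultimately have "degree (monom (coeff m 3) 3 - m) < 3"
      using False eq_zero_or_degree_less by blast
    thus ?thesis unfolding eq nu_infinity.ge_def using False
      by (simp add: nu_infinity_Fract degree_monom_eq)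
  qed
  hence *: "ord_at d f (At_Infinity \<gamma>) (- Fract m ?x3, Fract 1 ?x3) =
    (if - coeff m 3 + \<gamma> = 0 then nu_infinity ((- Fract m ?x3)^2 - D) else 0)"
    using ord_at[OF P] centred_infinity[OF assms(1)] by (intro value_chart) simp_all
  have "(- Fract m ?x3)^2 - D = Fract (norm_y m) (smult d (?x3^2))"
    using norm_y_eq[of ?x3 m] by (simp add: power2_eq_square)
  moreover have "?x3^2 = monom 1 6" by (simp add: x3 power2_eq_square mult_monom)
  ultimately have N: "nu_infinity ((- Fract m ?x3)^2 - D) = 6 - int (degree (norm_y m))"
    using norm_y_neq_0 d by (simp add: nu_infinity_Fract smult_monom degree_monom_eq)
  have "Fract ?x3 1 * Fract 1 ?x3 = 1" "Fract ?x3 1 * (- Fract m ?x3) = - Fract m 1"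
    by (simp_all add: One_fract_def eq_fract)
  moreover have "ord_at d f (At_Infinity \<gamma>) (Fract ?x3 1, 0) = - 3"
    using ord_infinity_base[OF assms(1), of "Fract ?x3 1"]
    by (simp add: x3 degree_monom_eq nu_infinity_Fract base_neq_0)
  moreover have "Fract ?x3 1 \<noteq> 0" by (simp add: base_neq_0)
  ultimately have "ord_at d f (At_Infinity \<gamma>) (- Fract m 1, 1) =
      - 3 + ord_at d f (At_Infinity \<gamma>) (- Fract m ?x3, Fract 1 ?x3)"
    using v_base_mult[of "Fract ?x3 1" "- Fract m ?x3" "Fract 1 ?x3"] c by (simp add: ff_zero_iff)
  moreover have "- coeff m 3 + \<gamma> = 0 \<longleftrightarrow> \<gamma> = coeff m 3" by (auto simp: add_eq_0_iff)
  ultimately show ?thesis using * N by simp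
qed

end

section \<open>Divisors\<close>

subsection \<open>Principal divisors\<close>

text \<open>Pulls a valuation back along an automorphism \<Phi> of the function field that moves the
  constants by \<tau>. It is applied to the hyperelliptic involution, where \<tau> is the identity,
  and to the Galois action.\<close>

lemma valuation_transport:
  assumes v: "ff_valuation d f v"
    and mult: "\<And>g h. \<Phi> (ff_mult d f g h) = ff_mult d f (\<Phi> g) (\<Phi> h)"
    and add: "\<And>g h. \<Phi> (ff_add g h) = ff_add (\<Phi> g) (\<Phi> h)"
    and const: "\<And>a. \<Phi> (ff_const a) = ff_const (\<tau> a)" and \<tau>: "\<And>a. a \<noteq> 0 \<Longrightarrow> \<tau> a \<noteq> 0"
    and zero: "\<And>g. \<Phi> g = ff_zero \<longleftrightarrow> g = ff_zero" and surj: "surj \<Phi>"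
  shows "ff_valuation d f (v \<circ> \<Phi>)"
proof -
  interpret ff_val d f v by unfold_locales (rule v)
  show ?thesis
    unfolding ff_valuation_def comp_def
  proof (intro conjI allI impI)
    fix g h :: "'a function_field" assume "g \<noteq> ff_zero" "h \<noteq> ff_zero"
    hence gh: "\<Phi> g \<noteq> ff_zero" "\<Phi> h \<noteq> ff_zero" using zero by blast+
    show "v (\<Phi> (ff_mult d f g h)) = v (\<Phi> g) + v (\<Phi> h)"
      unfolding mult using gh by (rule v_mult)
    assume "ff_add g h \<noteq> ff_zero"
    hence "\<Phi> (ff_add g h) \<noteq> ff_zero" using zero by blast
    thus "min (v (\<Phi> g)) (v (\<Phi> h)) \<le> v (\<Phi> (ff_add g h))"
      unfolding add using gh by (intro v_add)
  next
    fix a :: 'a assume "a \<noteq> 0"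
    thus "v (\<Phi> (ff_const a)) = 0"
      using v_const[OF \<tau>] by (simp add: const) (simp add: ff_const_def ff_of_base_def fract_const_def)
  next
    obtain g where g: "g \<noteq> ff_zero" "v g = 1" using v_one by blast
    obtain h where h: "g = \<Phi> h" using surj by (meson surjD)
    have "h \<noteq> ff_zero" using g(1) zero h by blast
    thus "\<exists>g. g \<noteq> ff_zero \<and> v (\<Phi> g) = 1" using g(2) h by blast
  next
    have "\<Phi> ff_zero = ff_zero" using zero by blast
    thus "v (\<Phi> ff_zero) = 0" using v_zero by simp
  qed
qed

context sextic_curve
begin

abbreviation C where "C \<equiv> curve_points d f"
abbreviation principal where "principal \<equiv> principal_divisors d f"

lemma Affine_in_C [simp]: "Affine \<alpha> \<beta> \<in> C \<longleftrightarrow> d * \<beta>^2 = poly f \<alpha>"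
  and At_Infinity_in_C [simp]: "At_Infinity \<gamma> \<in> C \<longleftrightarrow> d * \<gamma>^2 = coeff f 6"
  by (simp_all add: curve_points_def)

lemma principal_iff: "E \<in> principal \<longleftrightarrow> Poly_Mapping.keys E \<subseteq> C \<and>
    (\<exists>g. g \<noteq> ff_zero \<and> (\<forall>P\<in>C. Poly_Mapping.lookup E P = ord_at d f P g))"
  by (simp add: principal_divisors_def divisor_group_def)

lemma principal_zero: "0 \<in> principal"
proof -
  have "ord_at d f P (ff_const 1) = 0" if "P \<in> C" for P
    using ord_at(1)[OF that] unfolding ff_valuation_def by simp
  moreover have "ff_const 1 \<noteq> (ff_zero :: 'a function_field)"
    by (simp add: ff_const_def ff_of_base_def ff_zero_iff base_neq_0)
  ultimately show ?thesis unfolding principal_iff by fastforce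
qed

lemma norm_neq_0: "(a, b) \<noteq> ff_zero \<Longrightarrow> a^2 - b^2 * Fract f [:d:] \<noteq> 0"
proof
  assume *: "(a, b) \<noteq> ff_zero" "a^2 - b^2 * Fract f [:d:] = 0"
  hence "b \<noteq> 0" by (auto simp: ff_zero_iff)
  hence "Fract f [:d:] = (a / b)^2" using * by (simp add: field_simps)
  thus False using y_square by blast
qed

lemma ff_mult_neq_zero:
  assumes "g \<noteq> ff_zero" "h \<noteq> ff_zero"
  shows "ff_mult d f g h \<noteq> ff_zero"
proof
  obtain a b a' b' where gh: "g = (a, b)" "h = (a', b')" by (cases g; cases h)
  assume "ff_mult d f g h = ff_zero"
  hence 0: "a * a' + Fract f [:d:] * (b * b') = 0" "a * b' + b * a' = 0"
    by (simp_all add: gh ff_mult_def ff_zero_def)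
  have "(a^2 - b^2 * Fract f [:d:]) * (a'^2 - b'^2 * Fract f [:d:]) =
    (a * a' + Fract f [:d:] * (b * b'))^2 - (a * b' + b * a')^2 * Fract f [:d:]"
    by Groebner_Basis.algebra
  with 0 norm_neq_0[of a b] norm_neq_0[of a' b'] assms show False by (simp add: gh)
qed

lemma ff_inverse:
  assumes "g \<noteq> ff_zero"
  obtains h where "h \<noteq> ff_zero" "ff_mult d f g h = ff_const 1"
proof -
  obtain a b where g: "g = (a, b)" by (cases g)
  define N where "N = a^2 - b^2 * Fract f [:d:]"
  have N: "N \<noteq> 0" using norm_neq_0[of a b] assms by (simp add: g N_def)
  have "a * (a / N) + Fract f [:d:] * (b * (- b / N)) = (a^2 - b^2 * Fract f [:d:]) / N"
    by (simp add: diff_divide_distrib power2_eq_square mult.commute mult.left_commute)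
  hence *: "ff_mult d f g (a / N, - b / N) = ff_const 1"
    using N unfolding N_def[symmetric]
    by (simp add: g ff_mult_def ff_const_def ff_of_base_def One_fract_def pCons_one)
  moreover have "(a / N, - b / N) \<noteq> ff_zero"
    using N assms by (simp add: g ff_zero_iff)
  ultimately show ?thesis using that by blast
qed

lemma principal_add:
  assumes "E \<in> principal" "F \<in> principal"
  shows "E + F \<in> principal"
proof -
  obtain g h where g: "g \<noteq> ff_zero" "\<forall>P\<in>C. Poly_Mapping.lookup E P = ord_at d f P g"
    and h: "h \<noteq> ff_zero" "\<forall>P\<in>C. Poly_Mapping.lookup F P = ord_at d f P h"
    using assms unfolding principal_iff by blast
  have "Poly_Mapping.lookup (E + F) P = ord_at d f P (ff_mult d f g h)" if "P \<in> C" for P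
    using g h that ff_val.v_mult[OF ff_val.intro[OF ord_at(1)[OF that]]] by (simp add: lookup_add)
  moreover have "Poly_Mapping.keys (E + F) \<subseteq> C"
    using assms Poly_Mapping.keys_add[of E F] unfolding principal_iff by blast
  ultimately show ?thesis
    using ff_mult_neq_zero[OF g(1) h(1)] unfolding principal_iff by blast
qed

lemma principal_uminus:
  assumes "E \<in> principal"
  shows "- E \<in> principal"
proof -
  obtain g where g: "g \<noteq> ff_zero" "\<forall>P\<in>C. Poly_Mapping.lookup E P = ord_at d f P g"
    using assms unfolding principal_iff by blast
  obtain h where h: "h \<noteq> ff_zero" "ff_mult d f g h = ff_const 1" by (rule ff_inverse[OF g(1)])
  have "Poly_Mapping.lookup (- E) P = ord_at d f P h" if P: "P \<in> C" for P
  proof -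
    have "ord_at d f P (ff_const 1) = 0"
      using ord_at(1)[OF P] unfolding ff_valuation_def by simp
    hence "ord_at d f P g + ord_at d f P h = 0"
      using ff_val.v_mult[OF ff_val.intro[OF ord_at(1)[OF P]] g(1) h(1)] h(2) by simp
    thus ?thesis using g(2) P by simp
  qed
  moreover have "Poly_Mapping.keys (- E) \<subseteq> C" using assms by (simp add: principal_iff)
  ultimately show ?thesis using h(1) unfolding principal_iff by blast
qed

lemma principal_diff: "E \<in> principal \<Longrightarrow> F \<in> principal \<Longrightarrow> E - F \<in> principal"
  using principal_add[of E "- F"] principal_uminus[of F] by simp

lemma principal_cmul:
  assumes "E \<in> principal"
  shows "frag_cmul k E \<in> principal"
proof -
  have nat: "frag_cmul (int n) E \<in> principal" for n
    by (induction n) (simp_all add: principal_zero frag_cmul_distrib principal_add assms)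
  show ?thesis
  proof (cases "k \<ge> 0")
    case True
    thus ?thesis using nat[of "nat k"] by simp
  next
    case False
    thus ?thesis using principal_uminus[OF nat[of "nat (- k)"]] by simp
  qed
qed

section \<open>The divisor at infinity and the divisors of y - m and x - \<alpha>\<close>

definition gam :: 'a where
  "gam = (SOME g. d * g^2 = coeff f 6)"

lemma coeff_f: "coeff f 6 \<noteq> 0"
  using degree_f f_neq_0 leading_coeff_0_iff[of f] by simp

lemma sqrt_exists: "\<exists>b. d * b^2 = a"
proof -
  obtain b where "b^2 = a / d" using nth_root_exists[of 2 "a / d"] by auto
  thus ?thesis using d by (intro exI[of _ b]) simp
qed

lemma gam: "d * gam^2 = coeff f 6"
  unfolding gam_def by (rule someI_ex) (rule sqrt_exists)

lemma gam_neq: "gam \<noteq> - gam" "gam \<noteq> 0"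
proof -
  show "gam \<noteq> 0" using gam coeff_f by auto
  thus "gam \<noteq> - gam" using two by (metis add.right_inverse mult_2 mult_eq_0_iff)
qed

lemma infinite_points: "d * \<gamma>^2 = coeff f 6 \<longleftrightarrow> \<gamma> = gam \<or> \<gamma> = - gam"
proof
  assume "d * \<gamma>^2 = coeff f 6"
  hence "\<gamma>^2 = gam^2" using gam d by (metis mult_left_cancel)
  thus "\<gamma> = gam \<or> \<gamma> = - gam" by (simp add: power2_eq_iff)
qed (use gam in auto)

text \<open>The polar divisor of x. A point and its hyperelliptic conjugate add up to a divisor
  equivalent to it, and subtracting it brings divisors of degree 2 to degree 0.\<close>

definition H :: "'a curve_point \<Rightarrow>\<^sub>0 int" where
  "H = frag_of (At_Infinity gam) + frag_of (At_Infinity (- gam))"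

lemma keys_H: "Poly_Mapping.keys H \<subseteq> C"
  using Poly_Mapping.keys_add[of "frag_of (At_Infinity gam)" "frag_of (At_Infinity (- gam))"] gam
  by (auto simp: H_def keys_frag_of)

lemma lookup_H:
  "Poly_Mapping.lookup H (Affine \<alpha> \<beta>) = 0"
  "d * \<gamma>^2 = coeff f 6 \<Longrightarrow> Poly_Mapping.lookup H (At_Infinity \<gamma>) = 1"
  using gam_neq by (auto simp: H_def lookup_add infinite_points)

lemma keys_sum_frag: "Poly_Mapping.keys (\<Sum>\<alpha>\<in>#M. frag_of (F \<alpha>)) \<subseteq> F ` set_mset M"
proof (induction M)
  case (add x M)
  thus ?case using Poly_Mapping.keys_add[of "frag_of (F x)" "\<Sum>\<alpha>\<in>#M. frag_of (F \<alpha>)"]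
    by (auto simp: keys_frag_of)
qed simp

lemma lookup_sum_frag:
  "Poly_Mapping.lookup (\<Sum>\<alpha>\<in>#M. frag_of (Affine \<alpha> (F \<alpha>))) (Affine \<alpha> \<beta>) =
     (if \<beta> = F \<alpha> then int (count M \<alpha>) else 0)"
  "Poly_Mapping.lookup (\<Sum>\<alpha>\<in>#M. frag_of (Affine \<alpha> (F \<alpha>))) (At_Infinity \<gamma>) = 0"
  by (induction M) (auto simp: lookup_add)

text \<open>
  The intersection of the curve \<open>y = m(x)\<close> with the zeros of \<open>a\<close>, a polynomial of formal
  degree \<open>k\<close>: a drop of the degree means zeros at infinity.
\<close>

definition graph_divisor :: "nat \<Rightarrow> 'a poly \<Rightarrow> 'a poly \<Rightarrow> ('a curve_point \<Rightarrow>\<^sub>0 int)" where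
  "graph_divisor k a m = (\<Sum>\<alpha>\<in>#proots a. frag_of (Affine \<alpha> (poly m \<alpha>))) +
     frag_cmul (int k - int (degree a)) (frag_of (At_Infinity (coeff m 3)))"

lemma graph_divisor_mult:
  assumes "a \<noteq> 0" "b \<noteq> 0"
  shows "graph_divisor (k + l) (a * b) m = graph_divisor k a m + graph_divisor l b m"
  using assms 
  by (simp add: graph_divisor_def proots_mult degree_mult_eq algebra_simps flip: frag_cmul_distrib)

lemma graph_divisor_smult: "c \<noteq> 0 \<Longrightarrow> graph_divisor k (smult c a) m = graph_divisor k a m"
  by (simp add: graph_divisor_def)

lemma graph_divisor_cong:
  assumes "\<And>\<alpha>. poly a \<alpha> = 0 \<Longrightarrow> poly m \<alpha> = poly m' \<alpha>"
    and "k = degree a \<or> coeff m 3 = coeff m' 3" and "a \<noteq> 0"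
  shows "graph_divisor k a m = graph_divisor k a m'"
proof -
  have "(\<Sum>\<alpha>\<in>#proots a. frag_of (Affine \<alpha> (poly m \<alpha>))) =
      (\<Sum>\<alpha>\<in>#proots a. frag_of (Affine \<alpha> (poly m' \<alpha>)))"
    using assms by (intro arg_cong[where f = sum_mset] image_mset_cong) simp
  thus ?thesis using assms(2) by (auto simp: graph_divisor_def)
qed

lemma keys_graph_divisor:
  assumes "\<And>\<alpha>. poly a \<alpha> = 0 \<Longrightarrow> poly (norm_y m) \<alpha> = 0"
    and "k = degree a \<or> coeff (norm_y m) 6 = 0" and "a \<noteq> 0" and "degree m \<le> 3"
  shows "Poly_Mapping.keys (graph_divisor k a m) \<subseteq> C"
proof -
  let ?S = "\<Sum>\<alpha>\<in>#proots a. frag_of (Affine \<alpha> (poly m \<alpha>))"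
  let ?I = "frag_cmul (int k - int (degree a)) (frag_of (At_Infinity (coeff m 3)))"
  have "Poly_Mapping.keys ?S \<subseteq> C"
    using keys_sum_frag[of "\<lambda>\<alpha>. Affine \<alpha> (poly m \<alpha>)" "proots a"] assms(1,3)
    by (fastforce simp: norm_y_def)
  moreover have "Poly_Mapping.keys ?I \<subseteq> C"
  proof (cases "k = degree a")
    case False
    have "coeff (m^2) 6 = (coeff m 3)^2"
    proof -
      have "coeff m i = 0" if "i > 3" for i using assms(4) that by (intro coeff_eq_0) simp
      hence "coeff m 4 = 0" "coeff m 5 = 0" "coeff m 6 = 0" by simp_all
      moreover have "{..6::nat} = {0, 1, 2, 3, 4, 5, 6}" by auto
      ultimately show ?thesis by (simp add: power2_eq_square coeff_mult)
    qed
    hence "d * (coeff m 3)^2 = coeff f 6"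
      using False assms(2) by (simp add: norm_y_def)
    thus ?thesis using keys_cmul[of _ "frag_of (At_Infinity (coeff m 3))"]
      by (auto simp: keys_frag_of)
  qed simp
  ultimately show ?thesis
    using Poly_Mapping.keys_add[of ?S ?I] unfolding graph_divisor_def by blast
qed

lemma degree_norm_y: "degree m \<le> 3 \<Longrightarrow> degree (norm_y m) \<le> 6"
  unfolding norm_y_def using degree_f degree_power_le[of m 2]
  by (intro degree_diff_le) (auto intro: order_trans[OF degree_smult_le])

text \<open>This is the divisor of y - m. Its affine zeros are counted by the norm; at the point at
  infinity where y/x^3 equals the coefficient of x^3 in m, the drop of the degree of the norm
  offsets the triple pole.\<close>

lemma principal_graph:
  assumes "degree m \<le> 3"
  shows "graph_divisor 6 (norm_y m) m - frag_cmul 3 H \<in> principal"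
  unfolding principal_iff
proof
  have "6 = degree (norm_y m) \<or> coeff (norm_y m) 6 = 0"
    using degree_norm_y[OF assms] by (metis coeff_eq_0 le_neq_implies_less)
  hence "Poly_Mapping.keys (graph_divisor 6 (norm_y m) m) \<subseteq> C"
    by (intro keys_graph_divisor norm_y_neq_0 assms)
  moreover have "Poly_Mapping.keys (frag_cmul 3 H) \<subseteq> C"
    using keys_H keys_cmul[of 3 H] by blast
  ultimately show "Poly_Mapping.keys (graph_divisor 6 (norm_y m) m - frag_cmul 3 H) \<subseteq> C"
    using keys_diff[of "graph_divisor 6 (norm_y m) m" "frag_cmul 3 H"] by blast
  have "Poly_Mapping.lookup (graph_divisor 6 (norm_y m) m - frag_cmul 3 H) P =
    ord_at d f P (- Fract m 1, 1)" if "P \<in> C" for P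
    using that
  proof (cases rule: curve_points_cases)
    case (affine \<alpha> \<beta>)
    thus ?thesis using norm_y_neq_0
      by (simp add: graph_divisor_def lookup_minus lookup_add lookup_sum_frag lookup_H
          ord_affine_y[OF affine(2)] del: minus_fract)
  next
    case (infinity \<gamma>)
    thus ?thesis
      by (simp add: graph_divisor_def lookup_minus lookup_add lookup_sum_frag lookup_H
          ord_infinity_y[OF infinity(2) assms] del: minus_fract)
  qed
  moreover have "(- Fract m 1, 1) \<noteq> ff_zero" by (simp add: ff_zero_iff)
  ultimately show "\<exists>g. g \<noteq> ff_zero \<and>
      (\<forall>P\<in>C. Poly_Mapping.lookup (graph_divisor 6 (norm_y m) m - frag_cmul 3 H) P = ord_at d f P g)"
    by blast
qed

text \<open>This is the divisor of x - \<alpha>; for \<beta> = 0 the two points coincide and x -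
  \<alpha> vanishes doubly there.\<close>

lemma principal_vertical:
  assumes P: "d * \<beta>^2 = poly f \<alpha>"
  shows "frag_of (Affine \<alpha> \<beta>) + frag_of (Affine \<alpha> (- \<beta>)) - H \<in> principal" (is "?E \<in> _")
  unfolding principal_iff
proof
  have "Poly_Mapping.keys (frag_of (Affine \<alpha> \<beta>) + frag_of (Affine \<alpha> (- \<beta>))) \<subseteq> C"
    using Poly_Mapping.keys_add[of "frag_of (Affine \<alpha> \<beta>)" "frag_of (Affine \<alpha> (- \<beta>))"] P
    by (auto simp: keys_frag_of)
  thus "Poly_Mapping.keys ?E \<subseteq> C"
    using keys_diff[of "frag_of (Affine \<alpha> \<beta>) + frag_of (Affine \<alpha> (- \<beta>))" H] keys_H by blast
  have "Poly_Mapping.lookup ?E Q = ord_at d f Q (Fract [:- \<alpha>, 1:] 1, 0)" if "Q \<in> C" for Q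
    using that
  proof (cases rule: curve_points_cases)
    case (affine a b)
    have order: "order a [:- \<alpha>, 1:] = (if a = \<alpha> then 1 else 0)"
      using order_power_n_n[of \<alpha> 1] by (auto intro: order_0I)
    have "b = \<beta> \<or> b = - \<beta>" if "a = \<alpha>"
    proof -
      have "b^2 = \<beta>^2" using affine(2) P that d by (metis mult_left_cancel)
      thus ?thesis by (simp add: power2_eq_iff)
    qed
    moreover have "\<beta> = 0" if "\<beta> = - \<beta>"
      using that two by (metis add.right_inverse mult_2 mult_eq_0_iff)
    ultimately show ?thesis
      by (auto simp: affine(1) lookup_minus lookup_add lookup_H ord_affine_base[OF affine(2)]
          base_neq_0 nu_at_Fract order)
  next
    case (infinity \<gamma>)
    thus ?thesis
      by (simp add: lookup_minus lookup_add lookup_H ord_infinity_base[OF infinity(2)]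
          base_neq_0 nu_infinity_Fract)
  qed
  moreover have "(Fract [:- \<alpha>, 1:] 1, 0) \<noteq> ff_zero" by (simp add: ff_zero_iff base_neq_0)
  ultimately show "\<exists>g. g \<noteq> ff_zero \<and> (\<forall>P\<in>C. Poly_Mapping.lookup ?E P = ord_at d f P g)"
    by blast
qed

end

subsection \<open>Non-principal divisors\<close>

lemma proots_prod_linear: "proots (\<Prod>x\<in>#A. [:- x, 1::'a::idom:]) = A"
proof (induction A)
  case (add x A)
  have "(\<Prod>x\<in>#A. [:- x, 1::'a:]) \<noteq> 0" by (auto simp: prod_mset_zero_iff)
  thus ?case using add by (simp add: proots_mult del: mult_pCons_left)
qed simp

lemma size_proots_eq_degree:
  fixes p :: "'a::alg_closed_field poly"
  assumes "p \<noteq> 0"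
  shows "size (proots p) = degree p"
proof -
  obtain A where A: "size A = degree p" "p = smult (lead_coeff p) (\<Prod>x\<in>#A. [:- x, 1:])"
    using alg_closed_imp_factorization[OF assms] by blast
  have "proots p = proots (\<Prod>x\<in>#A. [:- x, 1:])"
    using A(2) assms by (metis leading_coeff_0_iff proots_smult)
  thus ?thesis using A(1) by (simp add: proots_prod_linear)
qed

text \<open>A rational function without finite poles is a polynomial; counting roots over an
  algebraically closed field compares the degrees of numerator and denominator.\<close>

lemma nu_infinity_le_0:
  fixes x :: "'a::alg_closed_field poly fract"
  assumes "x \<noteq> 0" and "\<And>a. nu_at a x \<ge> 0"
  shows "nu_infinity x \<le> 0"
proof -
  obtain p q where x: "x = Fract p q" "q \<noteq> 0" by (cases x) auto
  have p: "p \<noteq> 0" using assms(1) x by (auto simp: fract_collapse)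
  have "order a q \<le> order a p" for a
    using assms(2)[of a] p x by (simp add: nu_at_Fract)
  hence "proots q \<subseteq># proots p"
    using p x by (simp add: subseteq_mset_def)
  hence "size (proots q) \<le> size (proots p)" by (rule size_mset_mono)
  moreover have "size (proots q) = degree q" by (rule size_proots_eq_degree[OF x(2)])
  ultimately have "degree q \<le> degree p" using size_proots_le[of p] by linarith
  thus ?thesis using x p by (simp add: nu_infinity_Fract)
qed

primrec iota :: "'a::uminus curve_point \<Rightarrow> 'a curve_point" where
  "iota (Affine a b) = Affine a (- b)"
| "iota (At_Infinity c) = At_Infinity (- c)"

context sextic_curve
begin

lemma iota_in_C: "P \<in> C \<Longrightarrow> iota P \<in> C"
  by (cases P) simp_all

lemma ord_iota:
  assumes P: "P \<in> C"
  shows "ord_at d f (iota P) (a, b) = ord_at d f P (a, - b)"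
proof -
  define \<Phi> where "\<Phi> g = (fst g, - snd g)" for g :: "'a function_field"
  interpret ff_val d f "ord_at d f P" by unfold_locales (rule ord_at(1)[OF P])
  have val: "ff_valuation d f (ord_at d f P \<circ> \<Phi>)"
  proof (rule valuation_transport[OF ord_at(1)[OF P], where \<tau> = id])
    show "surj \<Phi>" by (rule surjI[of _ \<Phi>]) (simp add: \<Phi>_def)
  qed (auto simp: \<Phi>_def ff_mult_def ff_add_def ff_const_def ff_of_base_def ff_zero_def prod_eq_iff)
  have minus: "ord_at d f P (a, - b) = ord_at d f P (- a, b)" for a b
    using v_minus[of a "-b"] by simp
  have "centred_at (ord_at d f P \<circ> \<Phi>) (iota P)"
  proof (cases P)
    case (Affine \<alpha> \<beta>)
    thus ?thesis using ord_at(2)[OF P] minus[of "fract_const \<beta>" 1]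
      by (simp add: \<Phi>_def ff_diff_def ff_const_def ff_of_base_def ff_x_def ff_y_def
          fract_const_uminus flip: fract_const_def)
  next
    case (At_Infinity \<gamma>)
    thus ?thesis using ord_at(2)[OF P] minus[of "fract_const \<gamma>" "Fract 1 ([:0, 1:] ^ 3)"]
      by (simp add: \<Phi>_def ff_diff_def ff_const_def ff_of_base_def
          fract_const_uminus flip: fract_const_def)
  qed
  from ord_at_eqI[OF iota_in_C[OF P] val this] show ?thesis by (simp add: \<Phi>_def)
qed

text \<open>Comparison with the conjugate function isolates b y, and the square b^2 f/d is a
  rational function with bounded poles. At a finite point f has order at most 1, so b has no pole
  there. At infinity f has order - 6 while the square has order at least - 2, so b would vanish,
  which a nonzero polynomial cannot do.\<close>

lemma regular_imp_rational:
  assumes g: "(a, b) \<noteq> ff_zero"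
    and affine: "\<And>\<alpha> \<beta>. d * \<beta>^2 = poly f \<alpha> \<Longrightarrow> ord_at d f (Affine \<alpha> \<beta>) (a, b) \<ge> 0"
    and infinity: "\<And>\<gamma>. d * \<gamma>^2 = coeff f 6 \<Longrightarrow> ord_at d f (At_Infinity \<gamma>) (a, b) \<ge> - 1"
  shows "b = 0"
proof (rule ccontr)
  assume b: "b \<noteq> 0"
  have F: "Fract f [:d:] \<noteq> 0" using f_neq_0 d by (simp add: Zero_fract_def eq_fract)
  have y: "ord_at d f P (b^2 * Fract f [:d:], 0) \<ge> 2 * n"
    if P: "P \<in> C" and n: "ord_at d f P (a, b) \<ge> n" "ord_at d f (iota P) (a, b) \<ge> n" for P n
  proof -
    interpret ff_val d f "ord_at d f P" by unfold_locales (rule ord_at(1)[OF P])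
    have "ord_at d f P (- a, b) \<ge> n"
      using n(2) ord_iota[OF P] v_minus[of a "-b"] by simp
    moreover have "ff_add (a, b) (- a, b) = (fract_const 2 * 0, fract_const 2 * b)"
    proof -
      have "fract_const (2::'a) = 2" using fract_const_add[of "1::'a" 1] by simp
      thus ?thesis by (simp add: ff_add_def)
    qed
    moreover have "(fract_const 2 * 0, fract_const 2 * b) \<noteq> ff_zero" "(- a, b) \<noteq> ff_zero"
      using b two by (simp_all add: ff_zero_iff fract_const_eq_0_iff)
    ultimately have "ord_at d f P (fract_const 2 * 0, fract_const 2 * b) \<ge> n"
      using v_add[OF g, of "(- a, b)"] n(1) by simp
    hence "ord_at d f P (0, b) \<ge> n"
      using v_base_mult[of "fract_const 2" 0 b] v_const[OF two] b two
      by (simp add: ff_zero_iff fract_const_eq_0_iff)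
    moreover have "ff_mult d f (0, b) (0, b) = (b^2 * Fract f [:d:], 0)"
      by (simp add: ff_mult_def power2_eq_square mult.commute)
    ultimately show ?thesis using v_mult[of "(0, b)" "(0, b)"] b by (simp add: ff_zero_iff)
  qed
  have "nu_at \<alpha> b \<ge> 0" for \<alpha>
  proof -
    obtain \<beta> where \<beta>: "d * \<beta>^2 = poly f \<alpha>" using sqrt_exists by blast
    have "ord_at d f (Affine \<alpha> \<beta>) (b^2 * Fract f [:d:], 0) \<ge> 2 * 0"
      using \<beta> by (intro y) (simp_all add: affine)
    hence "nu_at \<alpha> (b^2 * Fract f [:d:]) \<ge> 0"
      using b F ord_affine_base[OF \<beta>, of "b^2 * Fract f [:d:]"]
      by (auto simp: zero_le_mult_iff split: if_splits)
    moreover have "nu_at \<alpha> (b^2 * Fract f [:d:]) = nu_at \<alpha> (b^2) + nu_at \<alpha> (Fract f [:d:])"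
      using b F by (intro nu_at.nu_mult) simp_all
    moreover have "nu_at \<alpha> (b^2) = 2 * nu_at \<alpha> b" using b by (simp add: nu_at.nu_power)
    moreover have "nu_at \<alpha> (Fract f [:d:]) \<le> 1"
      using simple_roots[of \<alpha>] f_neq_0 d by (cases "poly f \<alpha> = 0") (simp_all add: nu_at_Fract order_0I)
    ultimately show ?thesis by linarith
  qed
  from nu_infinity_le_0[OF b this] have "nu_infinity b \<le> 0" .
  moreover have "nu_infinity (b^2 * Fract f [:d:]) = nu_infinity (b^2) + nu_infinity (Fract f [:d:])"
    using b F by (intro nu_infinity.nu_mult) simp_all
  moreover have "nu_infinity (b^2) = 2 * nu_infinity b" using b by (simp add: nu_infinity.nu_power)
  moreover have "nu_infinity (Fract f [:d:]) = - 6"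
    using f_neq_0 d degree_f by (simp add: nu_infinity_Fract)
  moreover have "ord_at d f (At_Infinity gam) (b^2 * Fract f [:d:], 0) \<ge> 2 * (- 1)"
    using gam by (intro y) (simp_all add: infinity)
  hence "nu_infinity (b^2 * Fract f [:d:]) \<ge> - 2"
    using b F ord_infinity_base[OF gam, of "b^2 * Fract f [:d:]"] by simp
  ultimately show False by linarith
qed

lemma ord_base_even:
  assumes "P \<in> C" "iota P = P" "x \<noteq> 0"
  shows "even (ord_at d f P (x, 0))"
  using assms(1)
proof (cases rule: curve_points_cases)
  case (affine \<alpha> \<beta>)
  hence "\<beta> = - \<beta>" using assms(2) by simp
  hence "\<beta> = 0" using two by (metis add.right_inverse mult_2 mult_eq_0_iff)
  thus ?thesis using ord_affine_base[OF affine(2) assms(3)] affine(1) by simp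
next
  case (infinity \<gamma>)
  hence "\<gamma> = - \<gamma>" using assms(2) by simp
  thus ?thesis using infinity(2) infinite_points gam_neq by auto
qed

text \<open>
  A function with at most simple poles, all of them at infinity, is a polynomial in \<open>x\<close>,
  so its divisor is invariant under the hyperelliptic involution.
\<close>

lemma pair_not_principal:
  assumes P: "P \<in> C" and Q: "Q \<in> C" and pr: "frag_of P + frag_of Q - H \<in> principal"
  shows "Q = iota P"
proof (rule ccontr)
  assume ne: "Q \<noteq> iota P"
  obtain g where g: "g \<noteq> ff_zero"
    "\<And>R. R \<in> C \<Longrightarrow> Poly_Mapping.lookup (frag_of P + frag_of Q - H) R = ord_at d f R g"
    using pr unfolding principal_iff by blast
  obtain a b where ab: "g = (a, b)" by (cases g)
  have "b = 0"
  proof (rule regular_imp_rational)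
    show "(a, b) \<noteq> ff_zero" using g(1) ab by simp
  next
    fix \<alpha> \<beta> assume "d * \<beta>^2 = poly f \<alpha>"
    hence "Affine \<alpha> \<beta> \<in> C" by simp
    from g(2)[OF this] show "ord_at d f (Affine \<alpha> \<beta>) (a, b) \<ge> 0"
      by (simp add: ab lookup_minus lookup_add lookup_H split: if_splits)
  next
    fix \<gamma> assume \<gamma>: "d * \<gamma>^2 = coeff f 6"
    hence "At_Infinity \<gamma> \<in> C" by simp
    from g(2)[OF this] show "ord_at d f (At_Infinity \<gamma>) (a, b) \<ge> - 1"
      by (simp add: ab lookup_minus lookup_add lookup_H(2)[OF \<gamma>] split: if_splits)
  qed
  hence a: "g = (a, 0)" "a \<noteq> 0" using g(1) ab by (auto simp: ff_zero_iff)
  have H: "Poly_Mapping.lookup H (iota R) = Poly_Mapping.lookup H R" if "R \<in> C" for R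
    using that by (cases R) (simp_all add: lookup_H)
  have sym: "Poly_Mapping.lookup (frag_of P + frag_of Q) (iota R) =
      Poly_Mapping.lookup (frag_of P + frag_of Q) R" if R: "R \<in> C" for R
    using g(2)[OF R] g(2)[OF iota_in_C[OF R]] ord_iota[OF R, of a 0] H[OF R]
    by (simp add: a lookup_minus)
  \<comment> \<open>P and its conjugate have the same multiplicity in P + Q; as Q is not the
    conjugate of P, P must be its own conjugate.\<close>
  have PP: "iota P = P"
    using sym[OF P] ne by (auto simp: lookup_add split: if_splits)
  hence "P \<noteq> Q" using ne by auto
  \<comment> \<open>A function of x has even order at a branch point, whereas P has multiplicity 1
    in P + Q - H.\<close>
  have "even (ord_at d f P g)" unfolding a(1) by (rule ord_base_even) (use P PP a in auto)
  moreover have "Poly_Mapping.lookup H P = 0"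
    using P PP gam_neq by (cases P) (auto simp: lookup_H infinite_points)
  ultimately show False using g(2)[OF P] \<open>P \<noteq> Q\<close> by (simp add: lookup_minus lookup_add)
qed

end

section \<open>The Galois action\<close>

subsection \<open>Field automorphisms\<close>

locale field_embedding =
  fixes \<sigma> :: "'a::field \<Rightarrow> 'b::field"
  assumes hom_add: "\<sigma> (a + b) = \<sigma> a + \<sigma> b"
    and hom_mult: "\<sigma> (a * b) = \<sigma> a * \<sigma> b"
    and hom_1: "\<sigma> 1 = 1"
begin

lemma hom_0 [simp]: "\<sigma> 0 = 0"
  using hom_add[of 0 0] by (metis add.right_neutral add_left_cancel)

lemma hom_uminus: "\<sigma> (- a) = - \<sigma> a"
  using hom_add[of a "- a"] by (simp add: eq_neg_iff_add_eq_0 add.commute)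

lemma hom_diff: "\<sigma> (a - b) = \<sigma> a - \<sigma> b"
  using hom_add[of a "- b"] by (simp add: hom_uminus)

lemma hom_eq_0_iff [simp]: "\<sigma> a = 0 \<longleftrightarrow> a = 0"
  using hom_mult[of a "inverse a"] hom_1 by (cases "a = 0") auto

lemma hom_eq_iff: "\<sigma> a = \<sigma> b \<longleftrightarrow> a = b"
  using hom_eq_0_iff[of "a - b"] by (simp add: hom_diff)

lemma hom_power: "\<sigma> (a ^ n) = \<sigma> a ^ n"
  by (induction n) (simp_all add: hom_1 hom_mult)

lemma coeff_map: "coeff (map_poly \<sigma> p) n = \<sigma> (coeff p n)"
  by (simp add: coeff_map_poly)

lemma map_pCons [simp]: "map_poly \<sigma> (pCons a p) = pCons (\<sigma> a) (map_poly \<sigma> p)"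
  by (rule poly_eqI) (simp add: coeff_map coeff_pCons split: nat.split)

lemma map_add: "map_poly \<sigma> (p + q) = map_poly \<sigma> p + map_poly \<sigma> q"
  by (rule poly_eqI) (simp add: coeff_map hom_add)

lemma map_diff: "map_poly \<sigma> (p - q) = map_poly \<sigma> p - map_poly \<sigma> q"
  by (rule poly_eqI) (simp add: coeff_map hom_diff)

lemma map_smult: "map_poly \<sigma> (smult a p) = smult (\<sigma> a) (map_poly \<sigma> p)"
  by (rule poly_eqI) (simp add: coeff_map hom_mult)

lemma map_mult: "map_poly \<sigma> (p * q) = map_poly \<sigma> p * map_poly \<sigma> q"
  by (induction p) (simp_all add: map_add map_smult)

lemma map_1 [simp]: "map_poly \<sigma> 1 = 1"
  by (simp add: hom_1)

lemma map_power: "map_poly \<sigma> (p ^ n) = map_poly \<sigma> p ^ n"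
  by (induction n) (simp_all add: map_mult)

lemma map_eq_0_iff [simp]: "map_poly \<sigma> p = 0 \<longleftrightarrow> p = 0"
  by (simp add: poly_eq_iff coeff_map)

lemma degree_map [simp]: "degree (map_poly \<sigma> p) = degree p"
  by (rule degree_map_poly) simp

lemma poly_map: "poly (map_poly \<sigma> p) (\<sigma> x) = \<sigma> (poly p x)"
  by (induction p) (simp_all add: hom_add hom_mult)

definition fract_map :: "'a poly fract \<Rightarrow> 'b poly fract" where
  "fract_map x = (THE y. \<exists>p q. q \<noteq> 0 \<and> x = Fract p q \<and> y = Fract (map_poly \<sigma> p) (map_poly \<sigma> q))"

lemma fract_map_Fract:
  assumes "q \<noteq> 0"
  shows "fract_map (Fract p q) = Fract (map_poly \<sigma> p) (map_poly \<sigma> q)"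
  unfolding fract_map_def
proof (rule the_equality)
  fix y assume "\<exists>p' q'. q' \<noteq> 0 \<and> Fract p q = Fract p' q' \<and> y = Fract (map_poly \<sigma> p') (map_poly \<sigma> q')"
  then obtain p' q' where *: "q' \<noteq> 0" "Fract p q = Fract p' q'"
    "y = Fract (map_poly \<sigma> p') (map_poly \<sigma> q')" by blast
  hence "p * q' = p' * q" using assms by (simp add: eq_fract)
  hence "map_poly \<sigma> p * map_poly \<sigma> q' = map_poly \<sigma> p' * map_poly \<sigma> q"
    by (simp flip: map_mult)
  thus "y = Fract (map_poly \<sigma> p) (map_poly \<sigma> q)" using * assms by (simp add: eq_fract)
qed (use assms in blast)

lemma fract_map_add: "fract_map (x + y) = fract_map x + fract_map y"
  by (cases x; cases y) (simp add: fract_map_Fract map_add map_mult)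

lemma fract_map_mult: "fract_map (x * y) = fract_map x * fract_map y"
  by (cases x; cases y) (simp add: fract_map_Fract map_mult)

lemma fract_map_uminus: "fract_map (- x) = - fract_map x"
proof (cases x)
  case (Fract p q)
  have "map_poly \<sigma> (- p) = - map_poly \<sigma> p" using map_diff[of 0 p] by simp
  thus ?thesis using Fract by (simp add: fract_map_Fract)
qed

lemma fract_map_eq_0_iff: "fract_map x = 0 \<longleftrightarrow> x = 0"
  by (cases x) (simp add: fract_map_Fract Zero_fract_def eq_fract)

lemma fract_map_const: "fract_map (fract_const a) = fract_const (\<sigma> a)"
  by (simp add: fract_const_def fract_map_Fract)

end

lemma lookup_frag_extend_inj:
  assumes "inj h"
  shows "Poly_Mapping.lookup (frag_extend (\<lambda>P. frag_of (h P)) E) (h P) = Poly_Mapping.lookup E P"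
  using subset_UNIV[of "Poly_Mapping.keys E"]
proof (induction E rule: frag_induction)
  case (one x)
  thus ?case using assms by (simp add: inj_eq)
qed (simp_all add: frag_extend_diff lookup_minus)

lemma galois_act_add: "galois_act \<sigma> (E + F) = galois_act \<sigma> E + galois_act \<sigma> F"
  and galois_act_diff: "galois_act \<sigma> (E - F) = galois_act \<sigma> E - galois_act \<sigma> F"
  and galois_act_cmul: "galois_act \<sigma> (frag_cmul k E) = frag_cmul k (galois_act \<sigma> E)"
  and galois_act_frag_of: "galois_act \<sigma> (frag_of P) = frag_of (map_curve_point \<sigma> P)"
  and galois_act_0: "galois_act \<sigma> 0 = 0"
  by (simp_all add: galois_act_def frag_extend_add frag_extend_diff frag_extend_cmul)

lemma galois_act_inverse:
  assumes "\<And>x. \<sigma> (\<tau> x) = x"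
  shows "galois_act \<sigma> (galois_act \<tau> E) = E"
  using subset_UNIV[of "Poly_Mapping.keys E"]
proof (induction E rule: frag_induction)
  case (one P)
  have "map_curve_point \<sigma> (map_curve_point \<tau> P) = P"
    using assms by (cases P) simp_all
  thus ?case by (simp add: galois_act_frag_of)
qed (simp_all add: galois_act_0 galois_act_diff)

locale curve_automorphism = sextic_curve d f + field_embedding \<sigma>
  for d :: "'a::alg_closed_field" and f :: "'a poly" and \<sigma> :: "'a \<Rightarrow> 'a" +
  assumes bij: "bij \<sigma>" and fix_d: "\<sigma> d = d" and fix_f: "map_poly \<sigma> f = f"
begin

lemma map_point_in_C: "map_curve_point \<sigma> P \<in> C \<longleftrightarrow> P \<in> C"
proof (cases P)
  case (Affine \<alpha> \<beta>)
  have "d * (\<sigma> \<beta>)^2 = poly f (\<sigma> \<alpha>) \<longleftrightarrow> \<sigma> (d * \<beta>^2) = \<sigma> (poly f \<alpha>)"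
    using poly_map[of f \<alpha>] by (simp add: hom_mult hom_power fix_d fix_f)
  thus ?thesis by (simp add: Affine hom_eq_iff)
next
  case (At_Infinity \<gamma>)
  have "d * (\<sigma> \<gamma>)^2 = coeff f 6 \<longleftrightarrow> \<sigma> (d * \<gamma>^2) = \<sigma> (coeff f 6)"
    using coeff_map[of f 6] by (simp add: hom_mult hom_power fix_d fix_f)
  thus ?thesis by (simp add: At_Infinity hom_eq_iff)
qed

lemma inj_map_point: "inj (map_curve_point \<sigma>)"
  by (rule curve_point.inj_map) (use bij in \<open>simp add: bij_def\<close>)

lemma surj_map_point: "surj (map_curve_point \<sigma>)"
proof (rule surjI)
  fix P show "map_curve_point \<sigma> (map_curve_point (inv_into UNIV \<sigma>) P) = P"
    using bij by (cases P) (simp_all add: bij_is_surj surj_f_inv_f)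
qed

definition ff_map :: "'a function_field \<Rightarrow> 'a function_field" where
  "ff_map g = (fract_map (fst g), fract_map (snd g))"

lemma surj_fract_map: "surj fract_map"
  unfolding surj_def
proof
  fix x :: "'a poly fract"
  let ?\<tau> = "inv_into UNIV \<sigma>"
  obtain p q where x: "x = Fract p q" "q \<noteq> 0" by (cases x) auto
  have \<tau>: "\<sigma> (?\<tau> a) = a" for a using bij by (simp add: bij_is_surj surj_f_inv_f)
  have "?\<tau> 0 = 0" using \<tau>[of 0] by simp
  hence map_inv: "map_poly \<sigma> (map_poly ?\<tau> p) = p" for p
    by (intro poly_eqI) (simp add: coeff_map coeff_map_poly \<tau>)
  have "map_poly ?\<tau> q \<noteq> 0" using x(2) map_inv[of q] by auto
  hence "x = fract_map (Fract (map_poly ?\<tau> p) (map_poly ?\<tau> q))"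
    using x by (simp add: fract_map_Fract map_inv)
  thus "\<exists>y. x = fract_map y" ..
qed

text \<open>The valuation at the image point, composed with the action on coefficients, is a
  valuation centred at P, and there is only one.\<close>

lemma ord_map:
  assumes P: "P \<in> C"
  shows "ord_at d f (map_curve_point \<sigma> P) (ff_map g) = ord_at d f P g"
proof -
  let ?v = "ord_at d f (map_curve_point \<sigma> P)"
  have Q: "map_curve_point \<sigma> P \<in> C" using P by (simp add: map_point_in_C)
  have F: "fract_map (Fract f [:d:]) = Fract f [:d:]"
    using d by (simp add: fract_map_Fract fix_d fix_f)
  have const: "ff_map (ff_const a) = ff_const (\<sigma> a)" for a
    by (simp add: ff_map_def ff_const_def ff_of_base_def fract_map_eq_0_iff fract_map_const
        flip: fract_const_def)
  have diff: "ff_map (ff_diff g h) = ff_diff (ff_map g) (ff_map h)" for g h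
    by (simp add: ff_map_def ff_diff_def fract_map_add[of _ "- _", simplified] fract_map_uminus)
  have 0: "fract_map 0 = 0" and 1: "fract_map 1 = 1"
    using fract_map_const[of 1] by (simp_all add: fract_map_eq_0_iff hom_1)
  have "ff_valuation d f (?v \<circ> ff_map)"
  proof (rule valuation_transport[OF ord_at(1)[OF Q], where \<tau> = \<sigma>])
    show "ff_map (ff_const a) = ff_const (\<sigma> a)" for a by (rule const)
    show "surj ff_map"
    proof (rule surjI)
      fix g show "ff_map (inv_into UNIV fract_map (fst g), inv_into UNIV fract_map (snd g)) = g"
        using surj_fract_map by (simp add: ff_map_def surj_f_inv_f)
    qed
  qed (auto simp: ff_map_def ff_mult_def ff_add_def fract_map_add fract_map_mult F
      fract_map_eq_0_iff ff_zero_iff prod_eq_iff ff_zero_def)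
  moreover have "centred_at (?v \<circ> ff_map) P"
  proof (cases P)
    case (Affine \<alpha> \<beta>)
    have "ff_map ff_x = ff_x" "ff_map ff_y = ff_y"
      by (simp_all add: ff_map_def ff_x_def ff_y_def ff_of_base_def 0 1 fract_map_Fract hom_1)
    thus ?thesis using ord_at(2)[OF Q] by (simp add: Affine diff const)
  next
    case (At_Infinity \<gamma>)
    have "ff_map (ff_of_base (Fract 1 [:0, 1:])) = ff_of_base (Fract 1 [:0, 1:])"
      "ff_map (0, Fract 1 ([:0, 1:] ^ 3)) = (0, Fract 1 ([:0, 1:] ^ 3))"
      by (simp_all add: ff_map_def ff_of_base_def 0 fract_map_Fract hom_1 map_power)
    thus ?thesis using ord_at(2)[OF Q] by (simp add: At_Infinity diff const)
  qed
  ultimately have "ord_at d f P = ?v \<circ> ff_map" by (rule ord_at_eqI[OF P])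
  thus ?thesis by simp
qed

lemma lookup_galois_act:
  "Poly_Mapping.lookup (galois_act \<sigma> E) (map_curve_point \<sigma> P) = Poly_Mapping.lookup E P"
  unfolding galois_act_def by (rule lookup_frag_extend_inj[OF inj_map_point])

lemma keys_galois_act: "Poly_Mapping.keys (galois_act \<sigma> E) = map_curve_point \<sigma> ` Poly_Mapping.keys E"
proof (rule Set.set_eqI)
  fix Q obtain P where "Q = map_curve_point \<sigma> P" using surj_map_point by (meson surjD)
  thus "Q \<in> Poly_Mapping.keys (galois_act \<sigma> E) \<longleftrightarrow> Q \<in> map_curve_point \<sigma> ` Poly_Mapping.keys E"
    by (simp add: in_keys_iff lookup_galois_act inj_image_mem_iff[OF inj_map_point])
qed

lemma galois_act_principal: "E \<in> principal \<Longrightarrow> galois_act \<sigma> E \<in> principal"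
proof -
  assume E: "E \<in> principal"
  then obtain g where g: "g \<noteq> ff_zero" "\<forall>P\<in>C. Poly_Mapping.lookup E P = ord_at d f P g"
    unfolding principal_iff by blast
  have "Poly_Mapping.lookup (galois_act \<sigma> E) Q = ord_at d f Q (ff_map g)" if "Q \<in> C" for Q
  proof -
    obtain P where P: "Q = map_curve_point \<sigma> P" using surj_map_point by (meson surjD)
    thus ?thesis using g(2) that by (simp add: lookup_galois_act map_point_in_C ord_map)
  qed
  moreover have "ff_map g \<noteq> ff_zero"
    using g(1) by (cases g) (simp add: ff_map_def ff_zero_iff fract_map_eq_0_iff)
  moreover have "Poly_Mapping.keys (galois_act \<sigma> E) \<subseteq> C"
    using E by (auto simp: keys_galois_act map_point_in_C principal_iff)
  ultimately show ?thesis unfolding principal_iff by blast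
qed

text \<open>The inverse upgrades the inclusion of \<open>principal\<close> under the Galois action
  to the equality that invariance of cosets demands.\<close>

lemma curve_automorphism_inv: "curve_automorphism d f (inv_into UNIV \<sigma>)"
proof -
  have i: "inv_into UNIV \<sigma> (\<sigma> x) = x" "\<sigma> (inv_into UNIV \<sigma> x) = x" for x
    using bij by (simp_all add: bij_is_inj bij_is_surj surj_f_inv_f)
  show ?thesis
  proof
    fix a b
    show "inv_into UNIV \<sigma> (a + b) = inv_into UNIV \<sigma> a + inv_into UNIV \<sigma> b" "inv_into UNIV \<sigma> (a * b) = inv_into UNIV \<sigma> a * inv_into UNIV \<sigma> b"
      using hom_add[of "inv_into UNIV \<sigma> a" "inv_into UNIV \<sigma> b"] hom_mult[of "inv_into UNIV \<sigma> a" "inv_into UNIV \<sigma> b"] i by metis+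
  next
    show "inv_into UNIV \<sigma> 1 = 1" "inv_into UNIV \<sigma> d = d" using i hom_1 fix_d by metis+
    show "bij (inv_into UNIV \<sigma>)" using bij by (rule bij_imp_bij_inv)
    have "inv_into UNIV \<sigma> 0 = 0" using i hom_0 by metis
    moreover have "inv_into UNIV \<sigma> (coeff f n) = coeff f n" for n
      using coeff_map[of f n] i unfolding fix_f by metis
    ultimately show "map_poly (inv_into UNIV \<sigma>) f = f" by (intro poly_eqI) (simp add: coeff_map_poly)
  qed
qed

lemma galois_act_image_principal: "galois_act \<sigma> ` principal = principal"
proof
  show "galois_act \<sigma> ` principal \<subseteq> principal" using galois_act_principal by blast
  interpret i: curve_automorphism d f "inv_into UNIV \<sigma>" by (rule curve_automorphism_inv)
  show "principal \<subseteq> galois_act \<sigma> ` principal"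
  proof
    fix E assume "E \<in> principal"
    moreover have "galois_act \<sigma> (galois_act (inv_into UNIV \<sigma>) E) = E"
      by (rule galois_act_inverse) (use bij in \<open>simp add: bij_is_surj surj_f_inv_f\<close>)
    ultimately show "E \<in> galois_act \<sigma> ` principal" using i.galois_act_principal by force
  qed
qed

lemma proots_map: "proots (map_poly \<sigma> p) = image_mset \<sigma> (proots p)"
proof (cases "p = 0")
  case False
  obtain A where A: "p = smult (lead_coeff p) (\<Prod>x\<in>#A. [:- x, 1:])"
    using alg_closed_imp_factorization[OF False] by blast
  have "map_poly \<sigma> (\<Prod>x\<in>#A. [:- x, 1:]) = (\<Prod>x\<in>#image_mset \<sigma> A. [:- x, 1:])"
    by (induction A) (simp_all add: map_mult hom_uminus hom_1 del: mult_pCons_left)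
  hence "map_poly \<sigma> p = smult (\<sigma> (lead_coeff p)) (\<Prod>x\<in>#image_mset \<sigma> A. [:- x, 1:])"
    by (subst A) (simp only: map_smult)
  hence "proots (map_poly \<sigma> p) = image_mset \<sigma> A"
    using False by (simp only: proots_smult hom_eq_0_iff leading_coeff_0_iff proots_prod_linear
        not_False_eq_True)
  moreover have "proots p = A"
    using False by (subst A) (simp only: proots_smult leading_coeff_0_iff proots_prod_linear
        not_False_eq_True)
  ultimately show ?thesis by simp
qed simp

lemma galois_act_graph_divisor:
  assumes "map_poly \<sigma> a = a" "map_poly \<sigma> m = m"
  shows "galois_act \<sigma> (graph_divisor k a m) = graph_divisor k a m"
proof -
  have "galois_act \<sigma> (\<Sum>\<alpha>\<in>#M. frag_of (Affine \<alpha> (poly m \<alpha>))) =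
    (\<Sum>\<alpha>\<in>#image_mset \<sigma> M. frag_of (Affine \<alpha> (poly m \<alpha>)))" for M
    using assms(2) poly_map[of m]
    by (induction M) (simp_all add: galois_act_0 galois_act_add galois_act_frag_of)
  moreover have "\<sigma> (coeff m 3) = coeff m 3" using coeff_map[of m 3] assms(2) by simp
  ultimately show ?thesis
    using proots_map[of a] assms(1)
    by (simp add: graph_divisor_def galois_act_add galois_act_cmul galois_act_frag_of)
qed

lemma galois_act_H: "galois_act \<sigma> H = H"
proof -
  have "d * (\<sigma> gam)^2 = coeff f 6"
    using gam coeff_map[of f 6] by (metis fix_d fix_f hom_mult hom_power)
  thus ?thesis unfolding infinite_points
    by (auto simp: H_def galois_act_add galois_act_frag_of hom_uminus add.commute)
qed

end

subsection \<open>Rational divisor classes\<close>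

lemma divisor_degree_superset:
  assumes "finite S" "Poly_Mapping.keys E \<subseteq> S"
  shows "divisor_degree E = (\<Sum>P\<in>S. Poly_Mapping.lookup E P)"
  unfolding divisor_degree_def by (rule sum.mono_neutral_left) (use assms in \<open>auto simp: in_keys_iff\<close>)

lemma divisor_degree_add: "divisor_degree (E + F) = divisor_degree E + divisor_degree F"
proof -
  let ?S = "Poly_Mapping.keys E \<union> Poly_Mapping.keys F"
  have "divisor_degree (E + F) = (\<Sum>P\<in>?S. Poly_Mapping.lookup (E + F) P)"
    using Poly_Mapping.keys_add[of E F] by (intro divisor_degree_superset) auto
  also have "\<dots> = divisor_degree E + divisor_degree F"
    by (simp add: lookup_add sum.distrib divisor_degree_superset[of ?S E] divisor_degree_superset[of ?S F])
  finally show ?thesis .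
qed

lemma divisor_degree_uminus: "divisor_degree (- E) = - divisor_degree E"
  by (simp add: divisor_degree_def sum_negf)

lemma divisor_degree_diff: "divisor_degree (E - F) = divisor_degree E - divisor_degree F"
  using divisor_degree_add[of E "- F"] divisor_degree_uminus[of F] by simp

lemma divisor_degree_0 [simp]: "divisor_degree 0 = 0"
  by (simp add: divisor_degree_def)

lemma divisor_degree_frag_of [simp]: "divisor_degree (frag_of P) = 1"
  by (simp add: divisor_degree_def keys_frag_of)

lemma divisor_degree_cmul: "divisor_degree (frag_cmul k E) = k * divisor_degree E"
  using divisor_degree_superset[of "Poly_Mapping.keys E" "frag_cmul k E"] keys_cmul[of k E]
  by (simp add: divisor_degree_def sum_distrib_left)

context sextic_curve
begin

abbreviation Div where "Div \<equiv> divisor_group d f"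
abbreviation Pic where "Pic \<equiv> picard_group d f"

sublocale Div: comm_group Div
  unfolding divisor_group_def by (rule abelian_free_Abelian_group)

lemma Div_simps [simp]: "E \<in> carrier Div \<longleftrightarrow> Poly_Mapping.keys E \<subseteq> C"
  "E \<otimes>\<^bsub>Div\<^esub> F = E + F" "\<one>\<^bsub>Div\<^esub> = 0" "E [^]\<^bsub>Div\<^esub> (n::nat) = frag_cmul (int n) E"
  by (simp_all add: divisor_group_def)

lemma Div_inv [simp]: "Poly_Mapping.keys E \<subseteq> C \<Longrightarrow> inv\<^bsub>Div\<^esub> E = - E"
  by (simp add: divisor_group_def)

lemma principal_subgroup: "subgroup principal Div"
proof (rule Div.subgroupI)
  show "principal \<subseteq> carrier Div" by (auto simp: principal_iff)
  show "principal \<noteq> {}" using principal_zero by blast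
  fix E assume E: "E \<in> principal"
  hence "Poly_Mapping.keys E \<subseteq> C" by (simp add: principal_iff)
  thus "inv\<^bsub>Div\<^esub> E \<in> principal" using principal_uminus[OF E] by simp
  fix F assume "F \<in> principal"
  thus "E \<otimes>\<^bsub>Div\<^esub> F \<in> principal" using principal_add[OF E] by simp
qed

sublocale Pic: normal principal Div
  by (rule Div.subgroup_imp_normal[OF principal_subgroup])

lemma Pic_group: "group Pic"
  unfolding picard_group_def by (rule Pic.factorgroup_is_group)

abbreviation cls where "cls E \<equiv> principal #>\<^bsub>Div\<^esub> E"

lemma cls_eq_one_iff:
  assumes "Poly_Mapping.keys E \<subseteq> C"
  shows "cls E = \<one>\<^bsub>Pic\<^esub> \<longleftrightarrow> E \<in> principal"
  using assms Div.coset_join1[OF _ _ principal_subgroup, of E] Div.coset_join2[OF _ principal_subgroup, of E]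
    principal_subgroup
  by (auto simp: picard_group_def principal_iff)

lemma cls_pow:
  assumes "Poly_Mapping.keys E \<subseteq> C"
  shows "cls E [^]\<^bsub>Pic\<^esub> (n::nat) = cls (frag_cmul (int n) E)"
  using Pic.FactGroup_pow[of E n] assms by (simp add: picard_group_def)

end

lemma galois_act_set_mult:
  assumes "\<And>x y. x \<otimes>\<^bsub>G\<^esub> y = x + y"
  shows "galois_act \<sigma> ` (A <#>\<^bsub>G\<^esub> B) = galois_act \<sigma> ` A <#>\<^bsub>G\<^esub> galois_act \<sigma> ` B"
  unfolding set_mult_def assms by (auto simp: galois_act_add image_iff) (metis galois_act_add)+

interpretation to_ac: field_embedding to_ac
  by unfold_locales simp_all

locale sextic_over_field =
  fixes d\<^sub>0 :: "'k::field" and f\<^sub>0 :: "'k poly"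
  assumes sextic: "sextic_curve (to_ac d\<^sub>0) (map_poly to_ac f\<^sub>0)"
begin

sublocale sextic_curve "to_ac d\<^sub>0" "map_poly to_ac f\<^sub>0"
  by (rule sextic)

lemma fixes_map_poly:
  assumes "\<sigma> \<in> field_automorphisms_over_base"
  shows "map_poly \<sigma> (map_poly to_ac p) = map_poly to_ac p"
proof -
  have "\<sigma> (to_ac c) = to_ac c" for c using assms by (simp add: field_automorphisms_over_base_def)
  moreover from this[of 0] have "\<sigma> 0 = 0" by simp
  ultimately show ?thesis by (intro poly_eqI) (simp add: coeff_map_poly)
qed

lemma automorphism:
  assumes "\<sigma> \<in> field_automorphisms_over_base"
  shows "curve_automorphism (to_ac d\<^sub>0) (map_poly to_ac f\<^sub>0) \<sigma>"
proof -
  have "\<sigma> (to_ac c) = to_ac c" for c using assms by (simp add: field_automorphisms_over_base_def)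
  from this this[of 1] show ?thesis
    using assms fixes_map_poly[OF assms]
    by unfold_locales (simp_all add: field_automorphisms_over_base_def)
qed

abbreviation rational where "rational \<equiv> rational_divisor_classes d\<^sub>0 f\<^sub>0"

text \<open>Rationality is checked on one divisor instead of its class: the action maps the set of
  principal divisors onto itself, so a fixed representative makes the whole coset invariant.\<close>

lemma rational_cls:
  assumes E: "Poly_Mapping.keys E \<subseteq> C" and "divisor_degree E = 0"
    and "\<And>P. P \<in> Poly_Mapping.keys E \<Longrightarrow> set_curve_point P \<subseteq> separable_closure"
    and fixed: "\<And>\<sigma>. \<sigma> \<in> field_automorphisms_over_base \<Longrightarrow> galois_act \<sigma> E = E"
  shows "cls E \<in> rational"
  unfolding rational_divisor_classes_def
proof (intro CollectI conjI ballI)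
  show "cls E \<in> carrier Pic" using E by (auto simp: picard_group_def carrier_FactGroup)
  have "E \<in> cls E" using Div.rcos_self[OF _ principal_subgroup, of E] E by simp
  thus "\<exists>D\<in>cls E. divisor_degree D = 0 \<and>
      (\<forall>P\<in>Poly_Mapping.keys D. set_curve_point P \<subseteq> separable_closure)"
    using assms by blast
next
  fix \<sigma> :: "'k alg_closure \<Rightarrow> 'k alg_closure" assume \<sigma>: "\<sigma> \<in> field_automorphisms_over_base"
  interpret \<sigma>: curve_automorphism "to_ac d\<^sub>0" "map_poly to_ac f\<^sub>0" \<sigma> by (rule automorphism[OF \<sigma>])
  have cls: "cls E = (\<lambda>F. F + E) ` principal" by (auto simp: r_coset_def)
  have "galois_act \<sigma> ` cls E = (\<lambda>F. F + E) ` (galois_act \<sigma> ` principal)"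
    unfolding cls by (simp add: image_image galois_act_add fixed[OF \<sigma>])
  also have "\<dots> = cls E"
    unfolding \<sigma>.galois_act_image_principal cls ..
  finally show "galois_act \<sigma> ` cls E = cls E" .
qed

lemma rational_subgroup: "subgroup rational Pic"
proof (rule group.subgroupI[OF Pic_group])
  show "rational \<subseteq> carrier Pic" by (auto simp: rational_divisor_classes_def)
  have "cls 0 \<in> rational"
    by (rule rational_cls) (simp_all add: galois_act_0)
  thus "rational \<noteq> {}" by blast
next
  fix \<xi> assume \<xi>: "\<xi> \<in> rational"
  hence carrier: "\<xi> \<in> carrier Pic" by (simp add: rational_divisor_classes_def)
  have keys: "Poly_Mapping.keys E \<subseteq> C" if E: "E \<in> \<xi>" for E
  proof -
    obtain F where "\<xi> = cls F" "Poly_Mapping.keys F \<subseteq> C"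
      using carrier by (auto simp: picard_group_def carrier_FactGroup)
    moreover from this obtain G where "G \<in> principal" "E = G + F"
      using E by (auto simp: r_coset_def)
    ultimately show ?thesis using Poly_Mapping.keys_add[of G F] by (auto simp: principal_iff)
  qed
  have inv: "inv\<^bsub>Pic\<^esub> \<xi> = uminus ` \<xi>"
    using Pic.inv_FactGroup[of \<xi>] carrier keys by (auto simp: picard_group_def SET_INV_def)
  show "inv\<^bsub>Pic\<^esub> \<xi> \<in> rational"
    unfolding rational_divisor_classes_def
  proof (intro CollectI conjI ballI)
    show "inv\<^bsub>Pic\<^esub> \<xi> \<in> carrier Pic" using group.inv_closed[OF Pic_group carrier] .
    obtain E where E: "E \<in> \<xi>" "divisor_degree E = 0"
      "\<forall>P\<in>Poly_Mapping.keys E. set_curve_point P \<subseteq> separable_closure"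
      using \<xi> unfolding rational_divisor_classes_def by blast
    show "\<exists>D\<in>inv\<^bsub>Pic\<^esub> \<xi>. divisor_degree D = 0 \<and>
        (\<forall>P\<in>Poly_Mapping.keys D. set_curve_point P \<subseteq> separable_closure)"
      unfolding inv by (rule bexI[of _ "- E"]) (use E in \<open>auto simp: divisor_degree_uminus\<close>)
  next
    fix \<sigma> :: "'k alg_closure \<Rightarrow> 'k alg_closure" assume "\<sigma> \<in> field_automorphisms_over_base"
    hence "galois_act \<sigma> ` \<xi> = \<xi>" using \<xi> unfolding rational_divisor_classes_def by blast
    moreover have "galois_act \<sigma> (- E) = - galois_act \<sigma> E" for E
      using galois_act_diff[of \<sigma> 0 E] by (simp add: galois_act_0)
    hence "galois_act \<sigma> ` uminus ` \<xi> = uminus ` galois_act \<sigma> ` \<xi>"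
      by (simp add: image_image)
    ultimately show "galois_act \<sigma> ` (inv\<^bsub>Pic\<^esub> \<xi>) = inv\<^bsub>Pic\<^esub> \<xi>" unfolding inv by simp
  qed
next
  fix \<xi> \<eta> assume \<xi>: "\<xi> \<in> rational" and \<eta>: "\<eta> \<in> rational"
  have mult: "\<xi> \<otimes>\<^bsub>Pic\<^esub> \<eta> = \<xi> <#>\<^bsub>Div\<^esub> \<eta>" by (simp add: picard_group_def)
  show "\<xi> \<otimes>\<^bsub>Pic\<^esub> \<eta> \<in> rational"
    unfolding rational_divisor_classes_def
  proof (intro CollectI conjI ballI)
    show "\<xi> \<otimes>\<^bsub>Pic\<^esub> \<eta> \<in> carrier Pic"
      using \<xi> \<eta> Pic_group by (simp add: rational_divisor_classes_def monoid.m_closed group.is_monoid)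
    obtain E where E: "E \<in> \<xi>" "divisor_degree E = 0"
      "\<forall>P\<in>Poly_Mapping.keys E. set_curve_point P \<subseteq> separable_closure"
      using \<xi> unfolding rational_divisor_classes_def by blast
    obtain F where F: "F \<in> \<eta>" "divisor_degree F = 0"
      "\<forall>P\<in>Poly_Mapping.keys F. set_curve_point P \<subseteq> separable_closure"
      using \<eta> unfolding rational_divisor_classes_def by blast
    have "E + F \<in> \<xi> \<otimes>\<^bsub>Pic\<^esub> \<eta>" unfolding mult set_mult_def using E F by force
    moreover have "\<forall>P\<in>Poly_Mapping.keys (E + F). set_curve_point P \<subseteq> separable_closure"
      using E(3) F(3) Poly_Mapping.keys_add[of E F] by blast
    ultimately show "\<exists>D\<in>\<xi> \<otimes>\<^bsub>Pic\<^esub> \<eta>. divisor_degree D = 0 \<and>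
        (\<forall>P\<in>Poly_Mapping.keys D. set_curve_point P \<subseteq> separable_closure)"
      using E(2) F(2) divisor_degree_add[of E F] by (intro bexI[of _ "E + F"]) auto
  next
    fix \<sigma> :: "'k alg_closure \<Rightarrow> 'k alg_closure" assume "\<sigma> \<in> field_automorphisms_over_base"
    hence "galois_act \<sigma> ` \<xi> = \<xi>" "galois_act \<sigma> ` \<eta> = \<eta>"
      using \<xi> \<eta> unfolding rational_divisor_classes_def by blast+
    thus "galois_act \<sigma> ` (\<xi> \<otimes>\<^bsub>Pic\<^esub> \<eta>) = \<xi> \<otimes>\<^bsub>Pic\<^esub> \<eta>"
      unfolding mult using galois_act_set_mult[of Div \<sigma> \<xi> \<eta>] by simp
  qed
qed

text \<open>Write 48 = k m with k the order. As 48/2 = 24 and 48/3 = 16 are not multiples of k, m is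
  prime to 2 and to 3, hence m = 1.\<close>

lemma order_48:
  assumes E: "Poly_Mapping.keys E \<subseteq> C" and rational: "cls E \<in> rational"
    and 48: "frag_cmul 48 E \<in> principal"
    and 24: "frag_cmul 24 E \<notin> principal" and 16: "frag_cmul 16 E \<notin> principal"
  shows "\<exists>P \<in> carrier (jacobian_rational_points d\<^sub>0 f\<^sub>0).
    group.ord (jacobian_rational_points d\<^sub>0 f\<^sub>0) P = 48"
proof -
  let ?J = "jacobian_rational_points d\<^sub>0 f\<^sub>0"
  interpret P: group Pic by (rule Pic_group)
  have J: "?J = Pic\<lparr>carrier := rational\<rparr>" by (simp add: jacobian_rational_points_def)
  interpret J: group ?J unfolding J by (rule P.subgroup_imp_group[OF rational_subgroup])
  have carrier: "cls E \<in> carrier ?J" using rational by (simp add: J)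
  have dvd: "J.ord (cls E) dvd n \<longleftrightarrow> frag_cmul (int n) E \<in> principal" for n
  proof -
    have keys: "Poly_Mapping.keys (frag_cmul (int n) E) \<subseteq> C" using E keys_cmul[of "int n" E] by blast
    have "cls E [^]\<^bsub>?J\<^esub> n = cls (frag_cmul (int n) E)"
      using P.nat_pow_consistent[of "cls E" n rational] cls_pow[OF E] by (simp add: J)
    moreover have "\<one>\<^bsub>?J\<^esub> = \<one>\<^bsub>Pic\<^esub>" by (simp add: J)
    ultimately show ?thesis using J.pow_eq_id[OF carrier, of n] cls_eq_one_iff[OF keys] by simp
  qed
  define k where "k = J.ord (cls E)"
  have k: "k dvd 48" "\<not> k dvd 24" "\<not> k dvd 16"
    using dvd[of 48] dvd[of 24] dvd[of 16] 48 24 16 by (simp_all add: k_def)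
  then obtain m where m: "48 = k * m" by blast
  have "odd m"
  proof
    assume "even m"
    then obtain j where "m = 2 * j" ..
    hence "24 = k * j" using m by (simp add: ac_simps)
    thus False using k dvd_triv_left by metis
  qed
  moreover have "\<not> 3 dvd m"
  proof
    assume "3 dvd m"
    then obtain j where "m = 3 * j" ..
    hence "16 = k * j" using m by (simp add: ac_simps)
    thus False using k dvd_triv_left by metis
  qed
  hence "coprime m 3" using prime_imp_coprime[of 3 m] by (simp add: coprime_commute)
  moreover have "coprime m (2 ^ 4)"
    unfolding coprime_power_right_iff using \<open>odd m\<close> by simp
  moreover have "m dvd 48" using m by (metis dvd_triv_right)
  hence "m dvd 2 ^ 4 * 3" by simp
  ultimately have "m dvd 3" using coprime_dvd_mult_right_iff by blast
  hence "m = 1" using \<open>coprime m 3\<close> by (metis coprime_common_divisor dvd_refl nat_dvd_1_iff_1)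
  hence "k = 48" using m by simp
  thus ?thesis using carrier unfolding k_def by blast
qed

end

subsection \<open>Separable points\<close>

lemma order_linear: "order a [:- x, 1:] = (if a = x then 1 else 0)"
  using order_power_n_n[of x 1] by (auto intro: order_0I)

lemma rsquarefree_linear: "rsquarefree [:- x, 1:]"
  by (simp add: rsquarefree_def order_linear)

lemma rsquarefree_linear_mult: "x \<noteq> y \<Longrightarrow> rsquarefree ([:- x, 1:] * [:- y, 1:])"
  unfolding rsquarefree_def
proof (intro conjI allI)
  fix a assume "x \<noteq> y"
  have nz: "[:- x, 1:] * [:- y, 1:] \<noteq> 0" by (simp only: mult_eq_0_iff) simp
  show "order a ([:- x, 1:] * [:- y, 1:]) = 0 \<or> order a ([:- x, 1:] * [:- y, 1:]) = 1"
    unfolding order_mult[OF nz] order_linear using \<open>x \<noteq> y\<close> by auto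
qed simp

text \<open>If q \<rho> is nonzero, the element differs from its conjugate p - q \<rho> because the
  characteristic is not 2, so the quadratic with these two roots is squarefree. Otherwise the
  element lies in the base field.\<close>

lemma separable_closure_quadratic:
  fixes e p q :: "'k::field"
  assumes two: "(2::'k) \<noteq> 0" and \<rho>: "\<rho>^2 = to_ac e"
  shows "to_ac p + to_ac q * \<rho> \<in> separable_closure"
proof (cases "q = 0 \<or> e = 0")
  case True
  hence "to_ac p + to_ac q * \<rho> = to_ac p" using \<rho> by auto
  moreover have "rsquarefree (map_poly to_ac [:- p, 1:])"
    by (simp add: rsquarefree_linear)
  ultimately show ?thesis unfolding separable_closure_def
    by (intro CollectI exI[of _ "[:- p, 1:]"]) simp
next
  case False
  let ?P = "[:p^2 - q^2 * e, - 2 * p, 1:]"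
  let ?p = "to_ac p" and ?q = "to_ac q"
  have two': "(2::'k alg_closure) \<noteq> 0"
    using two by (metis to_ac_eq_0_iff to_ac_numeral)
  have P: "map_poly to_ac ?P = [:- (?p + ?q * \<rho>), 1:] * [:- (?p - ?q * \<rho>), 1:]"
    by (simp add: \<rho>[symmetric] algebra_simps power2_eq_square)
  have "?q * \<rho> \<noteq> 0" using False \<rho> by auto
  hence "?p + ?q * \<rho> \<noteq> ?p - ?q * \<rho>"
    using two' by (metis add_left_cancel add.right_inverse diff_conv_add_uminus mult_2 mult_eq_0_iff)
  hence "rsquarefree (map_poly to_ac ?P)" unfolding P by (rule rsquarefree_linear_mult)
  moreover have "poly (map_poly to_ac ?P) (?p + ?q * \<rho>) = 0" unfolding P poly_mult by simp
  ultimately show ?thesis unfolding separable_closure_def by blast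
qed

text \<open>Keeps the second coordinate m(x) of a point in the quadratic extension that contains x,
  so that it is separable together with x.\<close>

lemma quadratic_extension_poly:
  assumes x: "x = to_ac p + to_ac q * \<rho>" and \<rho>: "\<rho>^2 = to_ac e"
  shows "\<exists>p' q'. poly (map_poly to_ac m) x = to_ac p' + to_ac q' * \<rho>"
proof (induction m)
  case 0
  show ?case by (intro exI[of _ 0]) simp
next
  case (pCons c m)
  then obtain p' q' where *: "poly (map_poly to_ac m) x = to_ac p' + to_ac q' * \<rho>" by blast
  have "poly (map_poly to_ac (pCons c m)) x = to_ac c + x * poly (map_poly to_ac m) x"
    by simp
  also have "\<dots> = to_ac c + (to_ac p + to_ac q * \<rho>) * (to_ac p' + to_ac q' * \<rho>)"
    unfolding * by (simp only: x)
  also have "\<dots> = to_ac (c + p * p' + q * q' * e) + to_ac (p * q' + q * p') * \<rho>"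
    by (simp add: \<rho>[symmetric] algebra_simps power2_eq_square)
  finally show ?case by blast
qed

lemma quadratic_root:
  fixes a :: "'k::field poly"
  assumes two: "(2::'k) \<noteq> 0" and a: "a \<noteq> 0" "degree a \<le> 2" and root: "poly (map_poly to_ac a) x = 0"
  shows "\<exists>p q \<rho> e. x = to_ac p + to_ac q * \<rho> \<and> \<rho>^2 = to_ac e"
proof -
  define c0 c1 c2 where "c0 = coeff a 0" and "c1 = coeff a 1" and "c2 = coeff a 2"
  have eq: "a = [:c0, c1, c2:]"
  proof (rule poly_eqI)
    fix n show "coeff a n = coeff [:c0, c1, c2:] n"
      using a(2) coeff_eq_0[of a n]
      by (cases "n \<le> 2") (auto simp: c0_def c1_def c2_def le_Suc_eq numeral_2_eq_2 coeff_pCons split: nat.split)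
  qed
  have r: "to_ac c2 * x^2 + to_ac c1 * x + to_ac c0 = 0"
    using root unfolding eq by (simp add: algebra_simps power2_eq_square)
  show ?thesis
  proof (cases "c2 = 0")
    case True
    have "c1 \<noteq> 0"
    proof
      assume "c1 = 0"
      hence "c0 = 0" using r True by simp
      thus False using a(1) eq True \<open>c1 = 0\<close> by simp
    qed
    hence "x = to_ac (- c0 / c1) + to_ac 0 * 0"
      using r True by (simp add: field_simps eq_neg_iff_add_eq_0)
    moreover have "0^2 = to_ac 0" by simp
    ultimately show ?thesis by blast
  next
    case False
    have nz: "to_ac (2 * c2) \<noteq> 0" using False two by (simp only: to_ac_eq_0_iff mult_eq_0_iff) simp
    let ?\<rho> = "to_ac (2 * c2) * x + to_ac c1"
    have "?\<rho>^2 = to_ac (c1^2 - 4 * c2 * c0)"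
      using r by (simp only: to_ac_mult to_ac_diff to_ac_power to_ac_numeral) Groebner_Basis.algebra
    moreover have "x = to_ac (- c1 / (2 * c2)) + to_ac (1 / (2 * c2)) * ?\<rho>"
    proof -
      have "to_ac (2 * c2) * (to_ac (- c1 / (2 * c2)) + to_ac (1 / (2 * c2)) * ?\<rho>)
         = - to_ac c1 + ?\<rho>"
        using nz unfolding to_ac_divide to_ac_minus to_ac_1 distrib_left by simp
      hence "to_ac (2 * c2) * (to_ac (- c1 / (2 * c2)) + to_ac (1 / (2 * c2)) * ?\<rho>) = to_ac (2 * c2) * x"
        by simp
      thus ?thesis using nz mult_left_cancel by metis
    qed
    ultimately show ?thesis by blast
  qed
qed

section \<open>Torsion\<close>

subsection \<open>Relations between graph divisors\<close>

context sextic_curve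
begin

lemma divisor_degree_graph_divisor:
  assumes "a \<noteq> 0"
  shows "divisor_degree (graph_divisor k a m) = int k"
proof -
  have "divisor_degree (\<Sum>\<alpha>\<in>#M. frag_of (Affine \<alpha> (poly m \<alpha>))) = int (size M)" for M
    by (induction M) (simp_all add: divisor_degree_add)
  thus ?thesis using size_proots_eq_degree[OF assms]
    by (simp add: graph_divisor_def divisor_degree_add divisor_degree_cmul)
qed

lemma divisor_degree_H: "divisor_degree H = 2"
  by (simp add: H_def divisor_degree_add)

lemma three_quadratics:
  assumes m: "degree m \<le> 3" and N: "norm_y m = smult c (a1 * a2 * a3)"
    and deg: "degree a1 \<le> 2" "degree a2 \<le> 2" "degree a3 \<le> 2"
  shows "graph_divisor 2 a1 m + graph_divisor 2 a2 m + graph_divisor 2 a3 m - frag_cmul 3 H \<in> principal"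
    and "Poly_Mapping.keys (graph_divisor 2 a1 m) \<subseteq> C"
    and "Poly_Mapping.keys (graph_divisor 2 a2 m) \<subseteq> C"
    and "Poly_Mapping.keys (graph_divisor 2 a3 m) \<subseteq> C"
proof -
  have nz: "c \<noteq> 0" "a1 \<noteq> 0" "a2 \<noteq> 0" "a3 \<noteq> 0" using norm_y_neq_0[of m] N by auto
  have "graph_divisor 6 (norm_y m) m = graph_divisor (2 + 2 + 2) (a1 * a2 * a3) m"
    using nz(1) by (simp add: N graph_divisor_smult)
  also have "\<dots> = graph_divisor 2 a1 m + graph_divisor 2 a2 m + graph_divisor 2 a3 m"
    using nz by (simp only: graph_divisor_mult no_zero_divisors not_False_eq_True)
  finally show "graph_divisor 2 a1 m + graph_divisor 2 a2 m + graph_divisor 2 a3 m - frag_cmul 3 H \<in> principal"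
    using principal_graph[OF m] by simp
  have deg_N: "degree (norm_y m) = degree a1 + degree a2 + degree a3"
    using nz by (simp add: N degree_mult_eq)
  have "coeff (norm_y m) 6 = 0" if "degree a < 2" "a \<in> {a1, a2, a3}" for a
    by (rule coeff_eq_0) (use deg deg_N that in auto)
  moreover have "degree a \<le> 2" if "a \<in> {a1, a2, a3}" for a using that deg by auto
  ultimately have *: "2 = degree a \<or> coeff (norm_y m) 6 = 0" if "a \<in> {a1, a2, a3}" for a
    using that by (metis le_neq_implies_less)
  have "Poly_Mapping.keys (graph_divisor 2 a m) \<subseteq> C" if "a \<in> {a1, a2, a3}" for a
    by (rule keys_graph_divisor) (use that m * N nz in auto)
  thus "Poly_Mapping.keys (graph_divisor 2 a1 m) \<subseteq> C"
    "Poly_Mapping.keys (graph_divisor 2 a2 m) \<subseteq> C"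
    "Poly_Mapping.keys (graph_divisor 2 a3 m) \<subseteq> C" by auto
qed

text \<open>The coefficients of the three combinations come from eliminating q by 2 a = - q and 4 q
  = t: 24 a = - 12 q = - 3 t = t and 16 a = - 8 q = - 2 t = 0.\<close>

lemma torsion_48:
  assumes a: "frag_cmul 2 a + q \<in> principal" and q: "frag_cmul 4 q - t \<in> principal"
    and t: "frag_cmul 2 t \<in> principal" "t \<notin> principal"
    and b: "frag_cmul 3 b \<in> principal" "b \<notin> principal"
  shows "frag_cmul 48 (a + b) \<in> principal" "frag_cmul 24 (a + b) \<notin> principal"
    "frag_cmul 16 (a + b) \<notin> principal"
proof -
  have "frag_cmul 48 (a + b) = frag_cmul 24 (frag_cmul 2 a + q) - frag_cmul 6 (frag_cmul 4 q - t)
      - frag_cmul 3 (frag_cmul 2 t) + frag_cmul 16 (frag_cmul 3 b)"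
    by (rule poly_mapping_eqI) (simp add: lookup_add lookup_minus algebra_simps)
  also have "\<dots> \<in> principal"
    by (intro principal_add principal_diff principal_cmul a q t(1) b(1))
  finally show "frag_cmul 48 (a + b) \<in> principal" .
  show "frag_cmul 24 (a + b) \<notin> principal"
  proof
    assume *: "frag_cmul 24 (a + b) \<in> principal"
    have "t = frag_cmul 12 (frag_cmul 2 a + q) - frag_cmul 3 (frag_cmul 4 q - t)
      + frag_cmul 8 (frag_cmul 3 b) - frag_cmul 24 (a + b) - frag_cmul 1 (frag_cmul 2 t)"
      by (rule poly_mapping_eqI) (simp add: lookup_add lookup_minus algebra_simps)
    also have "\<dots> \<in> principal"
      by (intro principal_add principal_diff principal_cmul a q t(1) b(1) *)
    finally show False using t(2) by blast
  qed
  show "frag_cmul 16 (a + b) \<notin> principal"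
  proof
    assume *: "frag_cmul 16 (a + b) \<in> principal"
    have "b = frag_cmul 16 (a + b) - frag_cmul 8 (frag_cmul 2 a + q) + frag_cmul 2 (frag_cmul 4 q - t)
      + frag_cmul 1 (frag_cmul 2 t) - frag_cmul 5 (frag_cmul 3 b)"
      by (rule poly_mapping_eqI) (simp add: lookup_add lookup_minus algebra_simps)
    also have "\<dots> \<in> principal"
      by (intro principal_add principal_diff principal_cmul a q t(1) b(1) *)
    finally show False using b(2) by blast
  qed
qed

end

context sextic_over_field
begin

text \<open>Rationality of a divisor rather than of its class, with no condition on the degree: in
  this form it is stable under sums and differences, and H can be subtracted at the end.\<close>

definition galois_rational :: "('k alg_closure curve_point \<Rightarrow>\<^sub>0 int) \<Rightarrow> bool" where
  "galois_rational E \<longleftrightarrow> Poly_Mapping.keys E \<subseteq> C \<and>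
     (\<forall>P\<in>Poly_Mapping.keys E. set_curve_point P \<subseteq> separable_closure) \<and>
     (\<forall>\<sigma>\<in>field_automorphisms_over_base. galois_act \<sigma> E = E)"

lemma galois_rational_add: "galois_rational E \<Longrightarrow> galois_rational F \<Longrightarrow> galois_rational (E + F)"
  using Poly_Mapping.keys_add[of E F] unfolding galois_rational_def galois_act_add
  by (intro conjI ballI) (blast, blast, simp)

lemma galois_rational_diff: "galois_rational E \<Longrightarrow> galois_rational F \<Longrightarrow> galois_rational (E - F)"
  using keys_diff[of E F] unfolding galois_rational_def galois_act_diff
  by (intro conjI ballI) (blast, blast, simp)

lemma two_base: "(2::'k) \<noteq> 0"
  using two by (metis to_ac_eq_0_iff to_ac_numeral)

lemma galois_rational_frag_of:
  assumes "to_ac d\<^sub>0 * (to_ac \<beta>)^2 = poly (map_poly to_ac f\<^sub>0) (to_ac \<alpha>)"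
  shows "galois_rational (frag_of (Affine (to_ac \<alpha>) (to_ac \<beta>)))"
proof -
  have sep: "to_ac x \<in> separable_closure" for x :: 'k
    using separable_closure_quadratic[OF two_base, of 0 0 x 0] by simp
  show ?thesis using assms sep
    by (simp add: galois_rational_def keys_frag_of galois_act_frag_of field_automorphisms_over_base_def)
qed

lemma galois_rational_H: "galois_rational H"
proof -
  have "gam^2 = to_ac (coeff f\<^sub>0 6 / d\<^sub>0)"
    using gam d by (simp add: to_ac.coeff_map field_simps)
  from separable_closure_quadratic[OF two_base this, of 0 1] separable_closure_quadratic[OF two_base this, of 0 "- 1"]
  have "gam \<in> separable_closure" "- gam \<in> separable_closure" by simp_all
  moreover have "Poly_Mapping.keys H \<subseteq> {At_Infinity gam, At_Infinity (- gam)}"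
    using Poly_Mapping.keys_add[of "frag_of (At_Infinity gam)" "frag_of (At_Infinity (- gam))"]
    by (auto simp: H_def keys_frag_of)
  ultimately show ?thesis
    using keys_H curve_automorphism.galois_act_H[OF automorphism] unfolding galois_rational_def by fastforce
qed

text \<open>The roots of a polynomial of degree at most 2 lie in quadratic extensions of K, and a
  point at infinity in the support has its coordinate in K. Invariance holds because a and m have
  coefficients in K.\<close>

lemma galois_rational_graph_divisor:
  assumes a: "a \<noteq> 0" "degree a \<le> 2"
    and keys: "Poly_Mapping.keys (graph_divisor k (map_poly to_ac a) (map_poly to_ac m)) \<subseteq> C"
  shows "galois_rational (graph_divisor k (map_poly to_ac a) (map_poly to_ac m))" (is "galois_rational ?E")
  unfolding galois_rational_def
proof (intro conjI ballI)
  fix P assume P: "P \<in> Poly_Mapping.keys ?E"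
  let ?S = "\<Sum>\<alpha>\<in>#proots (map_poly to_ac a). frag_of (Affine \<alpha> (poly (map_poly to_ac m) \<alpha>))"
  let ?I = "frag_cmul (int k - int (degree (map_poly to_ac a))) (frag_of (At_Infinity (coeff (map_poly to_ac m) 3)))"
  have "P \<in> Poly_Mapping.keys ?S \<or> P \<in> Poly_Mapping.keys ?I"
    using P Poly_Mapping.keys_add[of ?S ?I] unfolding graph_divisor_def by blast
  thus "set_curve_point P \<subseteq> separable_closure"
  proof
    assume "P \<in> Poly_Mapping.keys ?S"
    then obtain \<alpha> where \<alpha>: "P = Affine \<alpha> (poly (map_poly to_ac m) \<alpha>)" "poly (map_poly to_ac a) \<alpha> = 0"
      using keys_sum_frag[of "\<lambda>\<alpha>. Affine \<alpha> (poly (map_poly to_ac m) \<alpha>)" "proots (map_poly to_ac a)"] a(1)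
      by fastforce
    obtain p q \<rho> e where x: "\<alpha> = to_ac p + to_ac q * \<rho>" "\<rho>^2 = to_ac e"
      using quadratic_root[OF two_base a \<alpha>(2)] by blast
    obtain p' q' where "poly (map_poly to_ac m) \<alpha> = to_ac p' + to_ac q' * \<rho>"
      using quadratic_extension_poly[OF x] by blast
    thus ?thesis using x separable_closure_quadratic[OF two_base x(2)] by (simp add: \<alpha>(1))
  next
    assume "P \<in> Poly_Mapping.keys ?I"
    hence "P = At_Infinity (to_ac (coeff m 3))"
      using keys_cmul by (fastforce simp: keys_frag_of to_ac.coeff_map)
    thus ?thesis using separable_closure_quadratic[OF two_base, of 0 0 "coeff m 3" 0] by simp
  qed
next
  fix \<sigma> :: "'k alg_closure \<Rightarrow> 'k alg_closure" assume \<sigma>: "\<sigma> \<in> field_automorphisms_over_base"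
  interpret \<sigma>: curve_automorphism "to_ac d\<^sub>0" "map_poly to_ac f\<^sub>0" \<sigma>
    by (rule automorphism[OF \<sigma>])
  show "galois_act \<sigma> ?E = ?E"
    by (intro \<sigma>.galois_act_graph_divisor fixes_map_poly \<sigma>)
qed (rule keys)

lemma norm_y_map: "norm_y (map_poly to_ac m) = map_poly to_ac (smult d\<^sub>0 (m^2) - f\<^sub>0)"
  by (simp add: norm_y_def to_ac.map_diff to_ac.map_smult to_ac.map_power)

lemma jacobian_point_of_order_48:
  assumes rat: "galois_rational E" "divisor_degree E = 0"
    and ord: "frag_cmul 48 E \<in> principal" "frag_cmul 24 E \<notin> principal" "frag_cmul 16 E \<notin> principal"
  shows "\<exists>P \<in> carrier (jacobian_rational_points d\<^sub>0 f\<^sub>0).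
    group.ord (jacobian_rational_points d\<^sub>0 f\<^sub>0) P = 48"
proof (rule order_48[OF _ _ ord])
  show "Poly_Mapping.keys E \<subseteq> C" using rat by (simp add: galois_rational_def)
  show "cls E \<in> rational"
    by (rule rational_cls) (use rat in \<open>auto simp: galois_rational_def\<close>)
qed

end

subsection \<open>The double cover of a constant elliptic curve\<close>

lemma order_eq_1:
  fixes p :: "'a::idom poly"
  assumes "poly p a = 0" "poly (pderiv p) a \<noteq> 0"
  shows "order a p = 1"
proof -
  obtain q where q: "p = [:- a, 1:] * q" using assms(1) by (auto simp: poly_eq_0_iff_dvd)
  have "poly q a \<noteq> 0" using assms(2) unfolding q pderiv_mult by (simp add: pderiv_pCons)
  moreover have "p \<noteq> 0" using assms(2) by auto
  ultimately show ?thesis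
    using order_mult[of "[:- a, 1:]" q a] by (simp add: q order_0I order_linear del: mult_pCons_left)
qed

text \<open>
  With \<open>x\<^sup>2 = u + d \<xi>\<close> and \<open>y = d \<eta>\<close> the curve is a double cover of the fixed elliptic curve
  \<open>\<eta>\<^sup>2 = \<xi> (\<xi>\<^sup>2 - 31 \<xi> + 256)\<close>, on which \<open>(8, 24)\<close> has order 8. Its multiples \<open>-2 (8, 24) = (16, 16)\<close>
  and \<open>4 (8, 24) = (0, 0)\<close> are cut out by the tangents \<open>\<eta> = 32 - \<xi>\<close> and \<open>\<eta> = \<xi>\<close>.
\<close>

locale double_cover =
  fixes d u :: "'k::field" and f :: "'k poly"
  assumes char: "(2::'k) \<noteq> 0" "(7::'k) \<noteq> 0" "(3::'k) \<noteq> 0"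
    and d_neq_0: "d \<noteq> 0"
    and f_def: "f = [:- (u^3) - 31*d*u^2 - 256*d^2*u, 0, 3*u^2 + 62*d*u + 256*d^2, 0, -3*u - 31*d, 0, 1:]"
    and const: "- (u^3) - 31*d*u^2 - 256*d^2*u \<noteq> 0"
begin

lemma u_neq_0: "u \<noteq> 0"
  using const by auto

lemma poly_f: "poly (map_poly to_ac f) x = (x^2 - to_ac u) *
  ((x^2 - to_ac u)^2 - 31 * to_ac d * (x^2 - to_ac u) + 256 * (to_ac d)^2)"
  by (simp add: f_def) Groebner_Basis.algebra

lemma f_simple_root:
  assumes "poly (map_poly to_ac f) x = 0"
  shows "order x (map_poly to_ac f) = 1"
proof (rule order_eq_1[OF assms])
  define D U where "D = to_ac d" and "U = to_ac u"
  define z where "z = x^2 - U"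
  have f: "poly (map_poly to_ac f) x = z * (z^2 - 31*D*z + 256*D^2)"
    by (simp add: poly_f D_def U_def z_def)
  have f': "poly (pderiv (map_poly to_ac f)) x = 2 * x * (3*z^2 - 62*D*z + 256*D^2)"
    by (simp add: f_def D_def U_def z_def pderiv_pCons) Groebner_Basis.algebra
  have nz: "(2::'k alg_closure) \<noteq> 0" "(3::'k alg_closure) \<noteq> 0" "(7::'k alg_closure) \<noteq> 0" "D \<noteq> 0"
    using char d_neq_0 by (simp_all add: D_def flip: to_ac_numeral)
  have "x \<noteq> 0"
  proof
    assume "x = 0"
    hence "to_ac (- (u^3) - 31*d*u^2 - 256*d^2*u) = 0" using assms by (simp add: f_def)
    thus False using const by (simp only: to_ac_eq_0_iff)
  qed
  moreover have "3*z^2 - 62*D*z + 256*D^2 \<noteq> 0"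
  proof
    assume *: "3*z^2 - 62*D*z + 256*D^2 = 0"
    from assms consider "z = 0" | "z^2 - 31*D*z + 256*D^2 = 0" unfolding f by auto
    \<comment> \<open>256 is the value of \<xi>^2 - 31 \<xi> + 256 at the root \<xi> = 0 of the
      cubic, and - 63 = 31^2 - 4 * 256 is its discriminant; a multiple root would need
      characteristic 2, 3 or 7.\<close>
    hence "2^8 * D^2 * (7 * 3^2) = 0"
    proof cases
      case 1
      thus ?thesis using * by Groebner_Basis.algebra
    next
      case 2
      have "D * (31 * z - 512 * D) = 0" using * 2 by Groebner_Basis.algebra
      hence "31 * z = 512 * D" using nz by simp
      thus ?thesis using 2 by Groebner_Basis.algebra
    qed
    thus False using nz by (metis mult_eq_0_iff power_not_zero)
  qed
  ultimately show "poly (pderiv (map_poly to_ac f)) x \<noteq> 0" unfolding f' using nz by simp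
qed

sublocale sextic_over_field d f
proof unfold_locales
  show "(2::'k alg_closure) \<noteq> 0" using char by (simp flip: to_ac_numeral)
  show "to_ac d \<noteq> 0" using d_neq_0 by simp
  show "degree (map_poly to_ac f) = 6" by (simp add: f_def)
  show "order a (map_poly to_ac f) = 1" if "poly (map_poly to_ac f) a = 0" for a
    by (rule f_simple_root[OF that])
qed

abbreviation graph :: "'k poly \<Rightarrow> 'k poly \<Rightarrow> ('k alg_closure curve_point \<Rightarrow>\<^sub>0 int)" where
  "graph a m \<equiv> graph_divisor 2 (map_poly to_ac a) (map_poly to_ac m)"

lemma graph_relation:
  assumes "degree m \<le> 3" and "smult d (m^2) - f = smult c (a1 * a2 * a3)"
    and "degree a1 \<le> 2" "degree a2 \<le> 2" "degree a3 \<le> 2"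
  shows "graph a1 m + graph a2 m + graph a3 m - frag_cmul 3 H \<in> principal"
    and "Poly_Mapping.keys (graph a1 m) \<subseteq> C" "Poly_Mapping.keys (graph a2 m) \<subseteq> C"
    "Poly_Mapping.keys (graph a3 m) \<subseteq> C"
proof -
  have "norm_y (map_poly to_ac m) = smult (to_ac c) (map_poly to_ac a1 * map_poly to_ac a2 * map_poly to_ac a3)"
    unfolding norm_y_map assms(2) by (simp add: to_ac.map_smult to_ac.map_mult)
  from three_quadratics[OF _ this] assms
  show "graph a1 m + graph a2 m + graph a3 m - frag_cmul 3 H \<in> principal"
    "Poly_Mapping.keys (graph a1 m) \<subseteq> C" "Poly_Mapping.keys (graph a2 m) \<subseteq> C"
    "Poly_Mapping.keys (graph a3 m) \<subseteq> C" by simp_all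
qed

text \<open>In the coordinate \<xi> of the elliptic curve this polynomial is d (\<xi> - k), so its
  roots are the x-coordinates over \<xi> = k.\<close>

definition fibre :: "'k \<Rightarrow> 'k poly" where
  "fibre k = [:- (u + k * d), 0, 1:]"

text \<open>\<open>Q8\<close>, \<open>Q4\<close> and \<open>Q2\<close> are the pullbacks of (8, 24),
  (16, 16) and (0, 0). The graphs are d (32 - \<xi>) and d \<xi> written in x, and the index is the
  order of the class obtained by subtracting H.\<close>

definition Q8 where "Q8 = graph (fibre 8) [:32*d + u, 0, -1:]"
definition Q4 where "Q4 = graph (fibre 16) [:32*d + u, 0, -1:]"
definition Q2 where "Q2 = graph (fibre 0) [:- u, 0, 1:]"

text \<open>Allows the same divisor to be cut out by different graphs, so that relations coming from
  different functions can be combined.\<close>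

lemma graph_fibre_cong:
  assumes "\<And>x. x^2 = to_ac (u + k * d) \<Longrightarrow> poly (map_poly to_ac m) x = poly (map_poly to_ac m') x"
  shows "graph (fibre k) m = graph (fibre k) m'"
proof (rule graph_divisor_cong)
  fix x assume "poly (map_poly to_ac (fibre k)) x = 0"
  hence "x * x - to_ac (u + k * d) = 0" by (simp add: fibre_def algebra_simps)
  thus "poly (map_poly to_ac m) x = poly (map_poly to_ac m') x"
    by (intro assms) (simp add: power2_eq_square)
qed (simp_all add: fibre_def)

text \<open>On the elliptic curve, (32 - \<xi>)^2 minus the cubic is -(\<xi> - 8)^2 (\<xi> -
  16).\<close>

lemma double_Q8: "frag_cmul 2 Q8 + Q4 - frag_cmul 3 H \<in> principal"
proof -
  have "smult d ([:32*d + u, 0, -1:]^2) - f = smult (-1) (fibre 8 * fibre 8 * fibre 16)"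
    unfolding f_def fibre_def power2_eq_square
    by (simp; intro conjI; Groebner_Basis.algebra)
  from graph_relation(1)[OF _ this] show ?thesis
    by (simp add: Q8_def Q4_def fibre_def frag_cmul_distrib[of 1 1, simplified])
qed

lemma double_Q4: "Q2 + frag_cmul 2 Q4 - frag_cmul 3 H \<in> principal"
proof -
  have "smult d ([:- u, 0, 1:]^2) - f = smult (-1) (fibre 0 * fibre 16 * fibre 16)"
    unfolding f_def fibre_def power2_eq_square
    by (simp; intro conjI; Groebner_Basis.algebra)
  from graph_relation(1)[OF _ this]
  have "Q2 + graph (fibre 16) [:- u, 0, 1:] + graph (fibre 16) [:- u, 0, 1:] - frag_cmul 3 H \<in> principal"
    by (simp add: Q2_def fibre_def)
  moreover have "graph (fibre 16) [:- u, 0, 1:] = Q4"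
    unfolding Q4_def by (rule graph_fibre_cong) (simp add: power2_eq_square)
  ultimately show ?thesis by (simp add: frag_cmul_distrib[of 1 1, simplified] add.assoc)
qed

lemma Q2_eq:
  obtains r where "r \<noteq> 0" "r^2 = to_ac u" "Q2 = frag_of (Affine r 0) + frag_of (Affine (- r) 0)"
proof -
  obtain r where r: "r^2 = to_ac u" using nth_root_exists[of 2 "to_ac u"] by auto
  have "map_poly to_ac (fibre 0) = [:- r, 1:] * [:- (- r), 1:]"
    using r by (simp add: fibre_def power2_eq_square)
  hence "proots (map_poly to_ac (fibre 0)) = {#r, - r#}"
    by (simp only: proots_mult) (subst proots_mult; simp)
  hence "Q2 = frag_of (Affine r 0) + frag_of (Affine (- r) 0)"
    using r by (simp add: Q2_def graph_divisor_def fibre_def power2_eq_square)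
  moreover have "r \<noteq> 0" using r u_neq_0 by auto
  ultimately show ?thesis using that r by blast
qed

lemma root_in_C: "r^2 = to_ac u \<Longrightarrow> Affine r 0 \<in> C"
  by (simp add: poly_f)

text \<open>Both points of \<open>Q2\<close> are branch points, so twice either of them is
  equivalent to H.\<close>

lemma Q2_torsion: "frag_cmul 2 (Q2 - H) \<in> principal"
proof -
  obtain r where r: "r \<noteq> 0" "r^2 = to_ac u" "Q2 = frag_of (Affine r 0) + frag_of (Affine (- r) 0)"
    by (rule Q2_eq)
  have "frag_of (Affine r 0) + frag_of (Affine r (- 0)) - H \<in> principal"
    "frag_of (Affine (- r) 0) + frag_of (Affine (- r) (- 0)) - H \<in> principal"
    using root_in_C[of r] root_in_C[of "- r"] r by (intro principal_vertical; simp)+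
  from principal_add[OF this] show ?thesis
    by (rule back_subst[of "\<lambda>E. E \<in> principal"])
      (rule poly_mapping_eqI, simp add: r(3) lookup_add lookup_minus)
qed

text \<open>The branch point (r, 0) is its own conjugate and differs from (- r, 0), because r is
  nonzero and the characteristic is not 2.\<close>

lemma Q2_not_principal: "Q2 - H \<notin> principal"
proof
  assume pr: "Q2 - H \<in> principal"
  obtain r where r: "r \<noteq> 0" "r^2 = to_ac u" "Q2 = frag_of (Affine r 0) + frag_of (Affine (- r) 0)"
    by (rule Q2_eq)
  have "Affine (- r) 0 = iota (Affine r 0)"
    using pair_not_principal[OF root_in_C[of r] root_in_C[of "- r"]] r pr by simp
  hence "- r = r" by simp
  hence "2 * r = 0" by (metis add.right_inverse mult_2)
  thus False using r(1) two by simp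
qed

text \<open>Coefficients of 1, x^2 and x^4 in 8 (d m^2 - f) = - (x^2 - v) (n x^2 - 8 d k x + A)^2,
  where m = 24 d + (x^2 - v) (k x + n). The odd coefficients agree identically, and that of x^6 is
  the first hypothesis.\<close>

lemma halving_identities:
  assumes k: "8 * d * k^2 = 8 - n^2" and n: "(u + 8*d) * (n^2 - 8) = d * (48 * n + 120)"
  defines "v \<equiv> u + 8*d" and "A \<equiv> 24*d - n*(u + 8*d)"
  shows "8*(d*A^2+u^3+31*d*u^2+256*d^2*u) = v*A^2"
    and "8*(d*(2*A*n + k^2*v^2) - (3*u^2+62*d*u+256*d^2)) = -(A^2 - v*((8*d*k)^2+2*A*n))"
    and "8*(d*(n^2-2*k^2*v)+3*u+31*d) = -((8*d*k)^2+2*A*n - v*n^2)"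
proof -
  have A: "A = 24*d - n*v" by (simp add: A_def v_def)
  have n: "v * n^2 = 8 * v + d * (48 * n + 120)" using n by (simp add: v_def algebra_simps)
  have u: "u = v - 8*d" by (simp add: v_def)
  have "A^2 = 576*d^2 - 48*d*n*v + v * (v * n^2)" unfolding A by Groebner_Basis.algebra
  hence sq: "A^2 = 8*v^2 + 120*v*d + 576*d^2" unfolding n by Groebner_Basis.algebra
  have "8*d*k^2*v^2 = v * (8 * v - v * n^2)" unfolding k by Groebner_Basis.algebra
  hence kv: "8*d*k^2*v^2 = - v*d*(48*n+120)" unfolding n by Groebner_Basis.algebra
  show "8*(d*A^2+u^3+31*d*u^2+256*d^2*u) = v*A^2" unfolding sq unfolding u by Groebner_Basis.algebra
  have An: "A * n = 24*d*n - v * n^2" by (simp add: A algebra_simps power2_eq_square)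
  have k2: "(8*d*k)^2 = 8*d*(8 - n^2)" unfolding k[symmetric] by Groebner_Basis.algebra
  have "8*(d*(2*A*n + k^2*v^2) - (3*u^2+62*d*u+256*d^2)) = 16*d*(A*n) + 8*d*k^2*v^2 - 8*(3*u^2+62*d*u+256*d^2)"
    by Groebner_Basis.algebra
  also have "\<dots> = - (A^2) + 64*d*v - 8*d*(v*n^2) + 2*v*(A * n)"
    unfolding kv sq An n unfolding u by Groebner_Basis.algebra
  also have "\<dots> = -(A^2 - v*(8*d*(8-n^2)+2*A*n))" by Groebner_Basis.algebra
  finally show "8*(d*(2*A*n + k^2*v^2) - (3*u^2+62*d*u+256*d^2)) = -(A^2 - v*((8*d*k)^2+2*A*n))"
    unfolding k2 .
  have "8*(d*(n^2-2*k^2*v)+3*u+31*d) = 8*d*n^2 - 2*(8*d*k^2)*v + 24*u+248*d" by Groebner_Basis.algebra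
  also have "\<dots> = -(8*d*(8-n^2)+2*(A*n) - v*n^2)"
    unfolding k An using n u by Groebner_Basis.algebra
  finally show "8*(d*(n^2-2*k^2*v)+3*u+31*d) = -((8*d*k)^2+2*A*n - v*n^2)"
   unfolding k2 by (simp add: mult.assoc)
qed

text \<open>On x^2 = u + 8 d the cubic m takes the value 24 d, so y = m passes through the two
  points of \<open>Q8\<close>. The other four intersections form a divisor counted twice, cut out by
  a, and that divisor is E.\<close>

lemma half_of_Q8_generic:
  assumes k: "8 * d * k^2 = 8 - n^2" and n: "(u + 8 * d) * (n^2 - 8) = d * (48 * n + 120)"
  shows "\<exists>E. galois_rational E \<and> divisor_degree E = 2 \<and> frag_cmul 2 E + Q8 - frag_cmul 3 H \<in> principal"
proof -
  define m where "m = [:24*d - n*(u + 8*d), - k*(u + 8*d), n, k:]"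
  \<comment> \<open>The square root of the cofactor of \<open>fibre 8\<close>, up to a constant; it
    can be read off from the coefficients of x^6, x^5 and x.\<close>
  define a where "a = [:24*d - n*(u + 8*d), - 8*d*k, n:]"
  have eight: "(8::'k) \<noteq> 0"
  proof -
    have "(8::'k) = 2^3" by simp
    thus ?thesis using char(1) by (metis power_not_zero)
  qed
  have a0: "a \<noteq> 0"
  proof
    assume "a = 0"
    hence "n = 0" "24 * d = 0" by (auto simp: a_def)
    moreover have "(24::'k) = 8 * 3" by simp
    ultimately show False using eight char(3) d_neq_0 by (metis mult_eq_0_iff)
  qed
  define v A where "v = u + 8*d" and "A = 24*d - n*v"
  note ids = halving_identities[OF k n, folded v_def, folded A_def]
  have "smult 8 (smult d (m^2) - f) =
    [:8*(d*A^2+u^3+31*d*u^2+256*d^2*u), - 16*d*A*k*v,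
      8*(d*(2*A*n + k^2*v^2) - (3*u^2+62*d*u+256*d^2)), 16*d*(A*k - n*k*v),
      8*(d*(n^2-2*k^2*v)+3*u+31*d), 16*d*k*n, 8*d*k^2 - 8:]"
    unfolding m_def f_def v_def[symmetric] unfolding A_def[symmetric]
    by (simp add: algebra_simps power2_eq_square power3_eq_cube)
  also have "\<dots> = [:v*A^2, - 16*d*A*k*v, -(A^2 - v*((8*d*k)^2+2*A*n)), 16*d*(A*k - n*k*v),
      -((8*d*k)^2+2*A*n - v*n^2), 16*d*k*n, - (n^2):]"
    unfolding ids k by simp
  also have "\<dots> = smult (- 1) (fibre 8 * a * a)"
    unfolding fibre_def a_def v_def[symmetric] unfolding A_def[symmetric]
    by (simp add: algebra_simps power2_eq_square)
  finally have "smult 8 (smult d (m^2) - f) = smult (- 1) (fibre 8 * a * a)" .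
  hence "smult (1/8) (smult 8 (smult d (m^2) - f)) = smult (1/8) (smult (- 1) (fibre 8 * a * a))"
    by (rule arg_cong)
  hence rel: "smult d (m^2) - f = smult (- 1 / 8) (fibre 8 * a * a)" using eight by simp
  note R = graph_relation[OF _ rel]
  have deg: "degree m \<le> 3" "degree (fibre 8) \<le> 2" "degree a \<le> 2"
    by (simp_all add: m_def fibre_def a_def)
  have "graph (fibre 8) m = Q8"
    unfolding Q8_def by (rule graph_fibre_cong) (simp add: m_def power2_eq_square, Groebner_Basis.algebra)
  hence "frag_cmul 2 (graph a m) + Q8 - frag_cmul 3 H \<in> principal"
    using R(1)[OF deg deg(3)] by (simp add: frag_cmul_distrib[of 1 1, simplified] ac_simps)
  moreover have "galois_rational (graph a m)"
    by (rule galois_rational_graph_divisor[OF a0 deg(3) R(3)[OF deg deg(3)]])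
  moreover have "divisor_degree (graph a m) = 2"
    using divisor_degree_graph_divisor[of "map_poly to_ac a"] a0 by simp
  ultimately show ?thesis by blast
qed

text \<open>The fibre over \<xi> = 8 is now x^2 = 0, so \<open>Q8\<close> is twice the point P = (0,
  24 d). For the rational branch point R = (k, 0), twice R is equivalent to H, and E can be taken as
  the conjugate of P plus R.\<close>

lemma half_of_Q8_special:
  assumes u8: "u + 8 * d = 0" and k: "k^2 = u"
  shows "\<exists>E. galois_rational E \<and> divisor_degree E = 2 \<and> frag_cmul 2 E + Q8 - frag_cmul 3 H \<in> principal"
proof -
  let ?y = "to_ac (24 * d)"
  have u: "u = - 8 * d" using u8 by (simp add: eq_neg_iff_add_eq_0)
  have on: "to_ac d * ?y^2 = poly (map_poly to_ac f) 0"
    unfolding poly_f u by (simp add: power2_eq_square)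
  have root: "Affine (to_ac k) 0 \<in> C"
    by (rule root_in_C) (simp add: k[symmetric])
  have "map_poly to_ac (fibre 8) = [:- 0, 1:] * [:- 0, 1:]"
    using u8 by (simp add: fibre_def)
  hence "proots (map_poly to_ac (fibre 8)) = {#0, 0#}"
    by (simp only: proots_mult) (subst proots_mult; simp)
  moreover have "to_ac u = - 8 * to_ac d" by (simp add: u)
  moreover have "degree (map_poly to_ac (fibre 8)) = 2" by (simp add: fibre_def)
  ultimately have Q8: "Q8 = frag_of (Affine 0 ?y) + frag_of (Affine 0 ?y)"
    unfolding Q8_def graph_divisor_def by simp
  let ?E = "frag_of (Affine (to_ac 0) (to_ac (- (24 * d)))) + frag_of (Affine (to_ac k) (to_ac 0))"
  have v: "frag_of (Affine 0 ?y) + frag_of (Affine 0 (- ?y)) - H \<in> principal"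
    "frag_of (Affine (to_ac k) 0) + frag_of (Affine (to_ac k) (- 0)) - H \<in> principal"
    using on root by (intro principal_vertical; simp)+
  have "frag_cmul 2 ?E + Q8 - frag_cmul 3 H \<in> principal"
    by (rule back_subst[of "\<lambda>E. E \<in> principal", OF principal_add[OF principal_add[OF v(1) v(1)] v(2)]])
      (rule poly_mapping_eqI, simp add: Q8 lookup_add lookup_minus)
  moreover have "galois_rational ?E"
    using on root by (intro galois_rational_add galois_rational_frag_of) simp_all
  moreover have "divisor_degree ?E = 2" by (simp add: divisor_degree_add)
  ultimately show ?thesis by blast
qed

text \<open>The flex line pulls back to y = a x + b x^3, with d m^2 - f = - c (j x^2 + h)^3, so E is
  the divisor cut out by j x^2 + h on it. For nonzero j its two points are not conjugate, as their
  x-coordinates r and - r are different.\<close>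

lemma flex:
  assumes "d * b^2 = 1 - c * j^3" "2 * d * a * b = (-3*u - 31*d) - 3 * c * j^2 * h"
    "d * a^2 = (3*u^2 + 62*d*u + 256*d^2) - 3 * c * j * h^2"
    "- (u^3) - 31*d*u^2 - 256*d^2*u = c * h^3"
  shows "\<exists>E. galois_rational E \<and> divisor_degree E = 2 \<and>
    frag_cmul 3 (E - H) \<in> principal \<and> E - H \<notin> principal"
proof -
  define m where "m = [:0, a, 0, b:]"
  define p where "p = [:h, 0, j:]"
  have h: "h \<noteq> 0" using assms(4) const by auto
  hence p0: "p \<noteq> 0" by (simp add: p_def)
  have rel: "smult d (m^2) - f = smult (- c) (p * p * p)"
    unfolding f_def power2_eq_square m_def p_def
    by (simp; intro conjI; use assms in Groebner_Basis.algebra)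
  have deg: "degree m \<le> 3" "degree p \<le> 2" by (simp_all add: m_def p_def)
  note R = graph_relation[OF deg(1) rel deg(2) deg(2) deg(2)]
  have "frag_cmul 3 (graph p m - H) = graph p m + graph p m + graph p m - frag_cmul 3 H"
    by (rule poly_mapping_eqI) (simp add: lookup_add lookup_minus algebra_simps)
  hence "frag_cmul 3 (graph p m - H) \<in> principal" using R(1) by simp
  moreover have "galois_rational (graph p m)"
    by (rule galois_rational_graph_divisor[OF p0 deg(2) R(2)])
  moreover have "divisor_degree (graph p m) = 2"
    using divisor_degree_graph_divisor[of "map_poly to_ac p"] p0 by simp
  moreover have "graph p m - H \<notin> principal"
  proof
    assume pr: "graph p m - H \<in> principal"
    show False
    proof (cases "j = 0")
      \<comment> \<open>The flex lies at X = 0, so both points fall together at one point at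
        infinity, whose conjugate is the other one.\<close>
      case True
      have g: "graph p m = frag_of (At_Infinity (to_ac b)) + frag_of (At_Infinity (to_ac b))"
        using True by (simp add: graph_divisor_def p_def m_def frag_cmul_distrib[of 1 1, simplified]
            to_ac.coeff_map numeral_3_eq_3)
      have b: "d * b^2 = 1" using assms(1) True by simp
      have "coeff (map_poly to_ac f) 6 = 1" by (simp add: f_def eval_nat_numeral)
      moreover have "to_ac d * (to_ac b)^2 = 1" using b by (metis to_ac_1 to_ac_mult to_ac_power)
      ultimately have "At_Infinity (to_ac b) \<in> C" by simp
      from pair_not_principal[OF this this] pr g have "to_ac b = - to_ac b" by simp
      hence "2 * to_ac b = 0" by (metis add.right_inverse mult_2)
      hence "b = 0" using two by simp
      thus False using b by simp
    next
      case False
      obtain r where r: "r^2 = to_ac (- h / j)" using nth_root_exists[of 2 "to_ac (- h / j)"] by auto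
      let ?M = "map_poly to_ac m"
      have "map_poly to_ac p = smult (to_ac j) ([:- r, 1:] * [:- (- r), 1:])"
        using r False by (simp add: p_def power2_eq_square)
      hence "proots (map_poly to_ac p) = proots ([:- r, 1:] * [:- (- r), 1:])"
        using False by (simp only: proots_smult to_ac_eq_0_iff not_False_eq_True)
      also have "\<dots> = {#r, - r#}" by (subst proots_mult; simp)
      finally have g: "graph p m = frag_of (Affine r (poly ?M r)) + frag_of (Affine (- r) (poly ?M (- r)))"
        using False by (simp add: graph_divisor_def p_def)
      have "r \<noteq> 0" using r h False by auto
      hence ne: "- r \<noteq> r" using two by (metis add.right_inverse mult_2 mult_eq_0_iff)
      have "Poly_Mapping.keys (graph p m) = {Affine r (poly ?M r), Affine (- r) (poly ?M (- r))}"
        unfolding g using ne by (auto simp: in_keys_iff lookup_add split: if_splits)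
      hence "Affine r (poly ?M r) \<in> C" "Affine (- r) (poly ?M (- r)) \<in> C" using R(2) by blast+
      from pair_not_principal[OF this] pr g ne show False by simp
    qed
  qed
  ultimately show ?thesis by blast
qed

section \<open>The class of order 48 as the sum of the halved class and the flex class\<close>

lemma point_of_order_48:
  assumes "\<exists>A. galois_rational A \<and> divisor_degree A = 2 \<and> frag_cmul 2 A + Q8 - frag_cmul 3 H \<in> principal"
    and "\<exists>B. galois_rational B \<and> divisor_degree B = 2 \<and> frag_cmul 3 (B - H) \<in> principal \<and> B - H \<notin> principal"
  shows "\<exists>P \<in> carrier (jacobian_rational_points d f). group.ord (jacobian_rational_points d f) P = 48"
proof -
  obtain A where A: "galois_rational A" "divisor_degree A = 2" "frag_cmul 2 A + Q8 - frag_cmul 3 H \<in> principal"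
    using assms(1) by blast
  obtain B where B: "galois_rational B" "divisor_degree B = 2" "frag_cmul 3 (B - H) \<in> principal" "B - H \<notin> principal"
    using assms(2) by blast
  have "frag_cmul 2 (A - H) + (Q8 - H) = frag_cmul 2 A + Q8 - frag_cmul 3 H"
    by (rule poly_mapping_eqI) (simp add: lookup_add lookup_minus algebra_simps)
  hence a: "frag_cmul 2 (A - H) + (Q8 - H) \<in> principal" using A(3) by (simp only:)
  \<comment> \<open>Twice the tangent relation at (8, 24) minus the one at (16, 16);
    \<open>Q4\<close> cancels.\<close>
  have "frag_cmul 4 (Q8 - H) - (Q2 - H) =
    frag_cmul 2 (frag_cmul 2 Q8 + Q4 - frag_cmul 3 H) - (Q2 + frag_cmul 2 Q4 - frag_cmul 3 H)"
    by (rule poly_mapping_eqI) (simp add: lookup_add lookup_minus algebra_simps)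
  hence q: "frag_cmul 4 (Q8 - H) - (Q2 - H) \<in> principal"
    using principal_diff[OF principal_cmul[OF double_Q8, of 2] double_Q4] by (simp only:)
  show ?thesis
  proof (rule jacobian_point_of_order_48)
    show "galois_rational ((A - H) + (B - H))"
      by (intro galois_rational_add galois_rational_diff A(1) B(1) galois_rational_H)
    show "divisor_degree ((A - H) + (B - H)) = 0"
      using A(2) B(2) by (simp add: divisor_degree_add divisor_degree_diff divisor_degree_H)
  qed (rule torsion_48[OF a q Q2_torsion Q2_not_principal B(3,4)])+
qed

end

theorem theorem3p2:
  fixes s z w :: "'k::field"
  assumes "CHAR('k) \<notin> {2, 3, 7}"
    and "c0 s * d_coeff s \<noteq> 0"
    and "w ^ 2 = z ^ 3 + 14 * z ^ 2 + 196 * z"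
    and "z ^ 4 - 896 * z ^ 3 - 24696 * z ^ 2 - 175616 * z + 38416 \<noteq> 0"
    and "s = - 21 * (((z ^ 2 + 196) * (z ^ 2 + 56 * z + 196) + 32 * (z + 14) * (z - 14) * w)
                     / (z ^ 4 - 896 * z ^ 3 - 24696 * z ^ 2 - 175616 * z + 38416))"
  shows "\<exists>P \<in> carrier (jacobian_rational_points (d_coeff s) (C24_sextic s)).
           group.ord (jacobian_rational_points (d_coeff s) (C24_sextic s)) P = 48"
proof -
  have nz: "(of_nat p :: 'k) \<noteq> 0" if "prime p" "p \<in> {2, 3, 7}" for p
  proof
    assume "(of_nat p :: 'k) = 0"
    hence "CHAR('k) dvd p" by (simp add: of_nat_eq_0_iff_char_dvd)
    hence "CHAR('k) = 1 \<or> CHAR('k) = p" using that(1) unfolding prime_nat_iff by blast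
    thus False using assms(1) that(2) CHAR_not_1 by auto
  qed
  have small: "(2::'k) \<noteq> 0" "(3::'k) \<noteq> 0" "(7::'k) \<noteq> 0"
    using nz[of 2] nz[of 3] nz[of 7] by simp_all
  define d u where "d = d_coeff s" and "u = - 28672 * s / 3"
  have u: "3 * u = - 28672 * s" using small(2) by (simp add: u_def)
  note coeffs = sextic_coefficients[OF small(2) u, folded d_def]
  have "c0 s \<noteq> 0" "d \<noteq> 0" using assms(2) by (auto simp: d_def)
  interpret double_cover d u "C24_sextic s"
    by unfold_locales
      (use small \<open>c0 s \<noteq> 0\<close> \<open>d \<noteq> 0\<close> in \<open>simp_all only: C24_sextic_def coeffs not_False_eq_True\<close>)
  obtain v l m where vlm: "v^2 = 2 * (s^2 + 7) * (s^2 + 63)"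
    "8 * l^2 = 27 * (8*(s^2+7)*v - 11*s^4 - 462*s^2 - 392*s + 1617)"
    "8 * m^2 = 189 * (8*(s^2+7)*v + 11*s^4 + 462*s^2 + 392*s - 1617)"
    by (rule parameter_exists[OF small(1) assms(3-5)])
  from small vlm u have
    "\<exists>A. galois_rational A \<and> divisor_degree A = 2 \<and> frag_cmul 2 A + Q8 - frag_cmul 3 H \<in> principal"
  proof (rule halving_parameters)
    fix n k
    assume "8 * d_coeff s * k^2 = 8 - n^2"
      "(u + 8 * d_coeff s) * (n^2 - 8) = d_coeff s * (48*n + 120)"
    thus ?thesis unfolding d_def[symmetric] by (rule half_of_Q8_generic)
  next
    fix k assume "u + 8 * d_coeff s = 0" "k^2 = u"
    thus ?thesis unfolding d_def[symmetric] by (rule half_of_Q8_special)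
  qed
  moreover obtain a b h j c where "d * b^2 = 1 - c * j^3" "2 * d * a * b = c4 s - 3 * c * j^2 * h"
    "d * a^2 = c2 s - 3 * c * j * h^2" "c0 s = c * h^3"
    by (rule flex_parameters[OF small(1,2) \<open>c0 s \<noteq> 0\<close>, folded d_def])
  hence "\<exists>B. galois_rational B \<and> divisor_degree B = 2 \<and>
      frag_cmul 3 (B - H) \<in> principal \<and> B - H \<notin> principal"
    unfolding coeffs by (rule flex)
  ultimately show ?thesis unfolding d_def[symmetric] by (rule point_of_order_48)
qed

end
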